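(* Let $M\ge 3$ be an integer, $m:=\phi(M)$, and let $m_1,\dots,m_m$ be integers forming a set of representatives of $(\mathbb{Z}/M\mathbb{Z})^{\star}$. Let $l_1,\dots,l_m\in\mathbb{Z}_{\ge 1}$, let $a=(a_1,\dots,a_m)$ be a tuple of integers with $0\le a_i\le l_i-1$ for all $i$, and put $L:=\prod_{i=1}^m l_i$. Define $$A_a(x):=\{N\le x : N \text{ is a squarefree positive integer coprime to } M,\ n_i(N)\equiv a_i \pmod{l_i}\text{ for all } 1\le i\le m\}.$$ Then $$|A_a(x)|\sim \frac{6x}{\pi^2\cdot L\cdot \prod_{p \text{ prime},\, p\mid M}(1+p^{-1})},\qquad x\to\infty.$$
   Context: $\phi$ is the Euler totient function. For a squarefree positive integer $N$ coprime to $M$ and $1\le i\le m$, $n_i(N)$ denotes the number of prime divisors $p$ of $N$ with $p\equiv m_i\pmod M$. The notation $f(x)\sim g(x)$ means $f(x)/g(x)\to 1$ as $x\to\infty$. *)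

theory Defs
  imports Complex_Main "HOL-Library.Landau_Symbols" "HOL-Number_Theory.Number_Theory"
    "HOL-Computational_Algebra.Squarefree"
begin

text \<open>
  The family \<open>r 1, \<dots>, r (totient M)\<close> of integers represents every class of
  \<open>(\<int>/M\<int>)\<^sup>\<times>\<close> exactly once. Values of \<open>r\<close> outside \<open>{1..totient M}\<close> are irrelevant.
\<close>

definition unit_reps :: "nat \<Rightarrow> (nat \<Rightarrow> int) \<Rightarrow> bool" where
  "unit_reps M r \<longleftrightarrow>
     (\<forall>i\<in>{1..totient M}. coprime (r i) (int M)) \<and>
     (\<forall>z::int. coprime z (int M) \<longrightarrow> (\<exists>!i. i \<in> {1..totient M} \<and> [z = r i] (mod int M)))"

definition num_prime_divs :: "nat \<Rightarrow> (nat \<Rightarrow> int) \<Rightarrow> nat \<Rightarrow> nat \<Rightarrow> nat" where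
  "num_prime_divs M r i N = card {p::nat. prime p \<and> p dvd N \<and> [int p = r i] (mod int M)}"

definition A_set :: "nat \<Rightarrow> (nat \<Rightarrow> int) \<Rightarrow> (nat \<Rightarrow> int) \<Rightarrow> (nat \<Rightarrow> int) \<Rightarrow> real \<Rightarrow> nat set" where
  "A_set M r l a x =
     {N::nat. N > 0 \<and> real N \<le> x \<and> squarefree N \<and> coprime N M \<and>
        (\<forall>i\<in>{1..totient M}. [int (num_prime_divs M r i N) = a i] (mod l i))}"

end

theory Submission
  imports Defs "HOL-Complex_Analysis.Complex_Analysis" "HOL-Real_Asymp.Real_Asymp"
begin

text \<open>
  The congruences \<open>n\<^sub>i(N) \<equiv> a\<^sub>i (mod l\<^sub>i)\<close> are detected by averaging, over all tuples \<open>\<zeta>\<close> of roots of unity with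
  \<open>\<zeta>\<^sub>i\<close> of order dividing \<open>l\<^sub>i\<close>, the functions \<open>f(N) = \<Prod> \<zeta>\<^sub>i\<^bsup>n\<^sub>i(N)\<^esup>\<close> supported on squarefree \<open>N\<close> coprime to \<open>M\<close>.
  The trivial tuple contributes the density of the squarefree integers coprime to \<open>M\<close>. For any other tuple
  \<open>f\<close> has mean value zero: on average \<open>f(N) log N\<close> is the convolution of \<open>f\<close> with the von Mangoldt function
  weighted by the \<open>\<zeta>\<^sub>i\<close>, so by the prime number theorem in arithmetic progressions the sum
  \<open>T(u) = \<Sum> f(n)/n\<close> over \<open>n \<le> u\<close> approximately solves \<open>T' = \<tau> T / (u log u)\<close>, where \<open>\<tau>\<close> is the mean of the
  \<open>\<zeta>\<^sub>i\<close>. Since \<open>Re \<tau> < 1\<close>, \<open>T(u) = o(log u)\<close>, and the mean value of \<open>f\<close> up to \<open>u\<close> is \<open>\<tau> T(u) / log u + o(1)\<close>.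
  The prime number theorem is obtained by Newman's contour integral, from the non-vanishing of
  \<open>L(s, \<xi>)\<close> on the line \<open>Re s = 1\<close>.
\<close>

section \<open>Newman's Tauberian theorem\<close>

text \<open>The mean \<tau> may lie anywhere in the closed unit disc, so \<open>f\<close> has no
  positivity to exploit. What takes its place is that a first-order equation with coefficient \<tau>
  lets solutions grow only like (log u) to the power Re \<tau>, and Re \<tau> < 1 is strict as soon
  as one root of unity differs from 1. The prime number theorem enters with its full error o(n): a
  Chebyshev bound O(n) would leave an error of the order of the main term.

  The analytic tools are ordered so that each meets only what it can treat. Newman's theorem accepts
  the complex sums of a single character but yields only a convergent series. Turning convergence
  into an asymptotic needs monotonicity, which only the sum over a residue class has, so
  orthogonality is applied in between. The inequality used for non-vanishing fails in exactly one
  case, at s = 1 with the square of \<xi> principal; that case gets a separate elementary argument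
  on real characters.

  Integrals over x \<ge> 1 are replaced by sums over unit intervals, weighted with the functions
  \<open>cell n\<close>, so that partial sums are finite sums of entire functions.\<close>

definition cell :: "nat \<Rightarrow> complex \<Rightarrow> complex" where
  "cell n s = (if s = 0 then deriv (\<lambda>s. of_nat n powr (-s) - of_nat (Suc n) powr (-s)) 0
     else (of_nat n powr (-s) - of_nat (Suc n) powr (-s)) / s)"

lemma cell_nonzero: "s \<noteq> 0 \<Longrightarrow> cell n s = (of_nat n powr (-s) - of_nat (Suc n) powr (-s)) / s"
  by (simp add: cell_def)

lemma cell_holomorphic:
  assumes "n > 0"
  shows "cell n holomorphic_on UNIV"
proof -
  let ?f = "\<lambda>s::complex. of_nat n powr (-s) - of_nat (Suc n) powr (-s)"
  have "?f holomorphic_on UNIV"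
    using assms by (intro holomorphic_intros) (auto simp: complex_nonpos_Reals_iff)
  from pole_lemma_open[OF this open_UNIV, of 0]
  have "(\<lambda>z. if z = 0 then deriv ?f 0 else (?f z - ?f 0) / (z - 0)) holomorphic_on UNIV" .
  moreover have "(\<lambda>z. if z = 0 then deriv ?f 0 else (?f z - ?f 0) / (z - 0)) = cell n"
    using assms by (auto simp: cell_def fun_eq_iff simp del: of_nat_Suc)
  ultimately show ?thesis by simp
qed

lemma cell_zero:
  assumes "n > 0"
  shows "cell n 0 = Ln (of_nat (Suc n)) - Ln (of_nat n)"
proof -
  have "((\<lambda>s. of_nat n powr (-s) - of_nat (Suc n) powr (-s)) has_field_derivative
      (Ln (of_nat (Suc n)) - Ln (of_nat n))) (at (0::complex))"
  proof -
    have "((\<lambda>s. c powr (-s)) has_field_derivative - Ln c) (at 0)" if "c \<noteq> 0" for c :: complex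
      unfolding powr_def using that by (auto intro!: derivative_eq_intros)
    from DERIV_diff[OF this this, of "of_nat n" "of_nat (Suc n)"] assms
    show ?thesis by (simp del: of_nat_Suc)
  qed
  thus ?thesis unfolding cell_def by (simp add: DERIV_imp_deriv)
qed

text \<open>This is what \<open>cell n s\<close> stands for: the integral of
  \<open>x powr (-s-1)\<close> over [n, n+1]. A series of \<open>A n * cell n s\<close> is thus the
  integral of the step function with value \<open>A n\<close> on that interval, and the patched
  value at \<open>s = 0\<close> is the logarithmic antiderivative.\<close>

lemma cell_has_integral:
  assumes "n > 0"
  shows "((\<lambda>x. of_real x powr (-s-1)) has_integral cell n s) {real n..real (Suc n)}"
proof -
  define F where "F = (\<lambda>z. if s = 0 then Ln z else - (z powr (-s)) / s)"
  have "((\<lambda>x. of_real x powr (-s-1)) has_integral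
      (F (complex_of_real (real (Suc n))) - F (complex_of_real (real n)))) {real n..real (Suc n)}"
  proof (rule fundamental_theorem_of_calculus)
    fix x assume x: "x \<in> {real n..real (Suc n)}"
    hence "x > 0" using assms by auto
    have "(F has_field_derivative (complex_of_real x powr (-s-1))) (at (of_real x))"
    proof (cases "s = 0")
      case True
      have "(Ln has_field_derivative inverse (complex_of_real x)) (at (of_real x))"
        using \<open>x > 0\<close> by (intro has_field_derivative_Ln) (auto simp: complex_nonpos_Reals_iff)
      thus ?thesis using True \<open>x > 0\<close> by (simp add: F_def powr_minus)
    next
      case False
      have "((\<lambda>z. - (z powr (-s)) / s) has_field_derivative (complex_of_real x powr (-s-1))) (at (of_real x))"
        using \<open>x > 0\<close> False
        by (auto intro!: derivative_eq_intros simp: complex_nonpos_Reals_iff field_simps)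
      thus ?thesis using False by (simp add: F_def)
    qed
    moreover have "(complex_of_real has_vector_derivative 1) (at x)"
      using has_vector_derivative_of_real[OF DERIV_ident, of "at x"] by simp
    ultimately have "(F \<circ> complex_of_real has_vector_derivative 1 * (complex_of_real x powr (-s-1))) (at x)"
      by (intro field_vector_diff_chain_at)
    thus "((\<lambda>x. F (complex_of_real x)) has_vector_derivative (of_real x powr (-s-1))) (at x within {real n..real (Suc n)})"
      by (auto intro: has_vector_derivative_at_within simp: o_def)
  qed auto
  also have "F (complex_of_real (real (Suc n))) - F (complex_of_real (real n)) = cell n s"
    using assms cell_zero[of n] by (auto simp: F_def cell_nonzero field_simps simp del: of_nat_Suc)
  finally show ?thesis .
qed

text \<open>The factor n is moved under the integral and replaced by x. The right-hand side is then
  a difference of consecutive values, so that the bounds of neighbouring cells telescope, on either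
  side of the line Re s = 1. This matches coefficients of size O(n).\<close>

lemma cell_bound_diff:
  assumes "n > 0" "Re s \<noteq> 1"
  shows "real n * norm (cell n s) \<le>
    (real (Suc n) powr (1 - Re s) - real n powr (1 - Re s)) / (1 - Re s)"
proof -
  have i1: "((\<lambda>x. of_nat n * of_real x powr (-s-1)) has_integral of_nat n * cell n s) {real n..real (Suc n)}"
    by (intro has_integral_mult_right cell_has_integral assms)
  have i2: "((\<lambda>x. x powr (- Re s)) has_integral
      (real (Suc n) powr (1 - Re s) / (1 - Re s) - real n powr (1 - Re s) / (1 - Re s)))
      {real n..real (Suc n)}"
  proof (rule fundamental_theorem_of_calculus)
    fix x assume x: "x \<in> {real n..real (Suc n)}"
    hence "x > 0" using assms by auto
    have "((\<lambda>z. z powr (1 - Re s) / (1 - Re s)) has_field_derivative (x powr (-Re s))) (at x)"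
      using DERIV_cdivide[OF has_real_derivative_powr[OF \<open>x > 0\<close>, of "1 - Re s"], of "1 - Re s"] assms(2)
      by simp
    thus "((\<lambda>z. z powr (1 - Re s) / (1 - Re s)) has_vector_derivative (x powr (-Re s)))
       (at x within {real n..real (Suc n)})"
      by (simp add: has_real_derivative_iff_has_vector_derivative has_vector_derivative_at_within)
  qed auto
  have "norm (integral {real n..real (Suc n)} (\<lambda>x. of_nat n * of_real x powr (-s-1)))
      \<le> integral {real n..real (Suc n)} (\<lambda>x. x powr (- Re s))"
  proof (rule integral_norm_bound_integral)
    fix x assume x: "x \<in> {real n..real (Suc n)}"
    hence "x > 0" using assms by auto
    have "norm (of_nat n * complex_of_real x powr (-s-1)) = real n * x powr (- Re s - 1)"
      using \<open>x > 0\<close> by (simp add: norm_mult norm_powr_real_powr)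
    also have "\<dots> \<le> x * x powr (- Re s - 1)"
      using x by (intro mult_right_mono) auto
    also have "\<dots> = x powr (- Re s)"
      using \<open>x > 0\<close> by (simp add: powr_diff)
    finally show "norm (of_nat n * complex_of_real x powr (-s-1)) \<le> x powr (- Re s)" .
  qed (use i1 i2 in \<open>auto intro: has_integral_integrable\<close>)
  thus ?thesis
    unfolding integral_unique[OF i1] integral_unique[OF i2]
    by (simp add: norm_mult diff_divide_distrib)
qed

lemma cell_bound_power:
  assumes "n > 0" "Re s \<ge> -1"
  shows "norm (cell n s) \<le> real n powr (- Re s - 1)"
proof -
  have "norm (cell n s) \<le> real n powr (- Re s - 1) * measure lborel (cbox (real n) (real (Suc n)))"
  proof (rule has_integral_bound)
    show "((\<lambda>x. of_real x powr (-s-1)) has_integral cell n s) (cbox (real n) (real (Suc n)))"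
      using cell_has_integral[OF assms(1)] by simp
    fix x assume x: "x \<in> cbox (real n) (real (Suc n))"
    hence "x > 0" using assms by auto
    have "norm (complex_of_real x powr (-s-1)) = x powr (- Re s - 1)"
      using \<open>x > 0\<close> by (simp add: norm_powr_real_powr)
    also have "\<dots> \<le> real n powr (- Re s - 1)"
      using x assms by (intro powr_mono2') auto
    finally show "norm (complex_of_real x powr (-s-1)) \<le> real n powr (- Re s - 1)" .
  qed auto
  thus ?thesis by simp
qed

text \<open>Split h z / z into the difference quotient of \<open>h\<close>, which is holomorphic on
  the convex set and integrates to 0, and h 0 / z. The return path \<gamma> is left general because
  the lemma serves twice: for a function that continues only slightly to the left of the imaginary
  axis, and for an entire one.\<close>

lemma half_circle_cauchy:
  fixes h :: "complex \<Rightarrow> complex"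
  assumes V: "open V" "convex V" "h holomorphic_on V" "0 \<in> V" and R: "R > 0"
    and right: "path_image (part_circlepath 0 R (-(pi/2)) (pi/2)) \<subseteq> V"
    and \<gamma>: "valid_path \<gamma>" "pathstart \<gamma> = \<i> * R" "pathfinish \<gamma> = - \<i> * R"
      "path_image \<gamma> \<subseteq> V" "path_image \<gamma> \<inter> \<real>\<^sub>\<ge>\<^sub>0 = {}"
  shows "contour_integral (part_circlepath 0 R (-(pi/2)) (pi/2)) (\<lambda>z. h z / z)
    + contour_integral \<gamma> (\<lambda>z. h z / z) = 2 * pi * \<i> * h 0"
proof -
  let ?r = "part_circlepath 0 R (-(pi/2)) (pi/2)"
  let ?l = "part_circlepath 0 R (pi/2) (3*pi/2)"
  define F where "F = (\<lambda>z. if z = 0 then deriv h 0 else (h z - h 0) / (z - 0))"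
  have F: "F holomorphic_on V"
    unfolding F_def by (rule pole_lemma_open) (use V in auto)
  have e1: "exp (\<i> * complex_of_real (pi/2)) = \<i>"
    using cis_pi_half by (simp add: cis_conv_exp)
  have e2: "exp (\<i> * complex_of_real (-(pi/2))) = -\<i>"
    using cis_minus_pi_half by (simp add: cis_conv_exp)
  have e3: "exp (\<i> * complex_of_real (3*pi/2)) = -\<i>"
  proof -
    have eq: "\<i> * complex_of_real (3*pi/2) = \<i> * complex_of_real (-(pi/2)) + 2 * of_real pi * \<i>"
      by (simp add: field_simps)
    show ?thesis unfolding eq exp_add e2 by simp
  qed
  have ends: "pathstart ?r = -\<i>*R" "pathfinish ?r = \<i>*R" "pathstart ?l = \<i>*R" "pathfinish ?l = -\<i>*R"
    using e1 e2 e3 by (simp_all add: mult.commute)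
  have rn0: "0 \<notin> path_image ?r" "0 \<notin> path_image ?l"
    using R by (auto dest: in_path_image_part_circlepath)
  have ln0: "0 \<notin> path_image \<gamma>" using \<gamma>(5) by auto
  \<comment> \<open>The branch Ln (- z), cut along the nonnegative reals, makes the integral of 1 /
    z depend on the end points only. Hence \<gamma> may be exchanged for the left semicircle, where
    the integral is explicit.\<close>
  have prim: "((\<lambda>z. 1 / z) has_contour_integral (Ln (- pathfinish g) - Ln (- pathstart g))) g"
    if "valid_path g" "path_image g \<inter> \<real>\<^sub>\<ge>\<^sub>0 = {}" for g
  proof (rule contour_integral_primitive)
    show "path_image g \<subseteq> - \<real>\<^sub>\<ge>\<^sub>0" using that by auto
    fix x :: complex assume x: "x \<in> - \<real>\<^sub>\<ge>\<^sub>0"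
    hence "- x \<notin> \<real>\<^sub>\<le>\<^sub>0" by (auto simp: complex_nonpos_Reals_iff complex_nonneg_Reals_iff)
    moreover have "x \<noteq> 0" using x by auto
    ultimately show "((\<lambda>z. Ln (- z)) has_field_derivative 1 / x) (at x within - \<real>\<^sub>\<ge>\<^sub>0)"
      by (auto intro!: derivative_eq_intros simp: field_simps)
  qed (use that in auto)
  have l_im: "path_image ?l \<inter> \<real>\<^sub>\<ge>\<^sub>0 = {}"
  proof -
    have False if "x \<in> {pi/2..3*pi/2}" "0 + R * exp (\<i> * complex_of_real x) \<in> \<real>\<^sub>\<ge>\<^sub>0" for x
    proof -
      from that(2) have "R * cos x \<ge> 0" "R * sin x = 0"
        by (auto simp: complex_nonneg_Reals_iff Re_exp Im_exp)
      hence "cos x \<ge> 0" "sin x = 0" using R by (auto simp: zero_le_mult_iff)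
      moreover have "cos (x - pi) \<ge> 0" using that(1) by (intro cos_ge_zero) auto
      ultimately have "cos x = 0" "sin x = 0" by auto
      thus False using sin_cos_squared_add[of x] by simp
    qed
    thus ?thesis by (fastforce simp: path_image_part_circlepath)
  qed
  have "contour_integral \<gamma> (\<lambda>z. 1/z) = contour_integral ?l (\<lambda>z. 1/z)"
    using prim[OF \<gamma>(1,5), unfolded \<gamma>(2,3)] prim[of ?l, OF valid_path_part_circlepath l_im, unfolded ends]
    by (metis contour_integral_unique)
  moreover have "contour_integral ?r (\<lambda>z. 1/z) + contour_integral ?l (\<lambda>z. 1/z) = 2 * pi * \<i>"
  proof -
    have eq: "contour_integral (part_circlepath 0 R s t) (\<lambda>z. 1/z) = \<i> * (t - s)" if "s < t" for s t
    proof -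
      have "((\<lambda>z. 1/z) has_contour_integral \<i> * (t - s)) (part_circlepath 0 R s t)"
        using that R has_integral_const_real[of \<i> s t]
        by (simp add: has_contour_integral_part_circlepath_iff mult_ac scaleR_conv_of_real)
      thus ?thesis by (rule contour_integral_unique)
    qed
    show ?thesis by (simp add: eq algebra_simps)
  qed
  ultimately have one: "contour_integral ?r (\<lambda>z. 1/z) + contour_integral \<gamma> (\<lambda>z. 1/z) = 2 * pi * \<i>"
    by simp
  have Fcont: "continuous_on V F" using F by (rule holomorphic_on_imp_continuous_on)
  have Fi: "F contour_integrable_on ?r" "F contour_integrable_on \<gamma>"
    using F V right \<gamma> by (auto intro!: contour_integrable_holomorphic_simple)
  have "(F has_contour_integral 0) (?r +++ \<gamma>)"
    by (rule Cauchy_theorem_convex_simple[OF F V(2)])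
       (use ends \<gamma> right in \<open>auto simp: path_image_join valid_path_join\<close>)
  hence F0: "contour_integral ?r F + contour_integral \<gamma> F = 0"
    using Fi ends \<gamma> by (metis contour_integral_join contour_integral_unique valid_path_part_circlepath)
  have dec: "contour_integral g (\<lambda>z. h z / z) = contour_integral g F + h 0 * contour_integral g (\<lambda>z. 1/z)"
    if "0 \<notin> path_image g" "F contour_integrable_on g" "valid_path g" for g
  proof -
    have "(\<lambda>z. 1/z) contour_integrable_on g"
      by (rule contour_integrable_holomorphic_simple[of _ "-{0}"])
         (use that in \<open>auto intro!: holomorphic_intros\<close>)
    hence "((\<lambda>z. F z + h 0 * (1/z)) has_contour_integral
        (contour_integral g F + h 0 * contour_integral g (\<lambda>z. 1/z))) g"
      using that by (intro has_contour_integral_add has_contour_integral_lmul has_contour_integral_integral)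
    hence "((\<lambda>z. h z / z) has_contour_integral
        (contour_integral g F + h 0 * contour_integral g (\<lambda>z. 1/z))) g"
      by (rule has_contour_integral_eq) (use that(1) in \<open>auto simp: F_def field_simps\<close>)
    thus ?thesis by (rule contour_integral_unique)
  qed
  have "contour_integral ?r (\<lambda>z. h z / z) + contour_integral \<gamma> (\<lambda>z. h z / z) =
      (contour_integral ?r F + contour_integral \<gamma> F) +
      h 0 * (contour_integral ?r (\<lambda>z. 1/z) + contour_integral \<gamma> (\<lambda>z. 1/z))"
    unfolding dec[OF rn0(1) Fi(1) valid_path_part_circlepath] dec[OF ln0 Fi(2) \<gamma>(1)]
    by (simp only: algebra_simps)
  thus ?thesis unfolding F0 one by simp
qed


text \<open>On the circle |z| = R, the number 1 + z^2 / R^2 equals z (cnj z + z) / R^2, a multiple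
  of Re z. This factor cancels the 1 / |Re z| of the tail bounds, which is the reason for Newman's
  choice of kernel.\<close>

lemma newman_kernel_norm:
  fixes z :: complex
  assumes "norm z = R" "R > 0"
  shows "norm ((1 + z^2 / of_real R ^ 2) / z) = 2 * \<bar>Re z\<bar> / R^2"
proof -
  have "(1 + z^2 / of_real R ^ 2) * of_real R ^ 2 = z * (cnj z + z)"
    using assms complex_norm_square[of z] by (simp add: field_simps power2_eq_square)
  also have "cnj z + z = of_real (2 * Re z)"
    by (simp add: complex_eq_iff)
  finally have "norm (1 + z^2 / of_real R ^ 2) * R ^ 2 = R * (2 * \<bar>Re z\<bar>)"
    using assms by (metis abs_mult abs_numeral norm_mult norm_of_real norm_power abs_of_pos)
  hence "norm (1 + z^2 / of_real R ^ 2) = 2 * \<bar>Re z\<bar> / R"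
    using assms by (simp add: field_simps power2_eq_square)
  thus ?thesis using assms by (simp add: norm_divide power2_eq_square)
qed

text \<open>Both \<open>g 0\<close> and \<open>S N 0\<close> are residues at 0 against one kernel.
  On the right arc \<open>g - S N\<close>, and on the left arc \<open>S N\<close>, is at most C N^(-
  Re z) / |Re z|; the kernel cancels both factors and leaves 2 C / R^2, uniformly in N. What remains
  is an integral of \<open>g\<close> just left of the imaginary axis, where N^z decays.\<close>

theorem newman_tauberian:
  fixes A :: "nat \<Rightarrow> complex" and g :: "complex \<Rightarrow> complex"
  assumes A: "\<And>n. norm (A n) \<le> C * real n"
    and U: "open U" "{z. Re z \<ge> 0} \<subseteq> U" and g: "g holomorphic_on U"
    and sums: "\<And>z. Re z > 0 \<Longrightarrow> (\<lambda>n. A n * cell n (1 + z)) sums g z"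
  shows "(\<lambda>n. A n * cell n 1) sums g 0"
proof -
  have C: "C \<ge> 0" using A[of 1] norm_ge_zero[of "A 1"] by linarith
  have A0: "A 0 = 0" using A[of 0] by simp
  define S where "S = (\<lambda>N z. \<Sum>n<N. A n * cell n (1 + z))"
  have Shol: "S N holomorphic_on X" for N X
  proof -
    have "(\<lambda>z. A n * cell n (1 + z)) holomorphic_on UNIV" for n
    proof (cases "n = 0")
      case False
      hence "cell n holomorphic_on UNIV" by (intro cell_holomorphic) auto
      hence "(cell n \<circ> (\<lambda>z. 1 + z)) holomorphic_on UNIV"
        by (intro holomorphic_on_compose_gen[of _ _ _ UNIV] holomorphic_intros) auto
      thus ?thesis by (intro holomorphic_intros) (simp add: o_def)
    qed (simp add: A0)
    hence "S N holomorphic_on UNIV" unfolding S_def by (rule holomorphic_on_sum)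
    thus ?thesis by (rule holomorphic_on_subset) auto
  qed
  have term_bound: "norm (A n * cell n (1 + z)) \<le>
      C * ((real (Suc n) powr (- Re z) - real n powr (- Re z)) / (- Re z))"
    if "n > 0" "Re z \<noteq> 0" "z \<noteq> -1" for n z
  proof -
    have "norm (A n * cell n (1 + z)) \<le> C * (real n * norm (cell n (1 + z)))"
      using A[of n] by (simp add: norm_mult mult_right_mono flip: mult.assoc)
    also have "real n * norm (cell n (1 + z)) \<le>
        (real (Suc n) powr (1 - Re (1+z)) - real n powr (1 - Re (1+z))) / (1 - Re (1+z))"
      using that by (intro cell_bound_diff) (auto simp: add_eq_0_iff)
    finally show ?thesis using C by (simp add: mult_left_mono)
  qed
  have sum_bound: "norm (\<Sum>n=m..<N. A n * cell n (1 + z)) \<le>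
      C * ((real N powr (- Re z) - real m powr (- Re z)) / (- Re z))"
    if "m > 0" "m \<le> N" "Re z \<noteq> 0" "z \<noteq> -1" for m N z
  proof -
    have "norm (\<Sum>n=m..<N. A n * cell n (1 + z)) \<le> (\<Sum>n=m..<N.
        C * ((real (Suc n) powr (- Re z) - real n powr (- Re z)) / (- Re z)))"
      using that by (intro sum_norm_le term_bound) auto
    also have "\<dots> = C / (- Re z) * (\<Sum>n=m..<N. real (Suc n) powr (- Re z) - real n powr (- Re z))"
      by (simp add: sum_distrib_left)
    also have "\<dots> = C / (- Re z) * (real N powr (- Re z) - real m powr (- Re z))"
      using that by (subst sum_Suc_diff') auto
    finally show ?thesis by simp
  qed
  have right_bound: "norm (g z - S N z) \<le> C * real N powr (- Re z) / Re z"
    if "N > 0" "Re z > 0" for N z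
  proof (rule tendsto_upperbound)
    show "(\<lambda>N'. norm (S N' z - S N z)) \<longlonglongrightarrow> norm (g z - S N z)"
      using sums[OF that(2)] unfolding sums_def S_def by (intro tendsto_intros)
    show "\<forall>\<^sub>F N' in sequentially. norm (S N' z - S N z) \<le> C * real N powr (- Re z) / Re z"
      using eventually_ge_at_top[of N]
    proof eventually_elim
      case (elim N')
      have "S N' z - S N z = (\<Sum>n=N..<N'. A n * cell n (1 + z))"
        using elim unfolding S_def by (simp add: sum_diff_nat_ivl lessThan_atLeast0)
      hence "norm (S N' z - S N z) \<le> C * ((real N' powr (- Re z) - real N powr (- Re z)) / (- Re z))"
        using sum_bound[of N N' z] that elim by (metis One_nat_def Re_complex_of_real less_irrefl neg_0_less_iff_less not_less_iff_gr_or_eq one_complex.sel(1) order.asym uminus_complex.sel(1) zero_less_one)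
      also have "\<dots> \<le> C * (real N powr (- Re z) / Re z)"
        using that C by (intro mult_left_mono) (auto simp: field_simps)
      finally show ?case by simp
    qed
  qed auto
  have left_bound: "norm (S N z) \<le> C * real N powr (- Re z) / (- Re z)"
    if "N > 0" "Re z < 0" "z \<noteq> -1" for N z
  proof -
    have "S N z = (\<Sum>n=1..<N. A n * cell n (1 + z))"
      unfolding S_def lessThan_atLeast0 using that A0 by (simp add: sum.atLeast_Suc_lessThan)
    hence "norm (S N z) \<le> C * ((real N powr (- Re z) - 1) / (- Re z))"
      using sum_bound[of 1 N z] that by auto
    also have "\<dots> \<le> C * (real N powr (- Re z) / (- Re z))"
      using that C by (intro mult_left_mono divide_right_mono) auto
    finally show ?thesis by simp
  qed
  have "(\<lambda>N. S N 0) \<longlonglongrightarrow> g 0"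
  proof (rule LIMSEQ_I)
    fix \<epsilon> :: real assume \<epsilon>: "\<epsilon> > 0"
    \<comment> \<open>With 2 C / R at most \<epsilon> / 2 the two arcs together contribute at most
      \<pi> \<epsilon>. R \<ge> 2 keeps the point -1, which the bounds above exclude, off the
      circle.\<close>
    define R where "R = 2 + 4 * C / \<epsilon>"
    have R: "R \<ge> 2" "R > 0" "2 * C / R \<le> \<epsilon> / 2"
      using C \<epsilon> unfolding R_def by (auto simp: field_simps)
    define K where "K = (\<lambda>N z. of_nat N powr z * (1 + z^2 / complex_of_real R ^ 2))"
    have Khol: "K N holomorphic_on X" if "N > 0" for N X
      unfolding K_def using that R by (intro holomorphic_intros) (auto simp: complex_nonpos_Reals_iff)
    have K0: "K N 0 = 1" if "N > 0" for N using that by (simp add: K_def)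
    have Knorm: "norm (K N z / z) = real N powr Re z * (2 * \<bar>Re z\<bar> / R^2)" if "norm z = R" "N > 0" for N z
      using newman_kernel_norm[OF that(1) R(2)] that
      by (simp add: K_def norm_mult norm_powr_real_powr flip: times_divide_eq_right)
    let ?r = "part_circlepath 0 R (-(pi/2)) (pi/2)"
    let ?l = "part_circlepath 0 R (pi/2) (3*pi/2)"
    have r_im: "norm z = R \<and> Re z \<ge> 0" if "z \<in> path_image ?r" for z
    proof
      show "norm z = R" using in_path_image_part_circlepath[OF that] R by simp
      from that obtain x where "x \<in> {-(pi/2)..pi/2}" "z = R * exp (\<i> * complex_of_real x)"
        by (auto simp: path_image_part_circlepath)
      thus "Re z \<ge> 0" using R by (auto simp: Re_exp intro!: mult_nonneg_nonneg cos_ge_zero)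
    qed
    have l_im: "norm z = R \<and> Re z \<le> 0 \<and> z \<notin> \<real>\<^sub>\<ge>\<^sub>0" if "z \<in> path_image ?l" for z
    proof -
      have "norm z = R" using in_path_image_part_circlepath[OF that] R by simp
      from that obtain x where x: "x \<in> {pi/2..3*pi/2}" "z = R * exp (\<i> * complex_of_real x)"
        by (auto simp: path_image_part_circlepath)
      have "cos (x - pi) \<ge> 0" using x by (intro cos_ge_zero) auto
      hence "Re z \<le> 0" using R x by (auto simp: Re_exp mult_nonneg_nonpos)
      moreover have "z \<notin> \<real>\<^sub>\<ge>\<^sub>0"
        using \<open>Re z \<le> 0\<close> \<open>norm z = R\<close> R by (auto simp: complex_nonneg_Reals_iff cmod_def)
      ultimately show ?thesis using \<open>norm z = R\<close> by auto
    qed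
    \<comment> \<open>an open half-strip inside \<open>U\<close> that contains the closed right half-disc\<close>
    obtain e where e: "e > 0" "e \<le> 1"
      "\<And>z. \<lbrakk>Re z > -e; \<bar>Im z\<bar> \<le> 2 * R\<rbrakk> \<Longrightarrow> z \<in> U"
    proof -
      let ?c = "closed_segment (- \<i> * (2*R)) (\<i> * (2*R))"
      have c: "z \<in> ?c \<longleftrightarrow> Re z = 0 \<and> \<bar>Im z\<bar> \<le> 2 * R" for z
        using R by (subst closed_segment_same_Re) (auto simp: closed_segment_eq_real_ivl)
      have "compact ?c" "?c \<subseteq> U" using U c by auto
      from compact_subset_open_imp_ball_epsilon_subset[OF this(1) U(1) this(2)]
      obtain e where e: "e > 0" "(\<Union>x\<in>?c. ball x e) \<subseteq> U" by auto
      show ?thesis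
      proof (rule that[of "min e 1"])
        fix z assume z: "Re z > - min e 1" "\<bar>Im z\<bar> \<le> 2 * R"
        show "z \<in> U"
        proof (cases "Re z \<ge> 0")
          case False
          have "\<i> * Im z \<in> ?c" using z unfolding c by simp
          moreover have "dist (\<i> * Im z) z = \<bar>Re z\<bar>"
            by (simp add: dist_norm cmod_def)
          ultimately show ?thesis using e(2) z False by (auto simp: subset_eq)
        qed (use U in auto)
      qed (use e in auto)
    qed
    define V where "V = {z. Re z > -e} \<inter> {z. \<bar>Im z\<bar> < 2 * R}"
    have V: "open V" "convex V" "V \<subseteq> U" "0 \<in> V"
    proof -
      have V': "V = {z. Re z > -e} \<inter> ({z. Im z < 2 * R} \<inter> {z. Im z > - (2*R)})"
        by (auto simp: V_def)
      show "open V" unfolding V' by (intro open_Int open_halfspace_Re_gt open_halfspace_Im_gt open_halfspace_Im_lt)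
      show "convex V" unfolding V' by (intro convex_Int convex_halfspace_Re_gt convex_halfspace_Im_gt convex_halfspace_Im_lt)
      show "V \<subseteq> U" using e by (auto simp: V_def)
      show "0 \<in> V" using e R by (auto simp: V_def)
    qed
    have gV: "g holomorphic_on V" using g V holomorphic_on_subset by blast
    define Q where "Q = cbox (Complex (-e/2) (-R)) (Complex 0 R)"
    have QV: "Q \<subseteq> V" unfolding Q_def V_def using e R by (auto simp: in_cbox_complex_iff)
    obtain B where B: "B > 0" "\<And>z. z \<in> Q \<Longrightarrow> norm (g z) \<le> B"
    proof -
      have "compact (g ` Q)"
        using gV QV by (intro compact_continuous_image holomorphic_on_imp_continuous_on)
          (auto intro: holomorphic_on_subset simp: Q_def)
      thus ?thesis using that by (auto dest!: compact_imp_bounded simp: bounded_pos)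
    qed
    \<comment> \<open>Fixed before N is chosen. The entry \<open>e/2\<close> keeps the path inside
      \<open>Q\<close>, where |g| \<le> B; the other one makes the two horizontal sides, at most 3 B
      \<delta> each, small for every N. Only the vertical side needs N large, through the factor
      N^(- \<delta>).\<close>
    define \<delta> where "\<delta> = min (e/2) (\<epsilon> / (8 * B))"
    have \<delta>: "\<delta> > 0" "\<delta> \<le> e/2" "\<delta> \<le> \<epsilon> / (8 * B)" using e B \<epsilon> by (auto simp: \<delta>_def)
    let ?p1 = "\<i> * R" and ?p2 = "Complex (-\<delta>) R" and ?p3 = "Complex (-\<delta>) (-R)" and ?p4 = "-\<i> * R"
    let ?\<gamma> = "linepath ?p1 ?p2 +++ linepath ?p2 ?p3 +++ linepath ?p3 ?p4"
    have lim0: "(\<lambda>N. real N powr (-\<delta>)) \<longlonglongrightarrow> 0"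
      using \<delta> by real_asymp
    have seg1: "z \<in> Q \<and> Re z \<le> 0 \<and> \<bar>Im z\<bar> = R" if "z \<in> closed_segment ?p1 ?p2 \<union> closed_segment ?p3 ?p4" for z
      using that \<delta> e R by (auto simp: closed_segment_same_Im Q_def in_cbox_complex_iff closed_segment_eq_real_ivl)
    have seg2: "z \<in> Q \<and> Re z = -\<delta>" if "z \<in> closed_segment ?p2 ?p3" for z
      using that \<delta> e R by (auto simp: closed_segment_same_Re Q_def in_cbox_complex_iff closed_segment_eq_real_ivl)
    have KN2: "norm (K N z / z) \<le> real N powr Re z * (1 / norm z + norm z / R^2)"
      if "N > 0" "z \<noteq> 0" for N z
    proof -
      have "norm (1 + z^2 / complex_of_real R ^ 2) \<le> 1 + norm z ^ 2 / R ^ 2"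
        using norm_triangle_ineq[of 1 "z^2 / complex_of_real R ^ 2"] R
        by (simp add: norm_divide norm_power)
      hence "norm (1 + z^2 / complex_of_real R ^ 2) / norm z \<le> (1 + norm z ^ 2 / R ^ 2) / norm z"
        by (intro divide_right_mono) auto
      also have "\<dots> = 1 / norm z + norm z / R^2"
        using that by (simp add: add_divide_distrib power2_eq_square)
      finally show ?thesis
        unfolding K_def using that
        by (auto simp: norm_mult norm_divide norm_powr_real_powr simp flip: times_divide_eq_right intro!: mult_left_mono)
    qed
    have "(\<lambda>N. B * (real N powr (-\<delta>) * (1 / \<delta> + 1)) * (2 * R)) \<longlonglongrightarrow> B * (0 * (1 / \<delta> + 1)) * (2 * R)"
      using lim0 by (intro tendsto_intros)
    hence "eventually (\<lambda>N. B * (real N powr (-\<delta>) * (1 / \<delta> + 1)) * (2 * R) < \<epsilon>) sequentially"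
      using \<epsilon> by (intro order_tendstoD(2)) auto
    then obtain N0 where N0: "\<And>N. N \<ge> N0 \<Longrightarrow> B * (real N powr (-\<delta>) * (1 / \<delta> + 1)) * (2 * R) < \<epsilon>"
      by (auto simp: eventually_at_top_linorder)
    have "norm (S N 0 - g 0) < \<epsilon>" if N: "N \<ge> max N0 1" for N
    proof -
      have N1: "N > 0" "N \<ge> N0" using N by auto
      define kg where "kg = (\<lambda>z. g z * K N z)"
      define ks where "ks = (\<lambda>z. S N z * K N z)"
      have kg: "kg holomorphic_on V" and ks: "ks holomorphic_on UNIV"
        unfolding kg_def ks_def using N1 by (auto intro!: holomorphic_intros gV Khol Shol)
      have i1: "exp (\<i> * complex_of_real (pi/2)) = \<i>"
        using cis_pi_half by (simp add: cis_conv_exp)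
      have i3: "exp (\<i> * complex_of_real (3*pi/2)) = - \<i>"
      proof -
        have eq: "\<i> * complex_of_real (3*pi/2) = \<i> * complex_of_real (pi/2) + of_real pi * \<i>"
          by (simp add: field_simps)
        show ?thesis unfolding eq exp_add i1 by simp
      qed
      have endsl: "pathstart ?l = \<i> * R" "pathfinish ?l = - \<i> * R"
        using i1 i3 by (simp_all add: mult.commute)
      have rV: "path_image ?r \<subseteq> V"
      proof
        fix z assume "z \<in> path_image ?r"
        from r_im[OF this] show "z \<in> V"
          using abs_Im_le_cmod[of z] R e by (auto simp: V_def)
      qed
      have \<gamma>im: "path_image ?\<gamma> = closed_segment ?p1 ?p2 \<union> closed_segment ?p2 ?p3 \<union> closed_segment ?p3 ?p4"
        by (auto simp: path_image_join)
      have \<gamma>V: "path_image ?\<gamma> \<subseteq> V" unfolding \<gamma>im using seg1 seg2 QV by blast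
      have c1: "contour_integral ?r (\<lambda>z. kg z / z) + contour_integral ?\<gamma> (\<lambda>z. kg z / z) = 2 * pi * \<i> * kg 0"
      proof (rule half_circle_cauchy[OF V(1,2) kg V(4) R(2) rV])
        show "path_image ?\<gamma> \<inter> \<real>\<^sub>\<ge>\<^sub>0 = {}"
          unfolding \<gamma>im using seg1 seg2 \<delta> R by (fastforce simp: complex_nonneg_Reals_iff)
      qed (use \<gamma>V in \<open>auto simp: valid_path_join\<close>)
      \<comment> \<open>\<open>S N\<close> is entire, so its contour may close along the left
        semicircle, where \<open>left_bound\<close> applies; the contour for \<open>g\<close> had to
        turn back near the imaginary axis.\<close>
      have c2: "contour_integral ?r (\<lambda>z. ks z / z) + contour_integral ?l (\<lambda>z. ks z / z) = 2 * pi * \<i> * ks 0"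
        by (rule half_circle_cauchy[OF _ _ ks _ R(2)])
           (use endsl l_im in auto)
      have nz: "0 \<notin> path_image ?r" "0 \<notin> path_image ?l" "0 \<notin> path_image ?\<gamma>"
        using r_im[of 0] l_im[of 0] R seg1[of 0] seg2[of 0] \<delta> unfolding \<gamma>im by auto
      have "(\<lambda>z. kg z / z) holomorphic_on V - {0}" "(\<lambda>z. ks z / z) holomorphic_on - {0}"
        by (intro holomorphic_intros holomorphic_on_subset[OF kg] holomorphic_on_subset[OF ks]; auto)+
      hence ints: "(\<lambda>z. kg z / z) contour_integrable_on ?r" "(\<lambda>z. ks z / z) contour_integrable_on ?r"
        "(\<lambda>z. ks z / z) contour_integrable_on ?l"
        using nz rV V(1) by (auto intro: contour_integrable_holomorphic_simple)
      have intg: "(\<lambda>z. kg z / z) contour_integrable_on linepath a b"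
        if "closed_segment a b \<subseteq> path_image ?\<gamma>" for a b
        using nz \<gamma>V V(1) that by (intro contour_integrable_holomorphic_simple[of _ "V - {0}"] holomorphic_intros
            holomorphic_on_subset[OF kg]) auto
      have Ir: "norm (contour_integral ?r (\<lambda>z. kg z / z) - contour_integral ?r (\<lambda>z. ks z / z)) \<le> 2 * C / R\<^sup>2 * R * (pi/2 - - (pi/2))"
      proof (rule has_contour_integral_bound_part_circlepath)
        show "((\<lambda>z. kg z / z - ks z / z) has_contour_integral
          contour_integral ?r (\<lambda>z. kg z / z) - contour_integral ?r (\<lambda>z. ks z / z)) ?r"
          using ints by (intro has_contour_integral_diff has_contour_integral_integral)
        fix z assume "z \<in> path_image ?r"
        from r_im[OF this] have z: "norm z = R" "Re z \<ge> 0" by auto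
        have "kg z / z - ks z / z = (g z - S N z) * (K N z / z)"
          by (simp add: kg_def ks_def diff_divide_distrib algebra_simps)
        hence eq: "norm (kg z / z - ks z / z) = norm (g z - S N z) * (real N powr Re z * (2 * \<bar>Re z\<bar> / R^2))"
          unfolding Knorm[OF z(1) N1(1), symmetric] by (simp only: norm_mult)
        show "norm (kg z / z - ks z / z) \<le> 2 * C / R\<^sup>2"
        proof (cases "Re z = 0")
          case False
          hence "Re z > 0" using z by simp
          have "norm (kg z / z - ks z / z) \<le> C * real N powr (- Re z) / Re z * (real N powr Re z * (2 * \<bar>Re z\<bar> / R^2))"
            unfolding eq using right_bound[OF N1(1) \<open>Re z > 0\<close>] by (intro mult_right_mono) auto
          also have "\<dots> = 2 * C / R\<^sup>2"
            using \<open>Re z > 0\<close> N1 by (simp add: powr_minus field_simps)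
          finally show ?thesis .
        qed (use eq C in auto)
      qed (use C R in auto)
      have Il: "norm (contour_integral ?l (\<lambda>z. ks z / z)) \<le> 2 * C / R\<^sup>2 * R * (3*pi/2 - pi/2)"
      proof (rule has_contour_integral_bound_part_circlepath[OF has_contour_integral_integral[OF ints(3)]])
        fix z assume "z \<in> path_image ?l"
        from l_im[OF this] have z: "norm z = R" "Re z \<le> 0" by auto
        have "ks z / z = S N z * (K N z / z)"
          by (simp add: ks_def)
        hence eq: "norm (ks z / z) = norm (S N z) * (real N powr Re z * (2 * \<bar>Re z\<bar> / R^2))"
          unfolding Knorm[OF z(1) N1(1), symmetric] by (simp only: norm_mult)
        show "norm (ks z / z) \<le> 2 * C / R\<^sup>2"
        proof (cases "Re z = 0")
          case False
          hence "Re z < 0" using z by simp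
          moreover have "z \<noteq> -1" using z R by auto
          ultimately have "norm (ks z / z) \<le> C * real N powr (- Re z) / (- Re z) * (real N powr Re z * (2 * \<bar>Re z\<bar> / R^2))"
            unfolding eq by (intro mult_right_mono left_bound[OF N1(1)] mult_nonneg_nonneg divide_nonneg_nonneg) auto
          also have "\<dots> = 2 * C / R\<^sup>2"
            using \<open>Re z < 0\<close> N1 by (simp add: powr_minus field_simps)
          finally show ?thesis .
        qed (use eq C in auto)
      qed (use C R in auto)
      have hor: "norm (contour_integral (linepath a b) (\<lambda>z. kg z / z)) \<le> (B * 3) * norm (b - a)"
        if ab: "closed_segment a b \<subseteq> closed_segment ?p1 ?p2 \<union> closed_segment ?p3 ?p4" for a b
      proof (rule contour_integral_bound_linepath)
        show "(\<lambda>z. kg z / z) contour_integrable_on linepath a b"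
          using intg[of a b] ab unfolding \<gamma>im by blast
        fix z assume "z \<in> closed_segment a b"
        hence z: "z \<in> Q" "Re z \<le> 0" "\<bar>Im z\<bar> = R" using ab seg1 by blast+
        have nz: "norm z \<ge> R" using abs_Im_le_cmod[of z] z by simp
        have "\<bar>Re z\<bar> \<le> 1" using z e by (auto simp: Q_def in_cbox_complex_iff)
        hence nz2: "norm z \<le> 2 * R" using cmod_le[of z] z R by linarith
        have "norm (K N z / z) \<le> real N powr Re z * (1 / norm z + norm z / R^2)"
          using nz R N1 by (intro KN2) auto
        also have "\<dots> \<le> 1 * (1 / R + 2 * R / R^2)"
        proof (intro mult_mono add_mono divide_left_mono divide_right_mono nz nz2)
          show "real N powr Re z \<le> 1" using powr_mono[of "Re z" 0 "real N"] z N1 by auto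
          show "0 < norm z * R" using nz R by (intro mult_pos_pos) linarith+
        qed auto
        also have "\<dots> \<le> 3" using R by (simp add: power2_eq_square field_simps)
        finally have "norm (g z) * norm (K N z / z) \<le> B * 3"
          using B z by (intro mult_mono) auto
        thus "norm (kg z / z) \<le> B * 3"
          by (simp add: kg_def norm_mult norm_divide)
      qed (use B in auto)
      have ver: "norm (contour_integral (linepath ?p2 ?p3) (\<lambda>z. kg z / z)) \<le>
         (B * (real N powr (-\<delta>) * (1 / \<delta> + 1))) * norm (?p3 - ?p2)"
      proof (rule contour_integral_bound_linepath)
        show "(\<lambda>z. kg z / z) contour_integrable_on linepath ?p2 ?p3"
          using intg[of ?p2 ?p3] unfolding \<gamma>im by blast
        fix z assume "z \<in> closed_segment ?p2 ?p3"
        hence z: "z \<in> Q" "Re z = -\<delta>" using seg2 by blast+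
        have nz: "norm z \<ge> \<delta>" using abs_Re_le_cmod[of z] z \<delta> by simp
        have "\<bar>Im z\<bar> \<le> R" "\<bar>Re z\<bar> \<le> 1" using z e by (auto simp: Q_def in_cbox_complex_iff)
        hence nz2: "norm z \<le> 2 * R" using cmod_le[of z] z R by linarith
        have "norm (K N z / z) \<le> real N powr Re z * (1 / norm z + norm z / R^2)"
          using nz \<delta> N1 by (intro KN2) auto
        also have "\<dots> \<le> real N powr (-\<delta>) * (1 / \<delta> + 2 * R / R^2)"
          unfolding z(2)
        proof (intro mult_left_mono add_mono divide_left_mono divide_right_mono nz nz2)
          show "0 < norm z * \<delta>" using nz \<delta> by (intro mult_pos_pos) linarith+
        qed auto
        also have "\<dots> \<le> real N powr (-\<delta>) * (1 / \<delta> + 1)"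
          using R by (intro mult_left_mono add_left_mono) (auto simp: power2_eq_square field_simps)
        finally have "norm (g z) * norm (K N z / z) \<le> B * (real N powr (-\<delta>) * (1 / \<delta> + 1))"
          using B z by (intro mult_mono) auto
        thus "norm (kg z / z) \<le> B * (real N powr (-\<delta>) * (1 / \<delta> + 1))"
          by (simp add: kg_def norm_mult norm_divide)
      qed (use B \<delta> in auto)
      have len: "norm (?p2 - ?p1) = \<delta>" "norm (?p4 - ?p3) = \<delta>" "norm (?p3 - ?p2) = 2 * R"
      proof -
        have "?p2 - ?p1 = of_real (-\<delta>)" "?p4 - ?p3 = of_real \<delta>" "?p3 - ?p2 = - \<i> * of_real (2 * R)"
          by (simp_all add: complex_eq_iff)
        thus "norm (?p2 - ?p1) = \<delta>" "norm (?p4 - ?p3) = \<delta>" "norm (?p3 - ?p2) = 2 * R"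
          using \<delta> R by (simp_all only: norm_mult norm_of_real norm_minus_cancel norm_ii)
      qed
      have i12: "(\<lambda>z. kg z / z) contour_integrable_on linepath ?p1 ?p2"
       and i23: "(\<lambda>z. kg z / z) contour_integrable_on linepath ?p2 ?p3"
       and i34: "(\<lambda>z. kg z / z) contour_integrable_on linepath ?p3 ?p4"
        using intg[of ?p1 ?p2] intg[of ?p2 ?p3] intg[of ?p3 ?p4] unfolding \<gamma>im by blast+
      have "contour_integral ?\<gamma> (\<lambda>z. kg z / z) =
          contour_integral (linepath ?p1 ?p2) (\<lambda>z. kg z / z) +
          (contour_integral (linepath ?p2 ?p3) (\<lambda>z. kg z / z) +
           contour_integral (linepath ?p3 ?p4) (\<lambda>z. kg z / z))"
        unfolding contour_integral_join[OF i12 contour_integrable_joinI[OF i23 i34 valid_path_linepath valid_path_linepath]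
            valid_path_linepath valid_path_join[OF valid_path_linepath valid_path_linepath,
              unfolded pathfinish_linepath pathstart_linepath, OF refl]]
          contour_integral_join[OF i23 i34 valid_path_linepath valid_path_linepath] ..
      hence "norm (contour_integral ?\<gamma> (\<lambda>z. kg z / z)) \<le>
          (B * 3) * \<delta> + ((B * (real N powr (-\<delta>) * (1 / \<delta> + 1))) * (2 * R) + (B * 3) * \<delta>)"
        using hor[of ?p1 ?p2] hor[of ?p3 ?p4] ver unfolding len
        by (metis (no_types, lifting) add_mono norm_triangle_le order_refl sup.cobounded1 sup.cobounded2)
      also have "\<dots> < 6 * (B * \<delta>) + \<epsilon>" using N0[OF N1(2)] by simp
      also have "B * \<delta> \<le> \<epsilon> / 8" using \<delta>(3) B by (simp add: field_simps)
      finally have Ig: "norm (contour_integral ?\<gamma> (\<lambda>z. kg z / z)) < 2 * \<epsilon>" using \<epsilon> by simp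
      have tri: "norm (a - b + c) \<le> norm a + norm b + norm c" for a b c :: complex
        using norm_triangle_ineq[of "a - b" c] norm_triangle_ineq4[of a b] by linarith
      have "2 * pi * \<i> * (g 0 - S N 0) =
          (contour_integral ?r (\<lambda>z. kg z / z) - contour_integral ?r (\<lambda>z. ks z / z))
          - contour_integral ?l (\<lambda>z. ks z / z) + contour_integral ?\<gamma> (\<lambda>z. kg z / z)"
        using c1 c2 K0[OF N1(1)] by (simp add: kg_def ks_def algebra_simps)
      hence "norm (2 * pi * \<i> * (g 0 - S N 0)) = norm (
          (contour_integral ?r (\<lambda>z. kg z / z) - contour_integral ?r (\<lambda>z. ks z / z))
          - contour_integral ?l (\<lambda>z. ks z / z) + contour_integral ?\<gamma> (\<lambda>z. kg z / z))"
        by (rule arg_cong)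
      also have "\<dots> \<le>
          norm (contour_integral ?r (\<lambda>z. kg z / z) - contour_integral ?r (\<lambda>z. ks z / z))
          + norm (contour_integral ?l (\<lambda>z. ks z / z)) + norm (contour_integral ?\<gamma> (\<lambda>z. kg z / z))"
        by (rule tri)
      also have "\<dots> < 2 * C / R\<^sup>2 * R * pi + 2 * C / R\<^sup>2 * R * pi + 2 * \<epsilon>"
        using Ir Il Ig by simp
      also have "\<dots> = (2 * C / R) * (2 * pi) + 2 * \<epsilon>"
        using R by (simp add: power2_eq_square field_simps)
      also have "\<dots> \<le> (\<epsilon> / 2) * (2 * pi) + pi * \<epsilon>"
        using R \<epsilon> pi_ge_two by (intro add_mono mult_right_mono) auto
      finally have "2 * pi * norm (g 0 - S N 0) < 2 * pi * \<epsilon>"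
        unfolding norm_mult by (simp add: algebra_simps)
      hence "norm (g 0 - S N 0) < \<epsilon>" using pi_gt_zero by simp
      thus ?thesis by (simp add: norm_minus_commute)
    qed
    thus "\<exists>N0. \<forall>N\<ge>N0. norm (S N 0 - g 0) < \<epsilon>" by blast
  qed
  thus ?thesis by (simp add: sums_def S_def)
qed

section \<open>Dirichlet series\<close>

lemma partial_summation:
  fixes a f :: "nat \<Rightarrow> 'a :: comm_ring"
  shows "(\<Sum>k\<le>N. a k * f k) = (\<Sum>k<N. (\<Sum>j\<le>k. a j) * (f k - f (Suc k))) + (\<Sum>j\<le>N. a j) * f N"
  by (induction N) (simp_all add: algebra_simps)

lemma dirichlet_partial_summation:
  fixes a :: "nat \<Rightarrow> complex"
  assumes s: "s \<noteq> 0"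
    and lim: "(\<lambda>N. (\<Sum>j\<le>N. a j) * of_nat N powr (-s)) \<longlonglongrightarrow> 0"
    and sums: "(\<lambda>k. (\<Sum>j\<le>k. a j) * cell k s) sums S"
  shows "(\<lambda>n. a n * of_nat n powr (-s)) sums (s * S)"
proof -
  have eq: "(\<Sum>k\<le>N. a k * of_nat k powr (-s)) =
      s * (\<Sum>k<N. (\<Sum>j\<le>k. a j) * cell k s) + (\<Sum>j\<le>N. a j) * of_nat N powr (-s)" for N
    unfolding partial_summation sum_distrib_left
    using s by (intro arg_cong2[of _ _ _ _ "(+)"] sum.cong refl) (simp add: cell_nonzero del: of_nat_Suc)
  have "(\<lambda>N. \<Sum>k\<le>N. a k * of_nat k powr (-s)) \<longlonglongrightarrow> s * S + 0"
    unfolding eq using sums[unfolded sums_def] lim by (intro tendsto_add tendsto_mult_left)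
  thus ?thesis by (simp add: sums_def_le)
qed

lemma holomorphic_series_right_half_plane:
  fixes f :: "nat \<Rightarrow> complex \<Rightarrow> complex"
  assumes hol: "\<And>n. n > 0 \<Longrightarrow> f n holomorphic_on {s. Re s > \<alpha>}"
    and bound: "\<And>n s. \<lbrakk>n > 0; Re s > \<alpha>\<rbrakk> \<Longrightarrow> norm (f n s) \<le> C * real n powr (\<alpha> - Re s - 1)"
    and f0: "\<And>s. f 0 s = 0"
  obtains F where "F holomorphic_on {s. Re s > \<alpha>}" "\<And>s. Re s > \<alpha> \<Longrightarrow> (\<lambda>n. f n s) sums F s"
proof -
  have op: "open {s. Re s > \<alpha>}" by (rule open_halfspace_Re_gt)
  have C: "C \<ge> 0" using order_trans[OF norm_ge_zero bound[of 1 "of_real (\<alpha> + 1)"]] by simp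
  obtain F where "\<forall>s\<in>{s. Re s > \<alpha>}. (\<lambda>n. f n s) sums F s \<and> F field_differentiable (at s)"
  proof (rule series_differentiable_comparison_complex[OF op, of f])
    fix n s assume s: "s \<in> {s. Re s > \<alpha>}"
    show "f n field_differentiable at s"
    proof (cases "n = 0")
      case True
      hence "f n = (\<lambda>_. 0)" using f0 by auto
      thus ?thesis by (simp add: field_differentiable_const)
    next
      case False
      thus ?thesis using hol[of n] s op holomorphic_on_imp_differentiable_at by blast
    qed
  next
    fix s assume s: "s \<in> {s. Re s > \<alpha>}"
    \<comment> \<open>Half the distance to the boundary line, so that the terms on the disc of
      radius \<open>d\<close> around \<open>s\<close> are dominated by n^(- d - 1).\<close>
    define d where "d = (Re s - \<alpha>) / 2"
    have d: "d > 0" using s by (simp add: d_def)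
    show "\<exists>d (h::nat \<Rightarrow> complex). 0 < d \<and> summable h \<and> range h \<subseteq> \<real>\<^sub>\<ge>\<^sub>0 \<and>
        (\<forall>\<^sub>F n in sequentially. \<forall>y\<in>ball s d \<inter> {s. \<alpha> < Re s}. norm (f n y) \<le> norm (h n))"
    proof (intro exI[of _ d] exI[of _ "\<lambda>n. of_real (C * real n powr (- d - 1))"] conjI)
      have "summable (\<lambda>n. C * real n powr (- d - 1))"
        using d by (intro summable_mult) (simp add: summable_real_powr_iff)
      thus "summable (\<lambda>n. complex_of_real (C * real n powr (- d - 1)))"
        by (rule summable_of_real)
      show "range (\<lambda>n. complex_of_real (C * real n powr (- d - 1))) \<subseteq> \<real>\<^sub>\<ge>\<^sub>0"
        using C by auto
      show "\<forall>\<^sub>F n in sequentially. \<forall>y\<in>ball s d \<inter> {s. \<alpha> < Re s}. norm (f n y) \<le>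
          norm (complex_of_real (C * real n powr (- d - 1)))"
        using eventually_gt_at_top[of 0]
      proof eventually_elim
        case (elim n)
        show ?case
        proof
          fix y assume y: "y \<in> ball s d \<inter> {s. \<alpha> < Re s}"
          have "\<bar>Re (s - y)\<bar> < d" using y abs_Re_le_cmod[of "s - y"] by (auto simp: dist_norm)
          moreover have "2 * d = Re s - \<alpha>" by (simp add: d_def)
          ultimately have "\<alpha> - Re y - 1 \<le> - d - 1" by simp
          hence "C * real n powr (\<alpha> - Re y - 1) \<le> C * real n powr (- d - 1)"
            using C elim by (intro mult_left_mono powr_mono) auto
          moreover have "norm (f n y) \<le> C * real n powr (\<alpha> - Re y - 1)"
            using y elim by (intro bound) auto
          ultimately show "norm (f n y) \<le> norm (complex_of_real (C * real n powr (- d - 1)))"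
            using C by (simp del: of_real_mult)
        qed
      qed
    qed (use d in auto)
  qed blast
  thus ?thesis using op by (intro that[of F]) (auto simp: holomorphic_on_def intro: field_differentiable_at_within)
qed

text \<open>Abel summation replaces the coefficients by their bounded partial sums and n^(-s) by s
  times \<open>cell n s\<close>, which is O(n^(- Re s - 1)). The new series converges absolutely and
  locally uniformly on the whole half-plane.\<close>

theorem dirichlet_series_bounded_partial_sums:
  fixes a :: "nat \<Rightarrow> complex"
  assumes a0: "a 0 = 0" and bound: "\<And>n. norm (\<Sum>j\<le>n. a j) \<le> C"
  obtains F where "F holomorphic_on {s. Re s > 0}"
    "\<And>s. Re s > 0 \<Longrightarrow> (\<lambda>n. a n * of_nat n powr (-s)) sums F s"
proof -
  let ?A = "\<lambda>k. \<Sum>j\<le>k. a j"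
  have C: "C \<ge> 0" using bound[of 0] norm_ge_zero[of "?A 0"] by linarith
  obtain F where F: "F holomorphic_on {s. Re s > 0}" "\<And>s. Re s > 0 \<Longrightarrow> (\<lambda>n. ?A n * cell n s) sums F s"
  proof (rule holomorphic_series_right_half_plane[where f = "\<lambda>n s. ?A n * cell n s" and \<alpha> = 0 and C = C])
    fix n :: nat assume "n > 0"
    show "(\<lambda>s. ?A n * cell n s) holomorphic_on {s. Re s > 0}"
      by (intro holomorphic_intros holomorphic_on_subset[OF cell_holomorphic[OF \<open>n > 0\<close>]]) auto
    fix s :: complex assume "Re s > 0"
    have "norm (cell n s) \<le> real n powr (- Re s - 1)"
      using \<open>n > 0\<close> \<open>Re s > 0\<close> by (intro cell_bound_power) auto
    thus "norm (?A n * cell n s) \<le> C * real n powr (0 - Re s - 1)"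
      unfolding norm_mult using bound[of n] C by (intro mult_mono) auto
  qed (use a0 in auto)
  show ?thesis
  proof (rule that[of "\<lambda>s. s * F s"])
    fix s :: complex assume s: "Re s > 0"
    show "(\<lambda>n. a n * of_nat n powr (-s)) sums (s * F s)"
    proof (rule dirichlet_partial_summation[OF _ _ F(2)[OF s]])
      have "(\<lambda>N. real N powr (- Re s)) \<longlonglongrightarrow> 0"
        using s by (intro tendsto_neg_powr filterlim_real_sequentially) auto
      hence lim: "(\<lambda>N. C * real N powr (- Re s)) \<longlonglongrightarrow> 0"
        by (rule tendsto_mult_right_zero)
      have ev: "eventually (\<lambda>N. norm (?A N * of_nat N powr (-s)) \<le> C * real N powr (- Re s)) at_top"
        using eventually_gt_at_top[of 0]
      proof eventually_elim
        case (elim N)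
        have "norm (complex_of_nat N powr (-s)) = real N powr (- Re s)"
          using elim by (subst norm_powr_real_powr) auto
        thus ?case using bound[of N] by (simp add: norm_mult mult_right_mono)
      qed
      show "(\<lambda>N. ?A N * of_nat N powr (-s)) \<longlonglongrightarrow> 0"
        by (rule Lim_null_comparison[OF ev lim])
    qed (use s in auto)
  qed (intro holomorphic_intros F)
qed

text \<open>\<open>Z s\<close> is (s - 1) zeta(s). The function \<open>g n\<close> is minus the
  integral of (x - n) x^(-s-1) over the n-th unit interval, hence O(n^(- Re s - 1)), while the cells
  at s - 1 telescope to 1 / (s - 1). This is the formula zeta(s) = s / (s - 1) + s G(s).\<close>

theorem zeta_continuation:
  obtains Z where "Z holomorphic_on {s. Re s > 0}" "Z 1 = 1"
    "\<And>s. Re s > 1 \<Longrightarrow> (\<lambda>n. of_nat n powr (-s)) sums (Z s / (s - 1))"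
proof -
  define g where "g = (\<lambda>n s. if n = 0 then 0 else of_nat n * cell n s - cell n (s - 1))"
  obtain G where G: "G holomorphic_on {s. Re s > 0}" "\<And>s. Re s > 0 \<Longrightarrow> (\<lambda>n. g n s) sums G s"
  proof (rule holomorphic_series_right_half_plane[where f = g and \<alpha> = 0 and C = 1])
    fix n :: nat assume n: "n > 0"
    have "(cell n \<circ> (\<lambda>s. s - 1)) holomorphic_on UNIV"
      by (intro holomorphic_on_compose_gen[OF _ cell_holomorphic[OF n]] holomorphic_intros) auto
    hence "(\<lambda>s. cell n (s - 1)) holomorphic_on UNIV" by (simp add: o_def)
    hence "(\<lambda>s. of_nat n * cell n s - cell n (s - 1)) holomorphic_on {s. Re s > 0}"
      by (intro holomorphic_intros holomorphic_on_subset[OF cell_holomorphic[OF n]]) (auto elim: holomorphic_on_subset)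
    thus "g n holomorphic_on {s. Re s > 0}" using n by (simp add: g_def)
    fix s :: complex assume s: "Re s > 0"
    have "norm (of_nat n * cell n s - cell n (s - 1)) \<le> real n powr (- Re s - 1) * measure lborel (cbox (real n) (real (Suc n)))"
    proof (rule has_integral_bound)
      show "((\<lambda>x. of_nat n * of_real x powr (-s-1) - of_real x powr (-(s-1)-1)) has_integral
          (of_nat n * cell n s - cell n (s - 1))) (cbox (real n) (real (Suc n)))"
        using cell_has_integral[OF n, of s] cell_has_integral[OF n, of "s - 1"]
        by (intro has_integral_diff has_integral_mult_right) auto
      fix x assume "x \<in> cbox (real n) (real (Suc n))"
      hence x: "real n \<le> x" "x \<le> real n + 1" "x > 0" using n by auto
      have "of_nat n * complex_of_real x powr (-s-1) - of_real x powr (-(s-1)-1) =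
          of_real (real n - x) * of_real x powr (-s-1)"
        using x by (simp add: field_simps powr_diff)
      hence "norm (of_nat n * complex_of_real x powr (-s-1) - of_real x powr (-(s-1)-1)) = (x - real n) * x powr (- Re s - 1)"
        using x by (simp only: norm_mult norm_of_real) (simp add: norm_powr_real_powr)
      also have "\<dots> \<le> 1 * real n powr (- Re s - 1)"
        using x n s by (intro mult_mono powr_mono2') auto
      finally show "norm (of_nat n * complex_of_real x powr (-s-1) - of_real x powr (-(s-1)-1)) \<le> real n powr (- Re s - 1)"
        by simp
    qed auto
    thus "norm (g n s) \<le> 1 * real n powr (0 - Re s - 1)" using n by (simp add: g_def)
  qed (auto simp: g_def)
  show ?thesis
  proof (rule that[of "\<lambda>s. s * (s - 1) * G s + s"])
    fix s :: complex assume s: "Re s > 1"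
    have s1: "s \<noteq> 1" using s by auto
    define b where "b = (\<lambda>n. if n = 0 then (0::complex) else cell n (s - 1))"
    have b: "b sums (1 / (s - 1))"
    proof -
      have "(\<lambda>n. (- (of_nat (Suc n) powr (-(s-1))) / (s - 1)) - (- (of_nat n powr (-(s-1))) / (s - 1))) sums
         (0 - (- (of_nat 0 powr (-(s-1))) / (s - 1)))"
      proof (rule telescope_sums)
        have "(\<lambda>n. complex_of_nat n powr (-(s-1))) \<longlonglongrightarrow> 0"
          using s by (intro tendsto_neg_powr_complex_of_nat[OF filterlim_ident]) auto
        from tendsto_divide[OF tendsto_minus[OF this] tendsto_const[of "s - 1"]]
        show "(\<lambda>n. - (complex_of_nat n powr (-(s-1))) / (s - 1)) \<longlonglongrightarrow> 0" using s1 by simp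
      qed
      hence "(\<lambda>n. (of_nat n powr (-(s-1)) - of_nat (Suc n) powr (-(s-1))) / (s - 1)) sums 0"
        by (simp add: diff_divide_distrib)
      \<comment> \<open>Since \<open>0 powr z = 0\<close>, the telescoping series carries an extra
        term -1 / (s - 1) at index 0; adding it back gives \<open>b\<close>.\<close>
      from sums_add[OF this sums_single[of 0 "\<lambda>_. 1 / (s - 1)"]]
      have "(\<lambda>n. (of_nat n powr (-(s-1)) - of_nat (Suc n) powr (-(s-1))) / (s - 1) + (if n = 0 then 1 / (s - 1) else 0)) sums (1 / (s - 1))"
        by simp
      moreover have "(\<lambda>n. (of_nat n powr (-(s-1)) - of_nat (Suc n) powr (-(s-1))) / (s - 1) + (if n = 0 then 1 / (s - 1) else 0)) = b"
        using s1 by (auto simp: b_def fun_eq_iff cell_nonzero)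
      ultimately show ?thesis by simp
    qed
    let ?one = "\<lambda>n. if n = 0 then 0 else (1::complex)"
    have part: "(\<Sum>j\<le>n. ?one j) = of_nat n" for n by (induction n) auto
    have "(\<lambda>n. ?one n * of_nat n powr (-s)) sums (s * (G s + 1 / (s - 1)))"
    proof (rule dirichlet_partial_summation)
      have "(\<lambda>n. g n s + b n) sums (G s + 1 / (s - 1))"
        using s b by (intro sums_add G) auto
      also have "(\<lambda>n. g n s + b n) = (\<lambda>k. (\<Sum>j\<le>k. ?one j) * cell k s)"
        unfolding part by (auto simp: g_def b_def)
      finally show "(\<lambda>k. (\<Sum>j\<le>k. ?one j) * cell k s) sums (G s + 1 / (s - 1))" .
      have "(\<lambda>n. complex_of_nat n powr (-(s-1))) \<longlonglongrightarrow> 0"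
        using s by (intro tendsto_neg_powr_complex_of_nat[OF filterlim_ident]) auto
      moreover have "eventually (\<lambda>N. complex_of_nat N powr (-(s-1)) = (\<Sum>j\<le>N. ?one j) * of_nat N powr (-s)) at_top"
        using eventually_gt_at_top[of 0] unfolding part
        by eventually_elim (simp add: powr_diff powr_add powr_minus field_simps)
      ultimately show "(\<lambda>N. (\<Sum>j\<le>N. ?one j) * of_nat N powr (-s)) \<longlonglongrightarrow> 0"
        by (rule Lim_transform_eventually)
    qed (use s in auto)
    also have "(\<lambda>n. ?one n * of_nat n powr (-s)) = (\<lambda>n. of_nat n powr (-s))"
      by auto
    also have "s * (G s + 1 / (s - 1)) = (s * (s - 1) * G s + s) / (s - 1)"
      using s1 by (simp add: field_simps)
    finally show "(\<lambda>n. of_nat n powr (-s)) sums ((s * (s - 1) * G s + s) / (s - 1))" .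
  qed (auto intro!: holomorphic_intros G)
qed

section \<open>Dirichlet characters\<close>

definition dirichlet_character :: "nat \<Rightarrow> (nat \<Rightarrow> complex) \<Rightarrow> bool" where
  "dirichlet_character M \<xi> \<longleftrightarrow>
     (\<forall>m n. [m = n] (mod M) \<longrightarrow> \<xi> m = \<xi> n) \<and>
     (\<forall>m n. \<xi> (m * n) = \<xi> m * \<xi> n) \<and>
     (\<forall>n. \<xi> n \<noteq> 0 \<longleftrightarrow> coprime n M)"

definition principal_character :: "nat \<Rightarrow> nat \<Rightarrow> complex" where
  "principal_character M n = (if coprime n M then 1 else 0)"

section \<open>Extending characters from subgroups\<close>

text \<open>A homomorphism into the nonzero complex numbers from a subgroup of the units
  modulo \<open>M\<close>, the subgroup being represented by the union \<open>H\<close> of its residue classes.\<close>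

definition partial_character :: "nat \<Rightarrow> nat set \<Rightarrow> (nat \<Rightarrow> complex) \<Rightarrow> bool" where
  "partial_character M H \<xi> \<longleftrightarrow> 1 \<in> H \<and> (\<forall>x\<in>H. coprime x M \<and> \<xi> x \<noteq> 0) \<and>
     (\<forall>x y. x \<in> H \<longrightarrow> [x = y] (mod M) \<longrightarrow> y \<in> H \<and> \<xi> x = \<xi> y) \<and>
     (\<forall>x\<in>H. \<forall>y\<in>H. x * y \<in> H \<and> \<xi> (x * y) = \<xi> x * \<xi> y)"

lemma partial_characterD:
  assumes "partial_character M H \<xi>"
  shows "1 \<in> H" "x \<in> H \<Longrightarrow> coprime x M" "x \<in> H \<Longrightarrow> \<xi> x \<noteq> 0"
    "x \<in> H \<Longrightarrow> [x = y] (mod M) \<Longrightarrow> y \<in> H" "x \<in> H \<Longrightarrow> [x = y] (mod M) \<Longrightarrow> \<xi> x = \<xi> y"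
    "x \<in> H \<Longrightarrow> y \<in> H \<Longrightarrow> x * y \<in> H" "x \<in> H \<Longrightarrow> y \<in> H \<Longrightarrow> \<xi> (x * y) = \<xi> x * \<xi> y"
  using assms unfolding partial_character_def by blast+

lemma partial_character_power:
  assumes "partial_character M H \<xi>" "x \<in> H"
  shows "x ^ j \<in> H" "\<xi> (x ^ j) = \<xi> x ^ j"
proof -
  have "\<xi> 1 * \<xi> 1 = \<xi> 1 * 1"
    using partial_characterD(7)[OF assms(1) partial_characterD(1,1)[OF assms(1)]] by simp
  hence "\<xi> 1 = 1" using partial_characterD(1,3)[OF assms(1)] by (metis mult_left_cancel)
  hence "x ^ j \<in> H \<and> \<xi> (x ^ j) = \<xi> x ^ j"
  proof (induction j)
    case (Suc j)
    thus ?case using partial_characterD(6,7)[OF assms(1,2), of "x ^ j"] by simp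
  qed (use partial_characterD(1)[OF assms(1)] in simp)
  thus "x ^ j \<in> H" "\<xi> (x ^ j) = \<xi> x ^ j" by auto
qed

text \<open>\<open>H\<close> is closed under division although inverses are not part of its
  definition: by Euler's theorem the power of \<open>x\<close> with exponent
  \<open>totient M - 1\<close>, again in \<open>H\<close>, is an inverse of
  \<open>x\<close>.\<close>

lemma partial_character_cancel:
  assumes pc: "partial_character M H \<xi>" and M: "M > 0" and "x \<in> H" "x * y \<in> H"
  shows "y \<in> H"
proof -
  have x: "coprime x M" using partial_characterD(2)[OF pc \<open>x \<in> H\<close>] .
  have "totient M > 0" using M by simp
  hence "x ^ (totient M - 1) * x = x ^ totient M" by (rule power_minus_mult)
  hence "[x ^ (totient M - 1) * x * y = 1 * y] (mod M)"
    using euler_theorem[OF x] by (intro cong_mult) auto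
  moreover have "x ^ (totient M - 1) * (x * y) \<in> H"
    using partial_character_power[OF pc \<open>x \<in> H\<close>] assms partial_characterD(6)[OF pc] by blast
  ultimately show ?thesis using partial_characterD(4)[OF pc] by (simp add: mult.assoc)
qed

text \<open>\<open>k\<close> is the order of \<open>a\<close> modulo the subgroup \<open>H\<close>,
  and every k-th root \<open>w\<close> of \<xi> (a^k) is an admissible value at \<open>a\<close>.
  The full freedom in \<open>w\<close>, together with k > 1, is what later separates a residue from
  1.\<close>

lemma partial_character_extend:
  assumes pc: "partial_character M H \<xi>" and M: "M > 0" and a: "coprime a M" "a \<notin> H"
  shows "\<exists>k>1. a ^ k \<in> H \<and> (\<forall>w. w ^ k = \<xi> (a ^ k) \<longrightarrow>
    (\<exists>H' \<xi>'. partial_character M H' \<xi>' \<and> H \<subseteq> H' \<and> a \<in> H' \<and>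
       \<xi>' a = w \<and> (\<forall>h\<in>H. \<xi>' h = \<xi> h)))"
proof -
  note D = partial_characterD[OF pc]
  define k where "k = (LEAST k. k > 0 \<and> a ^ k \<in> H)"
  have "a ^ totient M \<in> H"
    using D(1) D(4)[of 1 "a ^ totient M"] euler_theorem[OF a(1)] cong_sym by blast
  hence "\<exists>k. k > 0 \<and> a ^ k \<in> H" using M by (intro exI[of _ "totient M"]) auto
  hence k: "k > 0" "a ^ k \<in> H"
    using LeastI_ex[of "\<lambda>k. k > 0 \<and> a ^ k \<in> H"] unfolding k_def by auto
  have k_least: "k \<le> j" if "j > 0" "a ^ j \<in> H" for j
    unfolding k_def using that by (intro Least_le) auto
  have k1: "k > 1" using k a by (cases "k = 1") auto
  have k_dvd: "k dvd d" if "a ^ d \<in> H" for d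
  proof (rule ccontr)
    assume "\<not> k dvd d"
    hence r: "d mod k > 0" "d mod k < k" using k by (auto simp: dvd_eq_mod_eq_0)
    have "a ^ d = (a ^ k) ^ (d div k) * a ^ (d mod k)"
      by (simp flip: power_mult power_add)
    hence "a ^ (d mod k) \<in> H"
      using partial_character_cancel[OF pc M, of "(a ^ k) ^ (d div k)" "a ^ (d mod k)"]
        that partial_character_power[OF pc k(2)] by auto
    thus False using k_least[of "d mod k"] r by auto
  qed
  show ?thesis
  proof (intro exI[of _ k] conjI k1 k(2) allI impI)
    fix w :: complex assume w: "w ^ k = \<xi> (a ^ k)"
    have w0: "w \<noteq> 0" using w D(3)[OF k(2)] k by (auto simp: zero_power)
    have w_pow: "\<xi> (a ^ d) = w ^ d" if ad: "a ^ d \<in> H" for d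
    proof -
      obtain q where q: "d = k * q" using k_dvd[OF ad] by auto
      have "\<xi> (a ^ d) = \<xi> (a ^ k) ^ q"
        unfolding q power_mult by (rule partial_character_power[OF pc k(2)])
      thus ?thesis by (simp add: q power_mult w)
    qed
    \<comment> \<open>The value \<xi> h w^j does not depend on how an element is written as h a^j:
      cancelling a power of \<open>a\<close> puts a^(j - j') into \<open>H\<close>, where \<xi>
      already agrees with powers of \<open>w\<close>.\<close>
    have le: "\<xi> h * w ^ j = \<xi> h' * w ^ j'"
      if h: "h \<in> H" "h' \<in> H" and c: "[h * a ^ j = h' * a ^ j'] (mod M)" and "j' \<le> j" for h h' j j'
    proof -
      have "[h * a ^ (j - j') * a ^ j' = h' * a ^ j'] (mod M)"
        using c \<open>j' \<le> j\<close> by (simp add: mult.assoc flip: power_add)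
      hence c': "[h * a ^ (j - j') = h'] (mod M)"
        using a by (subst (asm) cong_mult_rcancel_nat) auto
      hence H1: "h * a ^ (j - j') \<in> H" using D(4)[OF h(2)] cong_sym by blast
      hence H2: "a ^ (j - j') \<in> H" using partial_character_cancel[OF pc M h(1)] by auto
      have "\<xi> h' = \<xi> (h * a ^ (j - j'))" using D(5)[OF H1 c'] by simp
      also have "\<dots> = \<xi> h * w ^ (j - j')" using D(7)[OF h(1) H2] w_pow[OF H2] by simp
      finally show ?thesis using \<open>j' \<le> j\<close> by (simp add: mult.assoc flip: power_add)
    qed
    have wd: "\<xi> h * w ^ j = \<xi> h' * w ^ j'"
      if "h \<in> H" "h' \<in> H" "[h * a ^ j = h' * a ^ j'] (mod M)" for h h' j j'
    proof (cases "j' \<le> j")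
      case True
      thus ?thesis by (rule le[OF that])
    next
      case False
      hence "j \<le> j'" by simp
      thus ?thesis by (rule le[OF that(2,1) cong_sym[OF that(3)], symmetric])
    qed
    define rep where "rep = (\<lambda>y p. fst p \<in> H \<and> [y = fst p * a ^ snd p] (mod M))"
    define H' where "H' = {y. \<exists>p. rep y p}"
    define \<xi>' where "\<xi>' = (\<lambda>y. let p = (SOME p. rep y p) in \<xi> (fst p) * w ^ snd p)"
    have \<xi>': "\<xi>' y = \<xi> h * w ^ j" if "h \<in> H" "[y = h * a ^ j] (mod M)" for y h j
    proof -
      have "rep y (h, j)" using that by (simp add: rep_def)
      hence "rep y (SOME p. rep y p)" by (rule someI)
      moreover define p where "p = (SOME p. rep y p)"
      ultimately have "fst p \<in> H" "[y = fst p * a ^ snd p] (mod M)" by (auto simp: rep_def)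
      hence "\<xi> (fst p) * w ^ snd p = \<xi> h * w ^ j"
        using that by (intro wd) (auto intro: cong_trans cong_sym)
      thus ?thesis by (simp add: \<xi>'_def p_def Let_def)
    qed
    have H'I: "y \<in> H'" if "h \<in> H" "[y = h * a ^ j] (mod M)" for y h j
      using that unfolding H'_def rep_def by (auto intro!: exI[of _ "(h, j)"])
    have H'E: "\<exists>h j. h \<in> H \<and> [y = h * a ^ j] (mod M)" if "y \<in> H'" for y
      using that unfolding H'_def rep_def by auto
    have "partial_character M H' \<xi>'"
      unfolding partial_character_def
    proof (intro conjI allI ballI impI)
      show "1 \<in> H'" using D(1) by (intro H'I[of 1 _ 0]) auto
    next
      fix x assume "x \<in> H'"
      then obtain h j where hj: "h \<in> H" "[x = h * a ^ j] (mod M)" using H'E by blast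
      have "coprime (h * a ^ j) M" using D(2)[OF hj(1)] a by simp
      thus "coprime x M" using hj(2) cong_imp_coprime cong_sym by blast
      show "\<xi>' x \<noteq> 0" using \<xi>'[OF hj] D(3)[OF hj(1)] w0 by simp
    next
      fix x y assume "x \<in> H'" and xy: "[x = y] (mod M)"
      then obtain h j where hj: "h \<in> H" "[x = h * a ^ j] (mod M)" using H'E by blast
      have hj': "[y = h * a ^ j] (mod M)" using hj xy cong_trans cong_sym by blast
      show "y \<in> H'" using H'I[OF hj(1) hj'] .
      show "\<xi>' x = \<xi>' y" using \<xi>'[OF hj] \<xi>'[OF hj(1) hj'] by simp
    next
      fix x y assume "x \<in> H'" "y \<in> H'"
      then obtain h j h' j' where hj: "h \<in> H" "[x = h * a ^ j] (mod M)" "h' \<in> H" "[y = h' * a ^ j'] (mod M)"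
        using H'E by meson
      have c: "[x * y = (h * h') * a ^ (j + j')] (mod M)"
        using cong_mult[OF hj(2,4)] by (simp add: power_add mult_ac)
      have hh: "h * h' \<in> H" using D(6) hj by blast
      show "x * y \<in> H'" using H'I[OF hh c] .
      show "\<xi>' (x * y) = \<xi>' x * \<xi>' y"
        using \<xi>'[OF hh c] \<xi>'[OF hj(1,2)] \<xi>'[OF hj(3,4)] D(7)[OF hj(1,3)] by (simp add: power_add mult_ac)
    qed
    moreover have "H \<subseteq> H'" by (auto intro: H'I[of _ _ 0])
    moreover have "a \<in> H'" using D(1) by (intro H'I[of 1 _ 1]) auto
    moreover have "\<xi> 1 = 1" using partial_character_power[OF pc D(1), of 0] by simp
    hence "\<xi>' a = w" using \<xi>'[of 1 a 1] D(1) by auto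
    moreover have "\<forall>h\<in>H. \<xi>' h = \<xi> h" using \<xi>'[of _ _ 0] by auto
    ultimately show "\<exists>H' \<xi>'. partial_character M H' \<xi>' \<and> H \<subseteq> H' \<and> a \<in> H' \<and> \<xi>' a = w \<and> (\<forall>h\<in>H. \<xi>' h = \<xi> h)"
      by blast
  qed
qed

text \<open>Each extension step captures at least one new residue class, so the number of missing
  units decreases; a k-th root to continue with always exists in the complex numbers. Once
  \<open>H\<close> contains all units, extension by 0 gives a character.\<close>

lemma partial_character_extend_full:
  assumes "partial_character M H \<xi>" "M > 0"
  shows "\<exists>\<psi>. dirichlet_character M \<psi> \<and> (\<forall>h\<in>H. \<psi> h = \<xi> h)"
  using assms(1)
proof (induction "card ({x. x < M \<and> coprime x M} - H)" arbitrary: H \<xi> rule: less_induct)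
  case less
  note D = partial_characterD[OF less.prems]
  show ?case
  proof (cases "\<exists>a. coprime a M \<and> a \<notin> H")
    case False
    hence H: "x \<in> H \<longleftrightarrow> coprime x M" for x using D by blast
    have cc: "coprime x M \<longleftrightarrow> coprime y M" if "[x = y] (mod M)" for x y
      using that cong_imp_coprime cong_sym by blast
    have "dirichlet_character M (\<lambda>x. if coprime x M then \<xi> x else 0)"
      unfolding dirichlet_character_def
    proof (intro conjI allI impI)
      fix m n assume c: "[m = n] (mod M)"
      show "(if coprime m M then \<xi> m else 0) = (if coprime n M then \<xi> n else 0)"
        using cc[OF c] D(5)[OF _ c] H by simp
    next
      fix m n
      show "(if coprime (m * n) M then \<xi> (m * n) else 0) =
          (if coprime m M then \<xi> m else 0) * (if coprime n M then \<xi> n else 0)"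
        using D(7)[of m n] H by simp
    next
      fix n show "((if coprime n M then \<xi> n else 0) \<noteq> 0) = coprime n M"
        using D(3)[of n] H by simp
    qed
    thus ?thesis using D(2) by (intro exI[of _ "\<lambda>x. if coprime x M then \<xi> x else 0"]) simp
  next
    case True
    then obtain a where a: "coprime a M" "a \<notin> H" by blast
    obtain k where k: "k > 1" "a ^ k \<in> H" and ext: "\<And>w. w ^ k = \<xi> (a ^ k) \<Longrightarrow>
       \<exists>H' \<xi>'. partial_character M H' \<xi>' \<and> H \<subseteq> H' \<and> a \<in> H' \<and> \<xi>' a = w \<and> (\<forall>h\<in>H. \<xi>' h = \<xi> h)"
      using partial_character_extend[OF less.prems assms(2) a] by blast
    define w where "w = exp (Ln (\<xi> (a ^ k)) / of_nat k)"
    have "w ^ k = \<xi> (a ^ k)"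
      using k D(3)[OF k(2)] by (simp add: w_def flip: exp_of_nat_mult)
    from ext[OF this] obtain H' \<xi>' where H': "partial_character M H' \<xi>'" "H \<subseteq> H'" "a \<in> H'" "\<forall>h\<in>H. \<xi>' h = \<xi> h"
      by blast
    have am: "a mod M \<in> H'" "a mod M \<notin> H" "coprime (a mod M) M" "a mod M < M"
      using H' a D(4)[of "a mod M" a] partial_characterD(4)[OF H'(1,3), of "a mod M"] assms(2)
      by (auto simp: coprime_mod_left_iff)
    have "card ({x. x < M \<and> coprime x M} - H') < card ({x. x < M \<and> coprime x M} - H)"
      using am H'(2) by (intro psubset_card_mono) auto
    from less.hyps[OF this H'(1)] obtain \<psi> where "dirichlet_character M \<psi>" "\<forall>h\<in>H'. \<psi> h = \<xi>' h" by blast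
    thus ?thesis using H' by (intro exI[of _ \<psi>]) auto
  qed
qed

text \<open>Start from the trivial subgroup. The value at \<open>n\<close> may be any k-th root of
  1, where k > 1 is the order of \<open>n\<close>; the primitive root with angle 2 \<pi> / k is not
  1.\<close>

theorem dirichlet_character_separating:
  assumes "M > 0" "coprime n M" "\<not> [n = 1] (mod M)"
  obtains \<xi> where "dirichlet_character M \<xi>" "\<xi> n \<noteq> 1"
proof -
  define H where "H = {y. [1 = y] (mod M)}"
  have pc: "partial_character M H (\<lambda>_. 1)"
    unfolding partial_character_def H_def
    using cong_mult[of 1 _ M 1] by (auto intro: cong_trans cong_imp_coprime)
  have "n \<notin> H" using assms(3) by (auto simp: H_def cong_sym_eq)
  obtain k where k: "k > 1" "n ^ k \<in> H" and ext: "\<And>w. w ^ k = (1::complex) \<Longrightarrow>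
       \<exists>H' \<xi>'. partial_character M H' \<xi>' \<and> H \<subseteq> H' \<and> n \<in> H' \<and> \<xi>' n = w \<and> (\<forall>h\<in>H. \<xi>' h = 1)"
    using partial_character_extend[OF pc assms(1,2) \<open>n \<notin> H\<close>] by auto
  define w where "w = cis (2 * pi / real k)"
  have "w ^ k = 1" using k Complex.DeMoivre[of "2 * pi / real k" k] by (simp add: w_def)
  from ext[OF this] obtain H' \<xi>' where H': "partial_character M H' \<xi>'" "n \<in> H'" "\<xi>' n = w" by blast
  have "w \<noteq> 1"
  proof
    assume "w = 1"
    hence "cos (2 * pi / real k) = 1" by (simp add: w_def complex_eq_iff)
    then obtain j :: int where "2 * pi / real k = real_of_int j * 2 * pi"
      by (auto simp: cos_one_2pi_int)
    hence "1 = real_of_int j * real k" using k by (simp add: field_simps)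
    hence "1 = j * int k" by (metis of_int_1 of_int_eq_iff of_int_mult of_int_of_nat_eq)
    hence "int k dvd 1" by (metis dvd_triv_right)
    thus False using k by simp
  qed
  moreover obtain \<psi> where "dirichlet_character M \<psi>" "\<forall>h\<in>H'. \<psi> h = \<xi>' h"
    using partial_character_extend_full[OF H'(1) assms(1)] by blast
  ultimately show ?thesis using H' by (intro that[of \<psi>]) auto
qed

section \<open>Values of characters and the orthogonality relations\<close>

lemma dirichlet_characterD:
  assumes "dirichlet_character M \<xi>"
  shows "[m = n] (mod M) \<Longrightarrow> \<xi> m = \<xi> n" "\<xi> (m * n) = \<xi> m * \<xi> n" "\<xi> n = 0 \<longleftrightarrow> \<not> coprime n M"
    "\<xi> 1 = 1"
proof -
  show "[m = n] (mod M) \<Longrightarrow> \<xi> m = \<xi> n" "\<xi> (m * n) = \<xi> m * \<xi> n" "\<xi> n = 0 \<longleftrightarrow> \<not> coprime n M"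
    using assms unfolding dirichlet_character_def by blast+
  have "\<xi> 1 \<noteq> 0" using assms unfolding dirichlet_character_def by simp
  moreover have "\<xi> (1 * 1) = \<xi> 1 * \<xi> 1" using assms unfolding dirichlet_character_def by blast
  ultimately show "\<xi> 1 = 1" unfolding mult_1 by (metis mult_cancel_right1)
qed

lemma dirichlet_character_power:
  assumes "dirichlet_character M \<xi>"
  shows "\<xi> (n ^ k) = \<xi> n ^ k"
  using dirichlet_characterD[OF assms] by (induction k) auto

lemma dirichlet_character_root_of_unity:
  assumes "dirichlet_character M \<xi>" "coprime n M"
  shows "\<xi> n ^ totient M = 1"
  using dirichlet_characterD(1)[OF assms(1) euler_theorem[OF assms(2)]]
    dirichlet_characterD(4)[OF assms(1)] dirichlet_character_power[OF assms(1)] by simp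

lemma dirichlet_character_norm:
  assumes "dirichlet_character M \<xi>" "M > 0"
  shows "norm (\<xi> n) = (if coprime n M then 1 else 0)"
proof (cases "coprime n M")
  case True
  have "norm (\<xi> n) ^ totient M = 1"
    using dirichlet_character_root_of_unity[OF assms(1) True] by (metis norm_one norm_power)
  thus ?thesis using True assms(2) power_eq_imp_eq_base[of "norm (\<xi> n)" "totient M" 1] by simp
qed (use dirichlet_characterD(3)[OF assms(1)] in auto)

lemma dirichlet_character_principal: "dirichlet_character M (principal_character M)"
  unfolding dirichlet_character_def principal_character_def
  using cong_imp_coprime cong_sym by (auto simp: coprime_mult_left_iff) blast+

lemma dirichlet_character_mult:
  assumes "dirichlet_character M \<xi>" "dirichlet_character M \<psi>"
  shows "dirichlet_character M (\<lambda>n. \<xi> n * \<psi> n)"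
  using assms unfolding dirichlet_character_def by auto

lemma finite_dirichlet_characters:
  assumes "M > 0"
  shows "finite {\<xi>. dirichlet_character M \<xi>}"
proof -
  define R where "R = insert 0 {z :: complex. z ^ totient M = 1}"
  have "finite R" unfolding R_def using assms finite_roots_unity[of "totient M"] by (simp add: Suc_le_eq)
  hence "finite ({..<M} \<rightarrow>\<^sub>E R)" by (intro finite_PiE) auto
  moreover have "(\<lambda>\<xi>. restrict \<xi> {..<M}) ` {\<xi>. dirichlet_character M \<xi>} \<subseteq> {..<M} \<rightarrow>\<^sub>E R"
  proof -
    have "\<xi> n \<in> R" if "dirichlet_character M \<xi>" for \<xi> n
      using dirichlet_character_root_of_unity[OF that, of n] dirichlet_characterD(3)[OF that, of n]
      by (cases "coprime n M") (auto simp: R_def)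
    thus ?thesis by (auto simp: PiE_def Pi_def extensional_def)
  qed
  moreover have "inj_on (\<lambda>\<xi>. restrict \<xi> {..<M}) {\<xi>. dirichlet_character M \<xi>}"
  proof (rule inj_onI, rule ext)
    fix \<xi> \<psi> n assume *: "\<xi> \<in> {\<xi>. dirichlet_character M \<xi>}" "\<psi> \<in> {\<xi>. dirichlet_character M \<xi>}"
      "restrict \<xi> {..<M} = restrict \<psi> {..<M}"
    have "\<xi> (n mod M) = \<psi> (n mod M)" using fun_cong[OF *(3), of "n mod M"] assms by simp
    moreover have "\<xi> n = \<xi> (n mod M)" "\<psi> n = \<psi> (n mod M)"
      using * by (auto intro!: dirichlet_characterD(1)[of M])
    ultimately show "\<xi> n = \<psi> n" by simp
  qed
  ultimately show ?thesis by (meson finite_imageD finite_subset)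
qed

text \<open>Multiplication by a unit \<open>a\<close> with \<xi> a \<noteq> 1 permutes the residues,
  so the sum equals \<xi> a times itself.\<close>

lemma sum_dirichlet_character:
  assumes "dirichlet_character M \<xi>" "\<xi> \<noteq> principal_character M" "M > 0"
  shows "(\<Sum>n<M. \<xi> n) = 0"
proof -
  obtain a where a: "\<xi> a \<noteq> principal_character M a" using assms(2) by auto
  hence ac: "coprime a M" using dirichlet_characterD(3)[OF assms(1), of a] by (auto simp: principal_character_def split: if_splits)
  hence a1: "\<xi> a \<noteq> 1" using a by (simp add: principal_character_def)
  have "bij_betw (\<lambda>n. a * n mod M) {..<M} {..<M}"
  proof (rule bij_betwI')
    fix x y assume "x \<in> {..<M}" "y \<in> {..<M}"
    thus "(a * x mod M = a * y mod M) = (x = y)"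
      using cong_mult_lcancel_nat[of a M x y] ac by (auto simp: Cong.cong_def)
  next
    fix y assume "y \<in> {..<M}"
    moreover obtain b where "[a * b = 1] (mod M)" using ac cong_solve_coprime_nat by auto
    hence "[a * (b * y) = 1 * y] (mod M)" unfolding mult.assoc[symmetric] by (rule cong_mult) auto
    hence "a * (b * y mod M) mod M = y mod M" by (simp add: Cong.cong_def mod_mult_right_eq)
    ultimately show "\<exists>x\<in>{..<M}. y = a * x mod M" using assms(3) by (intro bexI[of _ "b * y mod M"]) auto
  qed (use assms in auto)
  hence "(\<Sum>n<M. \<xi> (a * n mod M)) = (\<Sum>n<M. \<xi> n)" by (rule sum.reindex_bij_betw)
  also have "(\<Sum>n<M. \<xi> (a * n mod M)) = (\<Sum>n<M. \<xi> a * \<xi> n)"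
    using dirichlet_characterD(1)[OF assms(1), of "_ mod M" "_"] dirichlet_characterD(2)[OF assms(1)]
    by (intro sum.cong refl) (metis cong_mod_left cong_refl)
  also have "\<dots> = \<xi> a * (\<Sum>n<M. \<xi> n)" by (simp add: sum_distrib_left)
  finally show ?thesis using a1 by simp
qed

text \<open>The dual argument: multiplication by a character \<psi> with \<psi> n \<noteq> 1
  permutes the characters, multiplication by the conjugate of \<psi> being its inverse.\<close>

lemma sum_over_dirichlet_characters:
  assumes "M > 0" "\<not> [n = 1] (mod M)"
  shows "(\<Sum>\<xi> | dirichlet_character M \<xi>. \<xi> n) = 0"
proof (cases "coprime n M")
  case True
  let ?X = "{\<xi>. dirichlet_character M \<xi>}"
  obtain \<psi> where \<psi>: "dirichlet_character M \<psi>" "\<psi> n \<noteq> 1"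
    using dirichlet_character_separating[OF assms(1) True assms(2)] by metis
  have norm: "norm (\<psi> m) = (if coprime m M then 1 else 0)" for m
    using dirichlet_character_norm[OF \<psi>(1) assms(1)] .
  have cnj: "dirichlet_character M (\<lambda>m. cnj (\<psi> m))"
    using \<psi>(1) unfolding dirichlet_character_def by auto
  have cancel: "\<xi> m * \<psi> m * cnj (\<psi> m) = \<xi> m" if "dirichlet_character M \<xi>" for \<xi> m
    using norm[of m] dirichlet_characterD(3)[OF that, of m] complex_norm_square[of "\<psi> m"]
    by (auto simp: mult.assoc split: if_splits)
  have "bij_betw (\<lambda>\<xi> m. \<xi> m * \<psi> m) ?X ?X"
  proof (rule bij_betwI[where g = "\<lambda>\<xi> m. \<xi> m * cnj (\<psi> m)"])
    show "(\<lambda>\<xi> m. \<xi> m * \<psi> m) \<in> ?X \<rightarrow> ?X" using dirichlet_character_mult[OF _ \<psi>(1)] by auto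
    show "(\<lambda>\<xi> m. \<xi> m * cnj (\<psi> m)) \<in> ?X \<rightarrow> ?X" using dirichlet_character_mult[OF _ cnj] by auto
  next
    fix \<xi> assume "\<xi> \<in> ?X"
    thus "(\<lambda>m. \<xi> m * \<psi> m * cnj (\<psi> m)) = \<xi>" using cancel by auto
  next
    fix \<xi> assume "\<xi> \<in> ?X"
    thus "(\<lambda>m. \<xi> m * cnj (\<psi> m) * \<psi> m) = \<xi>" using cancel by (auto simp: mult_ac)
  qed
  hence "(\<Sum>\<xi>\<in>?X. \<xi> n * \<psi> n) = (\<Sum>\<xi>\<in>?X. \<xi> n)"
    by (rule sum.reindex_bij_betw[where g = "\<lambda>\<xi>. \<xi> n"])
  hence "(\<Sum>\<xi>\<in>?X. \<xi> n) * \<psi> n = (\<Sum>\<xi>\<in>?X. \<xi> n)" by (simp add: sum_distrib_right)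
  thus ?thesis using \<psi>(2) by simp
qed (use dirichlet_characterD(3) in \<open>auto intro!: sum.neutral\<close>)

lemma sum_principal_character:
  assumes "M > 1"
  shows "(\<Sum>n<M. principal_character M n) = of_nat (totient M)"
proof -
  have "{..<M} \<inter> {n. coprime n M} = totatives M"
    using assms unfolding totatives_def by (auto simp: le_less intro!: Nat.gr0I)
  thus ?thesis by (simp add: principal_character_def sum.If_cases totient_def)
qed

text \<open>Count the double sum of \<xi> n over all characters and all residues in both orders:
  summing over n first leaves the principal character, summing over \<xi> first leaves the residue
  1.\<close>

lemma card_dirichlet_characters:
  assumes "M > 1"
  shows "card {\<xi>. dirichlet_character M \<xi>} = totient M"
proof -
  let ?X = "{\<xi>. dirichlet_character M \<xi>}"
  have fin: "finite ?X" using assms by (intro finite_dirichlet_characters) auto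
  have "(\<Sum>\<xi>\<in>?X. \<Sum>n<M. \<xi> n) = (\<Sum>\<xi>\<in>{principal_character M}. \<Sum>n<M. \<xi> n)"
    using fin assms sum_dirichlet_character dirichlet_character_principal
    by (intro sum.mono_neutral_right) auto
  also have "\<dots> = of_nat (totient M)" using sum_principal_character[OF assms] by simp
  finally have "of_nat (totient M) = (\<Sum>\<xi>\<in>?X. \<Sum>n<M. \<xi> n)" by simp
  also have "\<dots> = (\<Sum>n<M. \<Sum>\<xi>\<in>?X. \<xi> n)" by (rule sum.swap)
  also have "\<dots> = (\<Sum>n\<in>{1}. \<Sum>\<xi>\<in>?X. \<xi> n)"
    using assms by (intro sum.mono_neutral_right ballI sum_over_dirichlet_characters) (auto simp: Cong.cong_def)
  also have "\<dots> = (\<Sum>\<xi>\<in>?X. 1)" by (simp del: One_nat_def sum_constant) (intro sum.cong refl, use dirichlet_characterD(4) in auto)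
  also have "\<dots> = of_nat (card ?X)" by simp
  finally show ?thesis by (metis of_nat_eq_iff)
qed

text \<open>As \<xi> a has modulus 1, its conjugate is the value at an inverse \<open>b\<close> of
  \<open>a\<close>, and the sum becomes one of \<xi> (b n).\<close>

theorem dirichlet_character_orthogonality:
  assumes "M > 1" "coprime a M"
  shows "(\<Sum>\<xi> | dirichlet_character M \<xi>. cnj (\<xi> a) * \<xi> n) = (if [n = a] (mod M) then of_nat (totient M) else 0)"
proof -
  obtain b where b: "[a * b = 1] (mod M)" using assms cong_solve_coprime_nat by auto
  have "cnj (\<xi> a) = \<xi> b" if "dirichlet_character M \<xi>" for \<xi>
  proof -
    have "\<xi> a * \<xi> b = 1" using dirichlet_characterD[OF that] b by metis
    moreover have "\<xi> a * cnj (\<xi> a) = 1"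
      using dirichlet_character_norm[OF that, of a] assms complex_norm_square[of "\<xi> a"] by simp
    ultimately show ?thesis by (metis mult_cancel_left mult_zero_left zero_neq_one)
  qed
  hence eq: "(\<Sum>\<xi> | dirichlet_character M \<xi>. cnj (\<xi> a) * \<xi> n) = (\<Sum>\<xi> | dirichlet_character M \<xi>. \<xi> (b * n))"
    using dirichlet_characterD(2) by (intro sum.cong refl) auto
  show ?thesis
  proof (cases "[n = a] (mod M)")
    case True
    have "[b * n = b * a] (mod M)" using True by (intro cong_mult) auto
    hence "[b * n = 1] (mod M)" using b by (metis cong_trans mult.commute)
    hence "\<xi> (b * n) = 1" if "dirichlet_character M \<xi>" for \<xi>
      using dirichlet_characterD[OF that] by metis
    hence "(\<Sum>\<xi> | dirichlet_character M \<xi>. \<xi> (b * n)) = (\<Sum>\<xi> | dirichlet_character M \<xi>. 1)"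
      by (intro sum.cong refl) auto
    hence "(\<Sum>\<xi> | dirichlet_character M \<xi>. \<xi> (b * n)) = of_nat (card {\<xi>. dirichlet_character M \<xi>})"
      by simp
    thus ?thesis using True eq card_dirichlet_characters[OF assms(1)] by simp
  next
    case False
    have "\<not> [b * n = 1] (mod M)"
    proof
      assume "[b * n = 1] (mod M)"
      hence "[a * (b * n) = a * 1] (mod M)" by (intro cong_mult) auto
      moreover have "[a * b * n = 1 * n] (mod M)" using b by (intro cong_mult) auto
      ultimately show False using False by (metis cong_trans cong_sym mult.assoc mult_1 mult_1_right)
    qed
    thus ?thesis using False eq sum_over_dirichlet_characters[of M "b * n"] assms by simp
  qed
qed

section \<open>Products and derivatives of Dirichlet series\<close>

text \<open>The pairs (d, k) are sorted by their product n = d k; unconditional summability licenses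
  the regrouping.\<close>

lemma has_sum_divisors:
  fixes h :: "nat \<times> nat \<Rightarrow> complex"
  assumes "(h has_sum S) ({0<..} \<times> {0<..})"
  shows "((\<lambda>n. \<Sum>d | d dvd n. h (d, n div d)) has_sum S) {0<..}"
proof -
  have "((\<lambda>(n, d). h (d, n div d)) has_sum S) (Sigma {0<..} (\<lambda>n. {d. d dvd n})) \<longleftrightarrow>
      (h has_sum S) ({0<..} \<times> {0<..})"
    by (rule has_sum_reindex_bij_witness[where i = "\<lambda>(d, k). (d * k, d)" and j = "\<lambda>(n, d). (d, n div d)"])
       (auto elim!: dvdE intro!: Nat.gr0I)
  with assms have "((\<lambda>(n, d). h (d, n div d)) has_sum S) (Sigma {0<..} (\<lambda>n. {d. d dvd n}))" by blast
  thus ?thesis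
    by (rule has_sum_Sigma') (auto intro!: has_sum_finite)
qed

lemma has_sum_product_abs:
  fixes F G :: "nat \<Rightarrow> complex"
  assumes "summable (\<lambda>n. norm (F n))" "summable (\<lambda>n. norm (G n))" "F sums A" "G sums B"
  shows "((\<lambda>(d, k). F d * G k) has_sum (A * B)) (UNIV \<times> UNIV)"
proof (rule has_sum_SigmaI)
  have F: "(F has_sum A) UNIV" and G: "(G has_sum B) UNIV"
    using assms by (auto intro: norm_summable_imp_has_sum)
  show "((\<lambda>y. case (x, y) of (d, k) \<Rightarrow> F d * G k) has_sum F x * B) UNIV" for x
    using has_sum_cmult_right[OF G, of "F x"] by simp
  show "((\<lambda>x. F x * B) has_sum A * B) UNIV"
    using has_sum_cmult_left[OF F] by simp
  have F': "(\<lambda>n. norm (F n)) summable_on UNIV" and G': "(\<lambda>n. norm (G n)) summable_on UNIV"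
    using assms by (auto intro!: norm_summable_imp_summable_on)
  have "(\<lambda>p. norm (case p of (d, k) \<Rightarrow> F d * G k)) summable_on (UNIV \<times> UNIV)"
    unfolding Infinite_Sum.abs_summable_on_Sigma_iff
  proof
    show "\<forall>x\<in>UNIV. (\<lambda>y. norm (case (x, y) of (d, k) \<Rightarrow> F d * G k)) summable_on UNIV"
      using G' by (auto simp: norm_mult intro: summable_on_cmult_right)
    have "(\<lambda>x. norm (F x) * (\<Sum>\<^sub>\<infinity>y. norm (G y))) summable_on UNIV"
      using F' by (rule summable_on_cmult_left)
    moreover have "(\<Sum>\<^sub>\<infinity>y. norm (G y)) \<ge> 0" by (rule infsum_nonneg) auto
    ultimately show "(\<lambda>x. norm (\<Sum>\<^sub>\<infinity>y. norm (case (x, y) of (d, k) \<Rightarrow> F d * G k))) summable_on UNIV"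
      using G' by (simp add: norm_mult infsum_cmult_right' abs_mult)
  qed
  thus "(\<lambda>(d, k). F d * G k) summable_on UNIV \<times> UNIV"
    by (rule Infinite_Sum.abs_summable_summable)
qed

theorem dirichlet_series_product:
  fixes a b :: "nat \<Rightarrow> complex"
  assumes a: "summable (\<lambda>n. norm (a n * of_nat n powr (-s)))" "(\<lambda>n. a n * of_nat n powr (-s)) sums A"
    and b: "summable (\<lambda>n. norm (b n * of_nat n powr (-s)))" "(\<lambda>n. b n * of_nat n powr (-s)) sums B"
  shows "(\<lambda>n. (\<Sum>d | d dvd n. a d * b (n div d)) * of_nat n powr (-s)) sums (A * B)"
proof -
  let ?h = "\<lambda>(d, k). (a d * of_nat d powr (-s)) * (b k * of_nat k powr (-s))"
  have "(?h has_sum (A * B)) (UNIV \<times> UNIV)"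
    by (rule has_sum_product_abs[OF a(1) b(1) a(2) b(2)])
  \<comment> \<open>Pairs with a zero entry contribute nothing because \<open>0 powr z = 0\<close>,
    so no assumption on \<open>a 0\<close> or \<open>b 0\<close> appears.\<close>
  also have "?this \<longleftrightarrow> (?h has_sum (A * B)) ({0<..} \<times> {0<..})"
    by (rule has_sum_cong_neutral) (auto simp: not_less)
  finally have "((\<lambda>n. \<Sum>d | d dvd n. ?h (d, n div d)) has_sum (A * B)) {0<..}"
    by (rule has_sum_divisors)
  also have "?this \<longleftrightarrow> ((\<lambda>n. (\<Sum>d | d dvd n. a d * b (n div d)) * of_nat n powr (-s)) has_sum (A * B)) {0<..}"
  proof (rule has_sum_cong)
    fix n :: nat assume "n \<in> {0<..}"
    have "?h (d, n div d) = a d * b (n div d) * of_nat n powr (-s)" if "d dvd n" for d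
    proof -
      from that obtain k where k: "n = d * k" by (rule dvdE)
      hence "n div d = k" "d > 0" using \<open>n \<in> {0<..}\<close> by auto
      moreover have "complex_of_nat n powr (-s) = of_nat d powr (-s) * of_nat k powr (-s)"
        using powr_times_real[of "of_nat d" "of_nat k" "-s"] k by simp
      ultimately show ?thesis by simp
    qed
    thus "(\<Sum>d | d dvd n. ?h (d, n div d)) = (\<Sum>d | d dvd n. a d * b (n div d)) * of_nat n powr (-s)"
      unfolding sum_distrib_right by (intro sum.cong) auto
  qed
  also have "\<dots> \<longleftrightarrow> ((\<lambda>n. (\<Sum>d | d dvd n. a d * b (n div d)) * of_nat n powr (-s)) has_sum (A * B)) UNIV"
    by (rule has_sum_cong_neutral) auto
  finally show ?thesis by (rule has_sum_imp_sums)
qed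

lemma summable_ln_powr:
  assumes "\<sigma> > 1"
  shows "summable (\<lambda>n. ln (real n) * real n powr (-\<sigma>))"
proof (rule summable_comparison_test_bigo)
  show "summable (\<lambda>n. norm (real n powr (-(1 + \<sigma>) / 2)))"
    using assms by (simp add: summable_real_powr_iff field_simps)
  show "(\<lambda>n. ln (real n) * real n powr (-\<sigma>)) \<in> O(\<lambda>n. real n powr (-(1 + \<sigma>) / 2))"
    using assms by real_asymp
qed

lemma norm_nat_powr: "n > 0 \<Longrightarrow> norm (complex_of_nat n powr s) = real n powr (Re s)"
  by (subst norm_powr_real_powr) auto

text \<open>The bound 1 + ln n covers both a character and its product with
  \<open>mangoldt\<close>.\<close>

lemma dirichlet_series_abs_summable:
  fixes a :: "nat \<Rightarrow> complex"
  assumes "\<And>n. norm (a n) \<le> 1 + ln (real n)" "Re s > 1"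
  shows "summable (\<lambda>n. norm (a n * of_nat n powr (-s)))"
proof (rule summable_comparison_test')
  show "summable (\<lambda>n. real n powr (-Re s) + ln (real n) * real n powr (-Re s))"
    using assms summable_ln_powr[of "Re s"] by (intro summable_add) (auto simp: summable_real_powr_iff)
  fix n :: nat
  show "norm (norm (a n * of_nat n powr (-s))) \<le> real n powr (-Re s) + ln (real n) * real n powr (-Re s)"
  proof (cases "n = 0")
    case False
    hence "norm (a n * of_nat n powr (-s)) \<le> (1 + ln (real n)) * real n powr (-Re s)"
      using assms(1)[of n] by (simp add: norm_mult norm_nat_powr mult_right_mono)
    thus ?thesis by (simp add: algebra_simps)
  qed auto
qed

theorem dirichlet_series_deriv:
  fixes a :: "nat \<Rightarrow> complex"
  assumes a: "\<And>n. norm (a n) \<le> 1"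
    and L: "\<And>s. Re s > 1 \<Longrightarrow> (\<lambda>n. a n * of_nat n powr (-s)) sums L s"
    and s: "Re s > 1"
  shows "(L has_field_derivative deriv L s) (at s)"
    "(\<lambda>n. - (a n * ln (real n)) * of_nat n powr (-s)) sums deriv L s"
proof -
  let ?S = "{s::complex. Re s > 1}"
  have op: "open ?S" by (rule open_halfspace_Re_gt)
  have "\<exists>g g'. \<forall>x \<in> ?S. ((\<lambda>n. a n * of_nat n powr (-x)) sums g x) \<and>
      ((\<lambda>n. - (a n * ln (real n)) * of_nat n powr (-x)) sums g' x) \<and> (g has_field_derivative g' x) (at x)"
  proof (rule series_and_derivative_comparison_complex[OF op])
    fix n x assume "x \<in> ?S"
    show "((\<lambda>s. a n * of_nat n powr (-s)) has_field_derivative - (a n * ln (real n)) * of_nat n powr (-x)) (at x)"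
    proof (cases "n = 0")
      case False
      have "((\<lambda>s. a n * exp (-s * of_real (ln (real n)))) has_field_derivative
          - (a n * ln (real n)) * exp (-x * of_real (ln (real n)))) (at x)"
        by (auto intro!: derivative_eq_intros)
      thus ?thesis using False by (simp add: powr_def flip: Ln_of_nat)
    qed auto
  next
    fix x assume x: "x \<in> ?S"
    define d where "d = (Re x - 1) / 2"
    have d: "d > 0" "2 * d = Re x - 1" using x by (auto simp: d_def)
    show "\<exists>d (h :: nat \<Rightarrow> complex). 0 < d \<and> summable h \<and> range h \<subseteq> \<real>\<^sub>\<ge>\<^sub>0 \<and>
        (\<forall>\<^sub>F n in sequentially. \<forall>y\<in>ball x d \<inter> ?S. norm (a n * of_nat n powr (-y)) \<le> norm (h n))"
    proof (intro exI[of _ d] exI[of _ "\<lambda>n. of_real (real n powr (- d - 1))"] conjI)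
      have "summable (\<lambda>n. real n powr (- d - 1))"
        using d by (simp add: summable_real_powr_iff)
      thus "summable (\<lambda>n. complex_of_real (real n powr (- d - 1)))"
        by (rule summable_of_real)
      show "\<forall>\<^sub>F n in sequentially. \<forall>y\<in>ball x d \<inter> ?S. norm (a n * of_nat n powr (-y)) \<le>
          norm (complex_of_real (real n powr (- d - 1)))"
        using eventually_gt_at_top[of 0]
      proof eventually_elim
        case (elim n)
        show ?case
        proof
          fix y assume y: "y \<in> ball x d \<inter> ?S"
          have "\<bar>Re (x - y)\<bar> < d" using y abs_Re_le_cmod[of "x - y"] by (auto simp: dist_norm)
          hence "- Re y \<le> - d - 1" using d by auto
          hence "real n powr (- Re y) \<le> real n powr (- d - 1)"
            using elim by (intro powr_mono) auto
          moreover have "norm (a n * of_nat n powr (-y)) \<le> 1 * real n powr (- Re y)"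
            using a[of n] elim by (simp only: norm_mult norm_nat_powr) (intro mult_mono, auto)
          ultimately show "norm (a n * of_nat n powr (-y)) \<le> norm (complex_of_real (real n powr (- d - 1)))"
            by simp
        qed
      qed
    qed (use d in auto)
  qed
  then obtain g g' where g: "\<And>x. x \<in> ?S \<Longrightarrow> (\<lambda>n. a n * of_nat n powr (-x)) sums g x"
    "\<And>x. x \<in> ?S \<Longrightarrow> (\<lambda>n. - (a n * ln (real n)) * of_nat n powr (-x)) sums g' x"
    "\<And>x. x \<in> ?S \<Longrightarrow> (g has_field_derivative g' x) (at x)" by blast
  have gL: "g x = L x" if "x \<in> ?S" for x using g(1)[OF that] L[of x] that sums_unique2 by blast
  have "(L has_field_derivative g' s) (at s)"
    using has_field_derivative_transform_within_open[OF g(3) op] gL s by auto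
  moreover from this have "deriv L s = g' s" by (rule DERIV_imp_deriv)
  ultimately show "(L has_field_derivative deriv L s) (at s)"
    "(\<lambda>n. - (a n * ln (real n)) * of_nat n powr (-s)) sums deriv L s" using g(2)[of s] s by auto
qed

section \<open>Real characters at 1\<close>

lemma sum_divisors_prime_power_mult:
  fixes f :: "nat \<Rightarrow> 'a :: comm_semiring_1"
  assumes p: "prime p" and m: "\<not> p dvd m" and mult: "\<And>x y. f (x * y) = f x * f y"
  shows "(\<Sum>d | d dvd p ^ k * m. f d) = (\<Sum>j\<le>k. f (p ^ j)) * (\<Sum>d | d dvd m. f d)"
proof -
  have m0: "m > 0" using m by (auto intro!: Nat.gr0I)
  have cop: "coprime (p ^ j) d" if "d dvd m" for j d
    using that p m by (meson coprime_power_left_iff dvd_trans prime_imp_coprime)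
  have inj: "inj_on (\<lambda>(j, d). p ^ j * d) ({..k} \<times> {d. d dvd m})"
  proof (rule inj_onI, safe)
    fix j d j' d' assume *: "d dvd m" "d' dvd m" "p ^ j * d = p ^ j' * d'"
    have "multiplicity p (p ^ j * d) = j" if "d dvd m" for j d
    proof -
      have "\<not> p dvd d" "d \<noteq> 0" using that m m0 by (auto intro: dvd_trans)
      thus ?thesis using p by (simp add: prime_elem_multiplicity_mult_distrib not_dvd_imp_multiplicity_0)
    qed
    hence "multiplicity p (p ^ j * d) = j" "multiplicity p (p ^ j' * d') = j'" using * by blast+
    thus "j = j'" using * by simp
    thus "d = d'" using * p by (simp add: prime_gt_0_nat)
  qed
  have img: "(\<lambda>(j, d). p ^ j * d) ` ({..k} \<times> {d. d dvd m}) = {d. d dvd p ^ k * m}"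
  proof safe
    fix d assume "d dvd p ^ k * m"
    then obtain a b where ab: "d = a * b" "a dvd p ^ k" "b dvd m" by (rule division_decomp[THEN exE]) blast
    moreover obtain j where "j \<le> k" "a = p ^ j" using ab(2) p divides_primepow_nat by blast
    ultimately show "d \<in> (\<lambda>(j, d). p ^ j * d) ` ({..k} \<times> {d. d dvd m})" by auto
  qed (auto intro!: mult_dvd_mono le_imp_power_dvd)
  have "(\<Sum>d | d dvd p ^ k * m. f d) = (\<Sum>(j, d)\<in>{..k} \<times> {d. d dvd m}. f (p ^ j) * f d)"
    unfolding img[symmetric] using inj by (subst sum.reindex) (auto simp: mult case_prod_unfold)
  also have "\<dots> = (\<Sum>j\<le>k. f (p ^ j)) * (\<Sum>d | d dvd m. f d)"
    by (simp add: sum_product sum.cartesian_product)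
  finally show ?thesis .
qed

lemma geometric_sign_sum:
  fixes e :: real
  assumes "e \<in> {-1, 0, 1}"
  shows "(\<Sum>j\<le>k. e ^ j) \<ge> 0" "(\<Sum>j\<le>2*k. e ^ j) \<ge> 1"
proof -
  consider "e = -1" | "e = 0" | "e = 1" using assms by auto
  hence "(\<Sum>j\<le>k. e ^ j) \<ge> 0 \<and> (\<Sum>j\<le>2*k. e ^ j) \<ge> 1"
  proof cases
    case 1
    have "(\<Sum>j\<le>k. (-1::real) ^ j) = (if even k then 1 else 0)" for k by (induction k) auto
    thus ?thesis using 1 by auto
  next
    case 2
    have "(\<Sum>j\<le>k. (0::real) ^ j) = 1" for k by (induction k) auto
    thus ?thesis using 2 by auto
  qed auto
  thus "(\<Sum>j\<le>k. e ^ j) \<ge> 0" "(\<Sum>j\<le>2*k. e ^ j) \<ge> 1" by auto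
qed

text \<open>Both sums factor over prime powers into geometric sums with ratio -1, 0 or 1. Powers of
  4 are taken because 4^k = 2^(2k) gives an odd number of terms, so that even the ratio f 2 = -1
  leaves 1.\<close>

lemma real_character_divisor_sum:
  fixes f :: "nat \<Rightarrow> real"
  assumes f: "\<And>n. f n \<in> {-1, 0, 1}" "\<And>x y. f (x * y) = f x * f y" "f 1 = 1"
  shows "n > 0 \<Longrightarrow> (\<Sum>d | d dvd n. f d) \<ge> 0" "(\<Sum>d | d dvd 4 ^ k. f d) \<ge> 1"
proof -
  have pow: "f (p ^ j) = f p ^ j" for p j using f by (induction j) auto
  show "(\<Sum>d | d dvd n. f d) \<ge> 0" if "n > 0"
    using that
  proof (induction n rule: less_induct)
    case (less n)
    show ?case
    proof (cases "n = 1")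
      case False
      then obtain p where p: "prime p" "p dvd n" using prime_factor_nat by blast
      define k where "k = multiplicity p n"
      have "n \<noteq> 0" "\<not> is_unit p" using less.prems p(1) by auto
      then obtain m where m: "n = p ^ k * m" "\<not> p dvd m"
        unfolding k_def by (rule multiplicity_decompose')
      have "k > 0" using p less.prems by (simp add: k_def prime_multiplicity_gt_zero_iff)
      hence "p ^ k > 1" using prime_gt_1_nat[OF p(1)] by (intro one_less_power) auto
      moreover have "m > 0" using m less.prems by (intro Nat.gr0I) auto
      ultimately have "1 * m < p ^ k * m" by (intro mult_strict_right_mono)
      hence "m < n" using m(1) by simp
      have "(\<Sum>d | d dvd n. f d) = (\<Sum>j\<le>k. f p ^ j) * (\<Sum>d | d dvd m. f d)"
        unfolding m(1) using sum_divisors_prime_power_mult[of p m f k] p m(2) f(2) by (simp add: pow)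
      also have "\<dots> \<ge> 0"
        using less.IH[OF \<open>m < n\<close> \<open>m > 0\<close>] geometric_sign_sum(1)[OF f(1)] by (intro mult_nonneg_nonneg)
      finally show ?thesis .
    qed (use f(3) in auto)
  qed
  have "(4::nat) ^ k = 2 ^ (2 * k) * 1" by (simp add: power_mult)
  hence "(\<Sum>d | d dvd 4 ^ k. f d) = (\<Sum>j\<le>2*k. f 2 ^ j) * (\<Sum>d | d dvd (1::nat). f d)"
    using sum_divisors_prime_power_mult[of 2 1 f "2*k"] f(2) by (simp add: pow)
  thus "(\<Sum>d | d dvd 4 ^ k. f d) \<ge> 1" using geometric_sign_sum(2)[OF f(1), of 2 k] f(3) by simp
qed

text \<open>Pair the terms i and n - 1 - i; each pair is at least twice its geometric mean. The base
  is written as a square so that this mean is an integral power of \<open>y\<close>.\<close>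

lemma geometric_sum_AM_GM:
  fixes y :: real
  assumes "y \<ge> 0"
  shows "(\<Sum>i<n. (y\<^sup>2) ^ i) \<ge> real n * y ^ (n - 1)"
proof -
  have "2 * (\<Sum>i<n. (y\<^sup>2) ^ i) = (\<Sum>i<n. (y\<^sup>2) ^ i) + (\<Sum>i<n. (y\<^sup>2) ^ (n - Suc i))"
    using sum.nat_diff_reindex[of "\<lambda>i. (y\<^sup>2) ^ i" n] by simp
  also have "\<dots> = (\<Sum>i<n. (y ^ i)\<^sup>2 + (y ^ (n - Suc i))\<^sup>2)"
    by (simp add: sum.distrib mult.commute flip: power_mult)
  also have "\<dots> \<ge> (\<Sum>i<n. 2 * y ^ (n - 1))"
  proof (rule sum_mono)
    fix i assume "i \<in> {..<n}"
    hence "y ^ (n - 1) = y ^ i * y ^ (n - Suc i)" by (simp flip: power_add)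
    thus "2 * y ^ (n - 1) \<le> (y ^ i)\<^sup>2 + (y ^ (n - Suc i))\<^sup>2"
      using sum_squares_bound[of "y ^ i" "y ^ (n - Suc i)"] by simp
  qed
  finally show ?thesis by simp
qed

text \<open>After Abel summation the decrements of \<open>b\<close> are nonnegative and telescope.
  As \<open>a 0 = 0\<close>, the value of \<open>b\<close> at 0 is free and is set to
  \<open>b 1\<close>.\<close>

lemma abel_bound:
  fixes b :: "nat \<Rightarrow> real" and a :: "nat \<Rightarrow> real"
  assumes A: "\<And>n. \<bar>\<Sum>j\<le>n. a j\<bar> \<le> C" and a0: "a 0 = 0"
    and dec: "\<And>n. n > 0 \<Longrightarrow> b (Suc n) \<le> b n" and nonneg: "\<And>n. n > 0 \<Longrightarrow> b n \<ge> 0"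
  shows "\<bar>\<Sum>k\<le>N. a k * b k\<bar> \<le> C * b 1"
proof -
  define b' where "b' = (\<lambda>n. if n = 0 then b 1 else b n)"
  have dec': "b' (Suc n) \<le> b' n" for n using dec by (auto simp: b'_def)
  have "b' N \<ge> 0" using nonneg by (simp add: b'_def)
  have "(\<Sum>k\<le>N. a k * b k) = (\<Sum>k\<le>N. a k * b' k)"
    using a0 by (intro sum.cong) (auto simp: b'_def)
  also have "\<bar>\<dots>\<bar> \<le> (\<Sum>k<N. C * (b' k - b' (Suc k))) + C * b' N"
    unfolding partial_summation
  proof (rule order_trans[OF abs_triangle_ineq add_mono])
    show "\<bar>\<Sum>k<N. (\<Sum>j\<le>k. a j) * (b' k - b' (Suc k))\<bar> \<le> (\<Sum>k<N. C * (b' k - b' (Suc k)))"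
      using A dec' by (intro order_trans[OF sum_abs] sum_mono) (auto simp: abs_mult intro!: mult_right_mono)
    show "\<bar>(\<Sum>j\<le>N. a j) * b' N\<bar> \<le> C * b' N"
      using A \<open>b' N \<ge> 0\<close> by (auto simp: abs_mult intro!: mult_right_mono)
  qed
  also have "\<dots> = C * b' 0"
    by (induction N) (auto simp: algebra_simps)
  finally show ?thesis by (simp add: b'_def)
qed

text \<open>Monsky's argument: if \<open>\<Sum> f n / n\<close> vanished, then the Lambert series
  \<open>\<Sum> f n x\<^sup>n / (1 - x\<^sup>n)\<close> would stay bounded as \<open>x \<rightarrow> 1\<close>, but its power series coefficients
  \<open>\<Sum>\<^bsub>d | n\<^esub> f d\<close> are nonnegative and at least \<open>1\<close> for \<open>n = 4\<^sup>k\<close>.\<close>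

theorem real_character_sum_nonzero:
  fixes f :: "nat \<Rightarrow> real"
  assumes f: "\<And>n. f n \<in> {-1, 0, 1}" "\<And>x y. f (x * y) = f x * f y" "f 1 = 1" "f 0 = 0"
    and bounded: "\<And>n. \<bar>\<Sum>j\<le>n. f j\<bar> \<le> C"
  shows "\<not> (\<lambda>n. f n / real n) sums 0"
proof
  assume sum0: "(\<lambda>n. f n / real n) sums 0"
  have C: "C \<ge> 0" using bounded[of 0] by linarith
  define c where "c = (\<lambda>n. \<Sum>d | d dvd n. f d)"
  have fb: "\<bar>f n\<bar> \<le> 1" for n using f(1)[of n] by auto
  have key: "(\<Sum>k<K. (y\<^sup>2) ^ (4 ^ k)) \<le> C" if y: "0 < y" "y < 1" for y :: real and K
  proof -
    define x where "x = y\<^sup>2"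
    have x: "0 < x" "x < 1" using y by (auto simp: x_def power_less_one_iff abs_square_less_1)
    have xn: "x ^ n < 1" if "n > 0" for n using x that by (simp add: power_less_one_iff)
    define g where "g = (\<lambda>n. \<Sum>i<n. x ^ i)"
    have geo: "1 - x ^ n = (1 - x) * g n" for n unfolding g_def by (rule one_diff_power_eq)
    have g: "g n > 0" if "n > 0" for n
      using geo[of n] xn[OF that] x by (metis diff_gt_0_iff_gt zero_less_mult_pos)
    \<comment> \<open>Since the sum of f n / n is assumed to be 0, it may be subtracted with factor
      1 / (1 - x) from the Lambert series. The resulting weights are nonnegative and decreasing and
      start at \<open>b 1 = 1\<close> for every x, so Abel summation gives the bound
      \<open>C\<close> uniformly in x.\<close>
    define b where "b = (\<lambda>n. 1 / (real n * (1 - x)) - x ^ n / (1 - x ^ n))"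
    have b_eq: "b n = (1 / (1 - x)) * (1 / real n - x ^ n / g n)" if "n > 0" for n
      unfolding b_def geo by (simp add: right_diff_distrib mult.commute)
    have b_nonneg: "b n \<ge> 0" if "n > 0" for n
    proof -
      have "real n * x ^ n = (\<Sum>i<n. x ^ n)" by simp
      also have "\<dots> \<le> g n" unfolding g_def using x by (intro sum_mono power_decreasing) auto
      finally have "x ^ n / g n \<le> 1 / real n" using g[OF that] that by (simp add: field_simps)
      thus ?thesis unfolding b_eq[OF that] using x by simp
    qed
    have b_dec: "b (Suc n) \<le> b n" if "n > 0" for n
    proof -
      \<comment> \<open>The arithmetic-geometric bound for \<open>g n\<close> and
        \<open>g (Suc n)\<close> yields y^(2n - 1), which is at least y^(2n) = x^n.\<close>
      have "real n * real (Suc n) * x ^ n \<le> (real n * y ^ (n - 1)) * (real (Suc n) * y ^ n)"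
      proof -
        have "x ^ n = y ^ (n + n)" by (simp add: x_def mult_2 flip: power_mult)
        also have "\<dots> \<le> y ^ (n - 1 + n)" using y by (intro power_decreasing) auto
        finally have "x ^ n \<le> y ^ (n - 1) * y ^ n" by (simp add: power_add)
        hence "real n * real (Suc n) * x ^ n \<le> real n * real (Suc n) * (y ^ (n - 1) * y ^ n)"
          by (intro mult_left_mono) auto
        thus ?thesis by (simp only: mult_ac)
      qed
      also have "\<dots> \<le> g n * g (Suc n)"
        using geometric_sum_AM_GM[of y n] geometric_sum_AM_GM[of y "Suc n"] y g[of n] that
        unfolding g_def x_def by (intro mult_mono) auto
      finally have gg: "real n * real (Suc n) * x ^ n \<le> g n * g (Suc n)" .
      have g_Suc: "g (Suc n) = 1 + x * g n"
        unfolding g_def by (simp add: sum.lessThan_Suc_shift sum_distrib_left del: sum.lessThan_Suc)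
      have "x ^ n / g n - x ^ Suc n / g (Suc n) = x ^ n * (g (Suc n) - x * g n) / (g n * g (Suc n))"
        using g[of n] g[of "Suc n"] that by (simp add: field_simps)
      also have "\<dots> = x ^ n / (g n * g (Suc n))" using g_Suc by simp
      also have "\<dots> \<le> 1 / (real n * real (Suc n))"
        using gg g[of n] g[of "Suc n"] that by (simp add: field_simps del: of_nat_Suc)
      also have "\<dots> = 1 / real n - 1 / real (Suc n)"
        using that by (simp add: field_simps)
      finally have "1 / real (Suc n) - x ^ Suc n / g (Suc n) \<le> 1 / real n - x ^ n / g n" by simp
      thus ?thesis
        unfolding b_eq[OF that] b_eq[OF zero_less_Suc] using x by (intro mult_left_mono) auto
    qed
    have b1: "b 1 = 1" using x by (simp add: b_def field_simps)
    have abs_lam: "summable (\<lambda>n. norm (f n * (x ^ n / (1 - x ^ n))))"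
    proof (rule summable_comparison_test')
      show "summable (\<lambda>n. x ^ n / (1 - x))" using x by (intro summable_divide summable_geometric) auto
      fix n :: nat
      show "norm (norm (f n * (x ^ n / (1 - x ^ n)))) \<le> x ^ n / (1 - x)"
      proof (cases "n = 0")
        case False
        hence "x ^ n \<le> x" using x power_decreasing[of 1 n x] by auto
        hence "x ^ n / (1 - x ^ n) \<le> x ^ n / (1 - x)"
          using x xn[of n] False by (intro divide_left_mono mult_pos_pos) auto
        moreover have nn: "x ^ n / (1 - x ^ n) \<ge> 0" using x xn[of n] False by simp
        have "norm (f n * (x ^ n / (1 - x ^ n))) = \<bar>f n\<bar> * (x ^ n / (1 - x ^ n))"
          using abs_of_nonneg[OF nn] by (simp only: real_norm_def abs_mult)
        moreover have "\<bar>f n\<bar> * (x ^ n / (1 - x ^ n)) \<le> 1 * (x ^ n / (1 - x ^ n))"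
          by (intro mult_right_mono fb nn)
        ultimately have "norm (f n * (x ^ n / (1 - x ^ n))) \<le> x ^ n / (1 - x)" by linarith
        thus ?thesis by (simp only: real_norm_def abs_abs)
      qed (use f x in auto)
    qed
    define lam where "lam = (\<Sum>n. f n * (x ^ n / (1 - x ^ n)))"
    have lam: "(\<lambda>n. f n * (x ^ n / (1 - x ^ n))) sums lam"
      unfolding lam_def using summable_norm_cancel[OF abs_lam] by (rule summable_sums)
    have "(\<lambda>n. 1 / (1 - x) * (f n / real n) - f n * (x ^ n / (1 - x ^ n))) sums (1 / (1 - x) * 0 - lam)"
      by (intro sums_diff sums_mult sum0 lam)
    also have "(\<lambda>n. 1 / (1 - x) * (f n / real n) - f n * (x ^ n / (1 - x ^ n))) = (\<lambda>n. f n * b n)"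
      by (auto simp: b_def algebra_simps)
    finally have "(\<lambda>N. \<bar>\<Sum>k\<le>N. f k * b k\<bar>) \<longlonglongrightarrow> \<bar>- lam\<bar>"
      unfolding sums_def_le by (intro tendsto_intros) simp
    hence "\<bar>- lam\<bar> \<le> C * b 1"
      by (rule tendsto_upperbound) (use abel_bound[of f C b] bounded f(4) b_dec b_nonneg in auto)
    hence lam_le: "lam \<le> C" using b1 by simp
    \<comment> \<open>regrouping the double series \<open>\<Sum> f d x\<^bsup>d k\<^esup>\<close> along \<open>n = d k\<close>\<close>
    let ?h = "\<lambda>(d, k). complex_of_real (f d * x ^ (d * k))"
    have h_inner: "((\<lambda>k. complex_of_real (f d * x ^ (d * k))) has_sum complex_of_real (f d * (x ^ d / (1 - x ^ d)))) {0<..}"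
      "((\<lambda>k. norm (complex_of_real (f d * x ^ (d * k)))) has_sum (\<bar>f d\<bar> * (x ^ d / (1 - x ^ d)))) {0<..}"
      if "d > 0" for d
    proof -
      have xd: "0 < x ^ d" "x ^ d < 1" using x xn[OF that] by auto
      have pw: "x ^ (d * Suc a) = (x ^ d) ^ a * x ^ d" for a
        by (simp only: power_mult[symmetric] power_add[symmetric] mult_Suc_right add.commute)
      have "(\<lambda>k. (x ^ d) ^ k * x ^ d) sums (1 / (1 - x ^ d) * x ^ d)"
        using xd by (intro sums_mult2 geometric_sums) auto
      hence "((\<lambda>k. (x ^ d) ^ k * x ^ d) has_sum (1 / (1 - x ^ d) * x ^ d)) UNIV"
        using xd by (intro norm_summable_imp_has_sum) (auto simp: sums_iff)
      also have "?this \<longleftrightarrow> ((\<lambda>k. x ^ (d * k)) has_sum (1 / (1 - x ^ d) * x ^ d)) {0<..}"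
        by (rule has_sum_reindex_bij_witness[where i = "\<lambda>k. k - 1" and j = Suc])
           (use pw in auto)
      finally have hs: "((\<lambda>k. x ^ (d * k)) has_sum (x ^ d / (1 - x ^ d))) {0<..}" by simp
      show "((\<lambda>k. complex_of_real (f d * x ^ (d * k))) has_sum complex_of_real (f d * (x ^ d / (1 - x ^ d)))) {0<..}"
        using has_sum_cmult_right[OF hs, of "f d"] by (rule has_sum_of_real)
      show "((\<lambda>k. norm (complex_of_real (f d * x ^ (d * k)))) has_sum (\<bar>f d\<bar> * (x ^ d / (1 - x ^ d)))) {0<..}"
      proof -
        have "norm (complex_of_real (f d * x ^ (d * k))) = \<bar>f d\<bar> * x ^ (d * k)" for k
          using x by (simp only: norm_of_real abs_mult) simp
        thus ?thesis using has_sum_cmult_right[OF hs, of "\<bar>f d\<bar>"] by simp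
      qed
    qed
    have lam_UNIV: "((\<lambda>d. f d * (x ^ d / (1 - x ^ d))) has_sum lam) UNIV"
      using abs_lam lam by (rule norm_summable_imp_has_sum)
    hence lam_pos: "((\<lambda>d. f d * (x ^ d / (1 - x ^ d))) has_sum lam) {0<..}"
      by (rule has_sum_cong_neutral[THEN iffD1, rotated -1]) (use f(4) in auto)
    have "(?h has_sum complex_of_real lam) ({0<..} \<times> {0<..})"
    proof (rule has_sum_SigmaI)
      show "((\<lambda>y. ?h (d, y)) has_sum complex_of_real (f d * (x ^ d / (1 - x ^ d)))) {0<..}"
        if "d \<in> {0<..}" for d using h_inner(1)[of d] that by simp
      show "((\<lambda>d. complex_of_real (f d * (x ^ d / (1 - x ^ d)))) has_sum complex_of_real lam) {0<..}"
        using lam_pos by (rule has_sum_of_real)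
      have "(\<lambda>p. norm (?h p)) summable_on ({0<..} \<times> {0<..})"
        unfolding Infinite_Sum.abs_summable_on_Sigma_iff
      proof
        show "\<forall>d\<in>{0<..}. (\<lambda>k. norm (?h (d, k))) summable_on {0<..}"
          using h_inner(2) by (auto simp: summable_on_def)
        have "(\<lambda>d. norm (f d * (x ^ d / (1 - x ^ d)))) summable_on {0<..}"
          using norm_summable_imp_summable_on[of "\<lambda>d. norm (f d * (x ^ d / (1 - x ^ d)))"] abs_lam
          by (auto intro: summable_on_subset_banach)
        also have "?this \<longleftrightarrow> (\<lambda>d. norm (\<Sum>\<^sub>\<infinity>k\<in>{0<..}. norm (?h (d, k)))) summable_on {0<..}"
        proof (rule summable_on_cong)
          fix d :: nat assume d: "d \<in> {0<..}"
          hence "(\<Sum>\<^sub>\<infinity>k\<in>{0<..}. norm (?h (d, k))) = \<bar>f d\<bar> * (x ^ d / (1 - x ^ d))"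
            using infsumI[OF h_inner(2)[of d]] by simp
          moreover have "0 < x ^ d" "x ^ d < 1" using x xn[of d] d by auto
          ultimately show "norm (f d * (x ^ d / (1 - x ^ d))) = norm (\<Sum>\<^sub>\<infinity>k\<in>{0<..}. norm (?h (d, k)))"
            by (simp add: abs_mult)
        qed
        finally show "(\<lambda>d. norm (\<Sum>\<^sub>\<infinity>k\<in>{0<..}. norm (?h (d, k)))) summable_on {0<..}" .
      qed
      thus "?h summable_on ({0<..} \<times> {0<..})"
        by (rule Infinite_Sum.abs_summable_summable)
    qed
    hence "((\<lambda>n. \<Sum>d | d dvd n. ?h (d, n div d)) has_sum complex_of_real lam) {0<..}"
      by (rule has_sum_divisors)
    also have "?this \<longleftrightarrow> ((\<lambda>n. complex_of_real (c n * x ^ n)) has_sum complex_of_real lam) {0<..}"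
      by (rule has_sum_cong) (auto simp: c_def sum_distrib_right intro!: sum.cong)
    finally have "((\<lambda>n. c n * x ^ n) has_sum lam) {0<..}"
      by (simp only: has_sum_of_real_iff)
    hence "sum (\<lambda>n. c n * x ^ n) ((\<lambda>k. 4 ^ k) ` {..<K}) \<le> lam"
      using real_character_divisor_sum(1)[OF f(1-3)] x
      by (intro has_sum_mono_neutral[OF has_sum_finite]) (auto simp: c_def)
    also have "sum (\<lambda>n. c n * x ^ n) ((\<lambda>k. 4 ^ k) ` {..<K}) = (\<Sum>k<K. c (4 ^ k) * x ^ (4 ^ k))"
      by (subst sum.reindex) (auto simp: inj_on_def)
    also have "\<dots> \<ge> (\<Sum>k<K. 1 * x ^ (4 ^ k))"
      using real_character_divisor_sum(2)[OF f(1-3)] x unfolding c_def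
      by (intro sum_mono mult_right_mono) auto
    finally show ?thesis using lam_le by (simp add: x_def)
  qed
  \<comment> \<open>More than \<open>C\<close> of the powers with exponents 4^k, each tending to 1
    as y tends to 1 from the left.\<close>
  define K where "K = Suc (nat \<lceil>C\<rceil>)"
  have "((\<lambda>y::real. \<Sum>k<K. (y\<^sup>2) ^ (4 ^ k)) \<longlongrightarrow> (\<Sum>k<K. (1\<^sup>2) ^ (4 ^ k))) (at_left 1)"
    by (intro tendsto_intros)
  moreover have "eventually (\<lambda>y::real. (\<Sum>k<K. (y\<^sup>2) ^ (4 ^ k)) \<le> C) (at_left 1)"
    using eventually_at_left_real[OF zero_less_one] by eventually_elim (use key in auto)
  ultimately have "(\<Sum>k<K. (1\<^sup>2) ^ (4 ^ k)) \<le> C"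
    by (rule tendsto_upperbound) auto
  thus False unfolding K_def using C by simp linarith
qed

section \<open>Non-vanishing on the line \<open>Re s = 1\<close>\<close>

text \<open>If f = (s - z0)^n g with g z0 \<noteq> 0, then f' / f = n / (s - z0) + g' / g. The point
  \<open>w\<close> guarantees that f is not identically zero on the connected domain.\<close>

lemma log_deriv_order:
  assumes f: "f holomorphic_on S" "open S" "connected S" "z0 \<in> S" "w \<in> S" "f w \<noteq> 0"
  obtains k :: nat where "((\<lambda>s. (s - z0) * (deriv f s / f s)) \<longlongrightarrow> of_nat k) (at z0)"
    "f z0 = 0 \<longleftrightarrow> k > 0" "eventually (\<lambda>s. f s \<noteq> 0) (at z0)"
proof (cases "f z0 = 0")
  case False
  have cont: "isCont f z0" "isCont (deriv f) z0"
    using f holomorphic_on_imp_continuous_on[OF f(1)] holomorphic_on_imp_continuous_on[OF holomorphic_deriv[OF f(1,2)]]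
    by (auto simp: continuous_on_eq_continuous_at)
  have "((\<lambda>s. (s - z0) * (deriv f s / f s)) \<longlongrightarrow> (z0 - z0) * (deriv f z0 / f z0)) (at z0)"
    using cont False by (intro tendsto_intros) (auto simp: isCont_def)
  moreover have "eventually (\<lambda>s. f s \<noteq> 0) (at z0)"
    using cont(1) False by (auto simp: isCont_def intro: tendsto_imp_eventually_ne)
  ultimately show ?thesis using False by (intro that[of 0]) auto
next
  case True
  have "\<not> f constant_on S" using True f(4-6) by (metis constant_on_def)
  from holomorphic_factor_zero_nonconstant[OF f(1-4) True this]
  obtain g r n where n: "0 < n" and r: "0 < r" "ball z0 r \<subseteq> S" and g: "g holomorphic_on ball z0 r"
    and fg: "\<And>w. w \<in> ball z0 r \<Longrightarrow> f w = (w - z0) ^ n * g w" "\<And>w. w \<in> ball z0 r \<Longrightarrow> g w \<noteq> 0" by metis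
  have ev: "eventually (\<lambda>s. s \<in> ball z0 r - {z0}) (at z0)"
    using r(1) by (auto simp: eventually_at intro!: exI[of _ r] simp: dist_commute)
  have cont: "isCont g z0" "isCont (deriv g) z0"
    using r(1) holomorphic_on_imp_continuous_on[OF g] holomorphic_on_imp_continuous_on[OF holomorphic_deriv[OF g open_ball]]
    by (auto simp: continuous_on_eq_continuous_at)
  have "((\<lambda>s. of_nat n + (s - z0) * (deriv g s / g s)) \<longlongrightarrow> of_nat n + (z0 - z0) * (deriv g z0 / g z0)) (at z0)"
    using cont fg(2)[of z0] r(1) by (intro tendsto_intros) (auto simp: isCont_def)
  moreover have "eventually (\<lambda>s. of_nat n + (s - z0) * (deriv g s / g s) = (s - z0) * (deriv f s / f s)) (at z0)"
    using ev
  proof eventually_elim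
    case (elim s)
    have gs: "(g has_field_derivative deriv g s) (at s)"
      using elim g by (intro holomorphic_derivI[OF _ open_ball]) auto
    have "((\<lambda>w. (w - z0) ^ n * g w) has_field_derivative
        (of_nat n * (s - z0) ^ (n - 1) * g s + (s - z0) ^ n * deriv g s)) (at s)"
      by (auto intro!: derivative_eq_intros gs)
    hence "(f has_field_derivative (of_nat n * (s - z0) ^ (n - 1) * g s + (s - z0) ^ n * deriv g s)) (at s)"
      by (rule has_field_derivative_transform_within_open[OF _ open_ball]) (use elim fg(1) in auto)
    hence df: "deriv f s = of_nat n * (s - z0) ^ (n - 1) * g s + (s - z0) ^ n * deriv g s"
      by (rule DERIV_imp_deriv)
    define u P where "u = s - z0" and "P = (s - z0) ^ (n - 1)"
    have "(s - z0) ^ n = u * P" using n by (simp add: u_def P_def flip: power_Suc)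
    moreover have "f s = (s - z0) ^ n * g s" "g s \<noteq> 0" "u \<noteq> 0" "P \<noteq> 0" using elim fg by (auto simp: u_def P_def)
    ultimately have "of_nat n + u * (deriv g s / g s) = u * (deriv f s / f s)"
      unfolding df P_def[symmetric] by (simp add: field_simps)
    thus ?case by (simp add: u_def)
  qed
  ultimately have "((\<lambda>s. (s - z0) * (deriv f s / f s)) \<longlongrightarrow> of_nat n) (at z0)"
    by (auto elim: Lim_transform_eventually)
  moreover have "eventually (\<lambda>s. f s \<noteq> 0) (at z0)"
    using ev by eventually_elim (use fg in auto)
  ultimately show ?thesis using True n by (intro that[of n]) auto
qed

lemma periodic_partial_sums:
  fixes f :: "nat \<Rightarrow> complex"
  assumes per: "\<And>n. f (n mod M) = f n" and norm: "\<And>n. norm (f n) \<le> 1" and M: "M > 0"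
  shows "norm ((\<Sum>j<N. f j) - of_nat (N div M) * (\<Sum>j<M. f j)) \<le> real M"
proof -
  have block: "(\<Sum>j<M * q. f j) = of_nat q * (\<Sum>j<M. f j)" for q
  proof (induction q)
    case (Suc q)
    have "(\<Sum>j<M * Suc q. f j) = (\<Sum>j<M * q. f j) + (\<Sum>j=M * q..<M * q + M. f j)"
      by (simp add: lessThan_atLeast0 sum.atLeastLessThan_concat add.commute)
    also have "(\<Sum>j=M * q..<M * q + M. f j) = (\<Sum>j<M. f (M * q + j))"
      by (subst sum.atLeastLessThan_shift_0) (simp add: lessThan_atLeast0)
    also have "(\<Sum>j<M. f (M * q + j)) = (\<Sum>j<M. f j)"
      using per[of "M * q + _"] per by (intro sum.cong refl) (metis mod_mult_self4)
    finally show ?case using Suc by (simp add: algebra_simps)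
  qed simp
  have "M * (N div M) \<le> N" by simp
  hence "(\<Sum>j<N. f j) = (\<Sum>j<M * (N div M). f j) + (\<Sum>j=M * (N div M)..<N. f j)"
    by (simp add: sum.atLeastLessThan_concat lessThan_atLeast0)
  hence "norm ((\<Sum>j<N. f j) - of_nat (N div M) * (\<Sum>j<M. f j)) = norm (\<Sum>j=M * (N div M)..<N. f j)"
    by (simp add: block)
  also have "\<dots> \<le> (\<Sum>j=M * (N div M)..<N. 1)" by (intro sum_norm_le norm)
  also have "\<dots> = real (N mod M)" by (simp add: minus_mult_div_eq_mod flip: of_nat_diff)
  also have "\<dots> \<le> real M" using M by (simp add: less_imp_le)
  finally show ?thesis .
qed

section \<open>Continuation of L(s, \<xi>) to Re s > 0\<close>

text \<open>\<open>Q\<close> is holomorphic on \<open>Re s > 0\<close> and agrees there with \<open>L(s, \<xi>)\<close>, except that for the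
  principal character the pole at \<open>1\<close> is removed by the factor \<open>s - 1\<close>.\<close>

definition L_numerator :: "nat \<Rightarrow> (nat \<Rightarrow> complex) \<Rightarrow> (complex \<Rightarrow> complex) \<Rightarrow> bool" where
  "L_numerator M \<xi> Q \<longleftrightarrow> Q holomorphic_on {s. Re s > 0} \<and>
     (\<forall>s. Re s > 1 \<longrightarrow> (\<lambda>n. \<xi> n * of_nat n powr (-s)) sums (if \<xi> = principal_character M then Q s / (s - 1) else Q s)) \<and>
     (\<xi> = principal_character M \<longrightarrow> Q 1 \<noteq> 0) \<and>
     (\<xi> \<noteq> principal_character M \<longrightarrow> (\<forall>s. Re s > 0 \<longrightarrow> (\<lambda>n. \<xi> n * of_nat n powr (-s)) sums Q s))"

context
  fixes M :: nat and \<xi> :: "nat \<Rightarrow> complex"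
  assumes M: "M > 1" and \<xi>: "dirichlet_character M \<xi>"
begin

lemma character_zero: "\<xi> 0 = 0"
  using dirichlet_characterD(3)[OF \<xi>, of 0] M by simp

lemma character_norm_le: "norm (\<xi> n) \<le> 1"
  using dirichlet_character_norm[OF \<xi>, of n] M by auto

lemma character_mod: "\<xi> (n mod M) = \<xi> n"
  by (rule dirichlet_characterD(1)[OF \<xi>]) auto

lemma L_numerator_exists: "\<exists>Q. L_numerator M \<xi> Q"
proof -
  \<comment> \<open>The mean of \<xi> over a period, which is 0 unless \<xi> is principal.
    Subtracting it leaves bounded partial sums, hence a series holomorphic for Re s > 0; \<delta>
    times zeta then supplies the pole, and \<open>Q 1\<close> becomes \<delta>.\<close>
  define \<delta> where "\<delta> = (\<Sum>j<M. \<xi> j) / of_nat M"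
  define a where "a = (\<lambda>n. \<xi> n - (if n = 0 then 0 else \<delta>))"
  have part: "norm (\<Sum>j\<le>n. a j) \<le> real M + 2 * norm \<delta> * real M" for n
  proof -
    have "(\<Sum>j\<le>n. if j = 0 then 0 else \<delta>) = of_nat n * \<delta>" by (induction n) (auto simp: algebra_simps)
    hence "(\<Sum>j\<le>n. a j) = (\<Sum>j<Suc n. \<xi> j) - of_nat n * \<delta>"
      by (simp add: a_def sum_subtractf lessThan_Suc_atMost)
    also have "\<dots> = ((\<Sum>j<Suc n. \<xi> j) - of_nat (Suc n div M) * (\<Sum>j<M. \<xi> j)) + (of_nat (Suc n div M) * of_nat M - of_nat n) * \<delta>"
      using M by (simp add: \<delta>_def field_simps)
    also have "norm \<dots> \<le> real M + norm ((of_nat (Suc n div M) * of_nat M - of_nat n) * \<delta>)"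
      using M by (intro norm_triangle_le add_right_mono periodic_partial_sums character_mod character_norm_le) auto
    also have "norm ((of_nat (Suc n div M) * of_nat M - of_nat n) * \<delta>) \<le> 2 * real M * norm \<delta>"
    proof -
      have "(of_nat (Suc n div M) * of_nat M - of_nat n :: complex) = of_real (1 - real (Suc n mod M))"
      proof -
        have "Suc n div M * M + Suc n mod M = Suc n" by simp
        hence "complex_of_nat (Suc n div M) * of_nat M + of_nat (Suc n mod M) = of_nat n + 1"
          by (metis of_nat_Suc of_nat_add of_nat_mult add.commute)
        thus ?thesis by (simp add: algebra_simps)
      qed
      moreover have "\<bar>1 - real (Suc n mod M)\<bar> \<le> 2 * real M"
        using mod_less_divisor[of M "Suc n"] M by linarith
      ultimately show ?thesis by (simp only: norm_mult norm_of_real) (intro mult_right_mono, auto)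
    qed
    finally show ?thesis by (simp add: mult_ac)
  qed
  have a0: "a 0 = 0" using character_zero by (simp add: a_def)
  from dirichlet_series_bounded_partial_sums[OF a0 part]
  obtain F where F: "F holomorphic_on {s. Re s > 0}" "\<And>s. Re s > 0 \<Longrightarrow> (\<lambda>n. a n * of_nat n powr (-s)) sums F s"
    by metis
  show ?thesis
  proof (cases "\<xi> = principal_character M")
    case False
    hence "\<delta> = 0" using sum_dirichlet_character[OF \<xi>] M by (simp add: \<delta>_def)
    hence "a = \<xi>" by (auto simp: a_def)
    thus ?thesis using F False by (intro exI[of _ F]) (auto simp: L_numerator_def)
  next
    case True
    have \<delta>0: "\<delta> \<noteq> 0" using sum_principal_character[OF M] M True by (simp add: \<delta>_def)
    obtain Z where Z: "Z holomorphic_on {s. Re s > 0}" "Z 1 = 1"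
      "\<And>s. Re s > 1 \<Longrightarrow> (\<lambda>n. of_nat n powr (-s)) sums (Z s / (s - 1))"
      using zeta_continuation by metis
    have "(\<lambda>n. \<xi> n * of_nat n powr (-s)) sums (((s - 1) * F s + \<delta> * Z s) / (s - 1))" if s: "Re s > 1" for s
    proof -
      from s have "(\<lambda>n. a n * of_nat n powr (-s) + \<delta> * of_nat n powr (-s)) sums (F s + \<delta> * (Z s / (s - 1)))"
        by (intro sums_add sums_mult F Z) auto
      also have "(\<lambda>n. a n * of_nat n powr (-s) + \<delta> * of_nat n powr (-s)) = (\<lambda>n. \<xi> n * of_nat n powr (-s))"
        by (auto simp: a_def fun_eq_iff algebra_simps)
      also have "F s + \<delta> * (Z s / (s - 1)) = ((s - 1) * F s + \<delta> * Z s) / (s - 1)"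
        using s by (cases "s = 1") (auto simp: field_simps)
      finally show ?thesis .
    qed
    moreover have "(\<lambda>s. (s - 1) * F s + \<delta> * Z s) holomorphic_on {s. Re s > 0}"
      by (intro holomorphic_intros F Z)
    ultimately show ?thesis
      using True Z(2) \<delta>0 by (intro exI[of _ "\<lambda>s. (s - 1) * F s + \<delta> * Z s"]) (simp add: L_numerator_def)
  qed
qed

end

section \<open>The series for -L'/L and its residues\<close>

definition log_deriv_series :: "(nat \<Rightarrow> complex) \<Rightarrow> complex \<Rightarrow> complex" where
  "log_deriv_series \<xi> s = (\<Sum>n. \<xi> n * mangoldt n * of_nat n powr (-s))"

context
  fixes M :: nat and \<xi> :: "nat \<Rightarrow> complex"
  assumes M: "M > 1" and \<xi>: "dirichlet_character M \<xi>"
begin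

lemma character_mangoldt_norm: "norm (\<xi> n * mangoldt n) \<le> ln (real n)"
proof (cases "n = 0")
  case False
  have "norm (\<xi> n * mangoldt n) \<le> 1 * mangoldt n"
    using character_norm_le[OF M \<xi>, of n] mangoldt_nonneg[of n] by (simp only: norm_mult norm_mangoldt) (intro mult_right_mono)
  also have "\<dots> \<le> ln (real n)" using mangoldt_le[of n] False by simp
  finally show ?thesis .
qed auto

lemma log_deriv_abs_summable:
  "Re s > 1 \<Longrightarrow> summable (\<lambda>n. norm (\<xi> n * mangoldt n * of_nat n powr (-s)))"
  by (rule dirichlet_series_abs_summable) (auto intro!: order_trans[OF character_mangoldt_norm])

lemma log_deriv_sums:
  "Re s > 1 \<Longrightarrow> (\<lambda>n. \<xi> n * mangoldt n * of_nat n powr (-s)) sums log_deriv_series \<xi> s"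
  unfolding log_deriv_series_def
  by (rule summable_sums[OF summable_norm_cancel[OF log_deriv_abs_summable]])

lemma log_deriv_bounded:
  assumes "\<sigma> > 1"
  obtains K where "K > 0" "\<And>s. Re s \<ge> \<sigma> \<Longrightarrow> norm (log_deriv_series \<xi> s) \<le> K"
proof -
  define K where "K = (\<Sum>n. ln (real n) * real n powr (-\<sigma>))"
  have K: "(\<lambda>n. ln (real n) * real n powr (-\<sigma>)) sums K"
    unfolding K_def by (rule summable_sums[OF summable_ln_powr[OF assms]])
  have "norm (log_deriv_series \<xi> s) \<le> K" if s: "Re s \<ge> \<sigma>" for s
  proof -
    have "norm (log_deriv_series \<xi> s) \<le> (\<Sum>n. norm (\<xi> n * mangoldt n * of_nat n powr (-s)))"
      unfolding log_deriv_series_def using s assms by (intro summable_norm log_deriv_abs_summable) auto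
    also have "\<dots> \<le> K"
      unfolding K_def
    proof (rule suminf_le)
      fix n :: nat
      show "norm (\<xi> n * mangoldt n * of_nat n powr (-s)) \<le> ln (real n) * real n powr (-\<sigma>)"
      proof (cases "n = 0")
        case False
        have "real n powr (- Re s) \<le> real n powr (-\<sigma>)" using s False by (intro powr_mono) auto
        thus ?thesis using character_mangoldt_norm[of n] False
          by (subst norm_mult) (auto simp: norm_nat_powr intro!: mult_mono)
      qed auto
    qed (use s assms log_deriv_abs_summable sums_summable[OF K] in auto)
    finally show ?thesis .
  qed
  thus ?thesis by (intro that[of "\<bar>K\<bar> + 1"]) force+
qed

text \<open>Multiplicativity pulls \<xi> n out of the convolution, where the sum of
  \<open>mangoldt\<close> over the divisors of n is ln n. The identity is kept in product form
  because L has not yet been shown to be nonzero.\<close>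

lemma log_deriv_eq:
  assumes L: "\<And>s. Re s > 1 \<Longrightarrow> (\<lambda>n. \<xi> n * of_nat n powr (-s)) sums L s" and s: "Re s > 1"
  shows "log_deriv_series \<xi> s * L s = - deriv L s"
proof -
  have "(\<lambda>n. (\<Sum>d | d dvd n. (\<xi> d * mangoldt d) * \<xi> (n div d)) * of_nat n powr (-s)) sums (log_deriv_series \<xi> s * L s)"
  proof (rule dirichlet_series_product)
    show "summable (\<lambda>n. norm (\<xi> n * of_nat n powr (-s)))"
    proof (rule dirichlet_series_abs_summable)
      show "norm (\<xi> n) \<le> 1 + ln (real n)" for n
        using character_norm_le[OF M \<xi>, of n] character_zero[OF M \<xi>] by (cases "n = 0") (auto intro: order_trans)
    qed (rule s)
  qed (use L s log_deriv_abs_summable log_deriv_sums in auto)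
  also have "(\<lambda>n. (\<Sum>d | d dvd n. (\<xi> d * mangoldt d) * \<xi> (n div d)) * of_nat n powr (-s)) =
      (\<lambda>n. \<xi> n * ln (real n) * of_nat n powr (-s))"
  proof
    fix n :: nat
    show "(\<Sum>d | d dvd n. (\<xi> d * mangoldt d) * \<xi> (n div d)) * of_nat n powr (-s) =
        \<xi> n * ln (real n) * of_nat n powr (-s)"
    proof (cases "n = 0")
      case False
      have "(\<Sum>d | d dvd n. (\<xi> d * mangoldt d) * \<xi> (n div d)) = (\<Sum>d | d dvd n. \<xi> n * mangoldt d)"
      proof (intro sum.cong refl)
        fix d assume "d \<in> {d. d dvd n}"
        hence "\<xi> n = \<xi> d * \<xi> (n div d)" by (simp flip: dirichlet_characterD(2)[OF \<xi>])
        thus "\<xi> d * mangoldt d * \<xi> (n div d) = \<xi> n * mangoldt d" by simp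
      qed
      also have "\<dots> = \<xi> n * of_real (ln (real n))"
        using mangoldt_sum[of n, where 'a = complex] False by (simp flip: sum_distrib_left)
      finally show ?thesis by simp
    qed auto
  qed
  finally have "(\<lambda>n. \<xi> n * ln (real n) * of_nat n powr (-s)) sums (log_deriv_series \<xi> s * L s)" .
  moreover have "(\<lambda>n. - (\<xi> n * ln (real n)) * of_nat n powr (-s)) sums deriv L s"
    using dirichlet_series_deriv(2)[OF character_norm_le[OF M \<xi>] L s] .
  hence "(\<lambda>n. - (- (\<xi> n * ln (real n)) * of_nat n powr (-s))) sums - deriv L s" by (rule sums_minus)
  hence "(\<lambda>n. \<xi> n * ln (real n) * of_nat n powr (-s)) sums - deriv L s" by simp
  ultimately show ?thesis by (rule sums_unique2)
qed

end

context
  fixes M :: nat and \<xi> Q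
  assumes M: "M > 1" and \<xi>: "dirichlet_character M \<xi>"
    and Q: "L_numerator M \<xi> Q"
begin

lemma Q_hol: "Q holomorphic_on {s. Re s > 0}"
  and Q_sums: "Re s > 1 \<Longrightarrow> (\<lambda>n. \<xi> n * of_nat n powr (-s)) sums
    (if \<xi> = principal_character M then Q s / (s - 1) else Q s)"
  and Q_1: "\<xi> = principal_character M \<Longrightarrow> Q 1 \<noteq> 0"
  and Q_sums': "\<lbrakk>\<xi> \<noteq> principal_character M; Re s > 0\<rbrakk> \<Longrightarrow> (\<lambda>n. \<xi> n * of_nat n powr (-s)) sums Q s"
  using Q unfolding L_numerator_def by blast+

lemma log_deriv_Q:
  assumes s: "Re s > 1" "Q s \<noteq> 0"
  shows "log_deriv_series \<xi> s = - (deriv Q s / Q s) + (if \<xi> = principal_character M then 1 / (s - 1) else 0)"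
proof -
  define L where "L = (\<lambda>s. if \<xi> = principal_character M then Q s / (s - 1) else Q s)"
  have s1: "s \<noteq> 1" using s by auto
  have eq: "log_deriv_series \<xi> s * L s = - deriv L s"
    using log_deriv_eq[OF M \<xi> _ s(1), of L] Q_sums unfolding L_def by blast
  have Qd: "(Q has_field_derivative deriv Q s) (at s)"
    using s by (intro holomorphic_derivI[OF Q_hol open_halfspace_Re_gt]) auto
  show ?thesis
  proof (cases "\<xi> = principal_character M")
    case True
    have "((\<lambda>s. Q s / (s - 1)) has_field_derivative (deriv Q s * (s - 1) - Q s) / (s - 1)\<^sup>2) (at s)"
      using s1 by (auto intro!: derivative_eq_intros Qd simp: power2_eq_square)
    hence "deriv L s = (deriv Q s * (s - 1) - Q s) / (s - 1)\<^sup>2"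
      using True by (intro DERIV_imp_deriv) (simp add: L_def)
    with eq True have "log_deriv_series \<xi> s * (Q s / (s - 1)) = - ((deriv Q s * (s - 1) - Q s) / (s - 1)\<^sup>2)"
      by (simp add: L_def)
    hence "log_deriv_series \<xi> s = - ((deriv Q s * (s - 1) - Q s) / (s - 1)\<^sup>2) / (Q s / (s - 1))"
      by (rule eq_divide_imp[rotated]) (use s1 s(2) in simp)
    also have "\<dots> = - (deriv Q s / Q s) + 1 / (s - 1)"
    proof -
      have "s - 1 \<noteq> 0" using s1 by simp
      thus ?thesis using s(2) by (simp add: power2_eq_square divide_simps)
    qed
    finally show ?thesis using True by simp
  next
    case False
    thus ?thesis using eq s(2) by (simp add: L_def field_simps)
  qed
qed

text \<open>The terms from n = 2 on add up to at most \<pi>^2 / 6 - 1 < 1 in modulus and cannot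
  cancel the first term 1. This provides the point at which \<open>Q\<close> is not zero, as
  \<open>log_deriv_order\<close> demands.\<close>

lemma Q_2: "Q 2 \<noteq> 0"
proof
  assume "Q 2 = 0"
  hence "(\<lambda>n. \<xi> n * of_nat n powr (-2)) sums 0" using Q_sums[of 2] by (auto split: if_splits)
  from sums_split_initial_segment[OF this, of 2]
  have "(\<lambda>n. \<xi> (n + 2) * of_nat (n + 2) powr (-2)) sums (-1)"
    using character_zero[OF M \<xi>] dirichlet_characterD(4)[OF \<xi>] by (simp add: numeral_2_eq_2)
  hence "1 = norm (\<Sum>n. \<xi> (n + 2) * of_nat (n + 2) powr (-2))" by (simp add: sums_iff)
  have sq: "(\<lambda>n. 1 / (real n + 2)\<^sup>2) sums (pi\<^sup>2 / 6 - 1)"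
    using sums_split_initial_segment[OF inverse_squares_sums, of 1] by (simp add: add_ac)
  have le: "norm (\<xi> (n + 2) * of_nat (n + 2) powr (-2)) \<le> 1 / (real n + 2)\<^sup>2" for n
  proof -
    have "norm (complex_of_nat (n + 2) powr (-2)) = real (n + 2) powr (-2)"
      by (subst norm_nat_powr) auto
    also have "\<dots> = 1 / (real n + 2)\<^sup>2" by (simp add: powr_minus powr_numeral field_simps)
    finally have eq: "norm (complex_of_nat (n + 2) powr (-2)) = 1 / (real n + 2)\<^sup>2" .
    have "norm (\<xi> (n + 2)) * (1 / (real n + 2)\<^sup>2) \<le> 1 * (1 / (real n + 2)\<^sup>2)"
      by (intro mult_right_mono character_norm_le[OF M \<xi>]) auto
    thus ?thesis by (simp only: norm_mult eq mult_1)
  qed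
  have "norm (\<Sum>n. \<xi> (n + 2) * of_nat (n + 2) powr (-2)) \<le> (\<Sum>n. 1 / (real n + 2)\<^sup>2)"
    using le sq by (intro norm_suminf_le) (auto simp: sums_iff)
  also have "\<dots> = pi\<^sup>2 / 6 - 1" using sq by (simp add: sums_iff)
  also have "pi\<^sup>2 < 3.2\<^sup>2" using pi_approx(2) pi_gt_zero by (intro power_strict_mono) auto
  hence "pi\<^sup>2 / 6 - 1 < 1" by (simp add: power2_eq_square)
  finally show False using \<open>1 = _\<close> by simp
qed

text \<open>\<open>m\<close> is the residue of -L'/L at \<open>z0\<close>: minus the order of the
  zero of \<open>Q\<close>, plus 1 where the factor s - 1 conceals the pole. The limit is taken
  within Re s > 1, the region in which the series is identified with -L'/L.\<close>

lemma log_deriv_residue: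
  assumes z0: "Re z0 \<ge> 1"
  shows "\<exists>m :: int. ((\<lambda>s. (s - z0) * log_deriv_series \<xi> s) \<longlongrightarrow> of_int m) (at z0 within {s. Re s > 1}) \<and>
    m \<le> (if \<xi> = principal_character M \<and> z0 = 1 then 1 else 0) \<and> (Q z0 = 0 \<longrightarrow> m < 0) \<and>
    (\<xi> = principal_character M \<and> z0 = 1 \<longrightarrow> m = 1)"
proof -
  let ?pr = "\<xi> = principal_character M"
  obtain k :: nat where k: "((\<lambda>s. (s - z0) * (deriv Q s / Q s)) \<longlongrightarrow> of_nat k) (at z0)"
    "Q z0 = 0 \<longleftrightarrow> k > 0" and ev: "eventually (\<lambda>s. Q s \<noteq> 0) (at z0)"
    using log_deriv_order[OF Q_hol open_halfspace_Re_gt convex_connected[OF convex_halfspace_Re_gt], of z0 2] z0 Q_2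
    by auto
  define e :: int where "e = (if ?pr \<and> z0 = 1 then 1 else 0)"
  have e_lim: "((\<lambda>s. (s - z0) * (if ?pr then 1 / (s - 1) else 0)) \<longlongrightarrow> of_int e) (at z0)"
  proof (cases "?pr \<and> z0 = 1")
    case True
    have "eventually (\<lambda>s. 1 = (s - z0) * (if ?pr then 1 / (s - 1) else 0)) (at z0)"
      using eventually_neq_at_within[of z0] by eventually_elim (use True in auto)
    from Lim_transform_eventually[OF tendsto_const this] show ?thesis
      using True by (simp add: e_def)
  next
    case False
    have "((\<lambda>s. (s - z0) * (if ?pr then 1 / (s - 1) else 0)) \<longlongrightarrow> (z0 - z0) * (if ?pr then 1 / (z0 - 1) else 0)) (at z0)"
      using False by (cases ?pr) (auto intro!: tendsto_eq_intros)
    thus ?thesis using False by (auto simp: e_def)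
  qed
  have "((\<lambda>s. - ((s - z0) * (deriv Q s / Q s)) + (s - z0) * (if ?pr then 1 / (s - 1) else 0)) \<longlongrightarrow> - of_nat k + of_int e) (at z0)"
    by (intro tendsto_intros k e_lim)
  moreover have "- of_nat k + of_int e = (of_int (e - int k) :: complex)" by simp
  ultimately have "((\<lambda>s. - ((s - z0) * (deriv Q s / Q s)) + (s - z0) * (if ?pr then 1 / (s - 1) else 0)) \<longlongrightarrow> of_int (e - int k)) (at z0)"
    by (simp only:)
  hence "((\<lambda>s. - ((s - z0) * (deriv Q s / Q s)) + (s - z0) * (if ?pr then 1 / (s - 1) else 0)) \<longlongrightarrow> of_int (e - int k)) (at z0 within {s. Re s > 1})"
    by (rule tendsto_within_subset) auto
  moreover have "eventually (\<lambda>s. - ((s - z0) * (deriv Q s / Q s)) + (s - z0) * (if ?pr then 1 / (s - 1) else 0) =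
      (s - z0) * log_deriv_series \<xi> s) (at z0 within {s. Re s > 1})"
  proof -
    have "eventually (\<lambda>s. Q s \<noteq> 0) (at z0 within {s. Re s > 1})"
      using ev by (rule filter_leD[OF at_le, rotated]) auto
    moreover have "eventually (\<lambda>s. s \<in> {s. Re s > 1}) (at z0 within {s. Re s > 1})"
      by (simp add: eventually_at_filter)
    ultimately show ?thesis
      by eventually_elim (simp add: log_deriv_Q algebra_simps)
  qed
  ultimately have "((\<lambda>s. (s - z0) * log_deriv_series \<xi> s) \<longlongrightarrow> of_int (e - int k)) (at z0 within {s. Re s > 1})"
    by (rule Lim_transform_eventually)
  thus ?thesis
    using k(2) Q_1 by (intro exI[of _ "e - int k"]) (auto simp: e_def)
qed

text \<open>A zero would force a nonzero residue, but the absolutely convergent series stays bounded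
  near \<open>z0\<close>. No Euler product is involved.\<close>

lemma Q_nonzero_gt_1:
  assumes z0: "Re z0 > 1"
  shows "Q z0 \<noteq> 0"
proof
  assume "Q z0 = 0"
  obtain m :: int where m: "((\<lambda>s. (s - z0) * log_deriv_series \<xi> s) \<longlongrightarrow> of_int m) (at z0 within {s. Re s > 1})"
    "Q z0 = 0 \<longrightarrow> m < 0"
    using log_deriv_residue[OF less_imp_le[OF z0]] by blast
  define \<sigma> where "\<sigma> = (1 + Re z0) / 2"
  have \<sigma>: "\<sigma> > 1" "\<sigma> < Re z0" using z0 by (auto simp: \<sigma>_def)
  obtain K where K: "K > 0" "\<And>s. Re s \<ge> \<sigma> \<Longrightarrow> norm (log_deriv_series \<xi> s) \<le> K"
    using log_deriv_bounded[OF M \<xi> \<sigma>(1)] by metis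
  have at: "at z0 within {s. Re s > 1} = at z0"
    by (rule at_within_open[OF _ open_halfspace_Re_gt]) (use z0 in auto)
  have "((\<lambda>s. (s - z0) * log_deriv_series \<xi> s) \<longlongrightarrow> 0) (at z0)"
  proof (rule Lim_null_comparison)
    have "eventually (\<lambda>s. s \<in> {s. Re s > \<sigma>}) (at z0)"
      using \<sigma> by (intro eventually_at_in_open' open_halfspace_Re_gt) auto
    thus "eventually (\<lambda>s. norm ((s - z0) * log_deriv_series \<xi> s) \<le> norm (s - z0) * K) (at z0)"
      by eventually_elim (auto simp: norm_mult intro!: mult_left_mono K)
    show "((\<lambda>s. norm (s - z0) * K) \<longlongrightarrow> 0) (at z0)"
      by (auto intro!: tendsto_eq_intros)
  qed
  hence "of_int m = (0::complex)" using m(1) unfolding at by (intro tendsto_unique[of "at z0"]) auto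
  thus False using m(2) \<open>Q z0 = 0\<close> by simp
qed

end

lemma filterlim_vertical_right:
  "filterlim (\<lambda>x. of_real x + \<i> * of_real t) (at (1 + \<i> * of_real t) within {s. Re s > 1}) (at_right 1)"
  unfolding filterlim_at
proof
  show "\<forall>\<^sub>F x in at_right 1. complex_of_real x + \<i> * of_real t \<in> {s. 1 < Re s} \<and> complex_of_real x + \<i> * of_real t \<noteq> 1 + \<i> * of_real t"
    using eventually_at_right_less[of 1] by eventually_elim (auto simp: complex_eq_iff)
  have "((\<lambda>x. complex_of_real x + \<i> * of_real t) \<longlongrightarrow> of_real 1 + \<i> * of_real t) (at_right 1)"
    by (intro tendsto_intros)
  thus "((\<lambda>x. complex_of_real x + \<i> * of_real t) \<longlongrightarrow> 1 + \<i> * of_real t) (at_right 1)" by simp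
qed

lemma tendsto_vertical_Re:
  assumes "((\<lambda>s. (s - (1 + \<i> * of_real t)) * f s) \<longlongrightarrow> of_int m) (at (1 + \<i> * of_real t) within {s. Re s > 1})"
  shows "((\<lambda>x. (x - 1) * Re (f (of_real x + \<i> * of_real t))) \<longlongrightarrow> of_int m) (at_right 1)"
proof -
  have "Re ((of_real x + \<i> * of_real t - (1 + \<i> * of_real t)) * w) = (x - 1) * Re w" for x w
    by simp
  thus ?thesis
    using tendsto_Re[OF filterlim_compose[OF assms filterlim_vertical_right]] by simp
qed

text \<open>The inequality \<open>3 + 4 cos \<theta> + cos 2\<theta> \<ge> 0\<close> behind the classical proof of non-vanishing.\<close>

lemma log_deriv_3_4_1:
  assumes M: "M > 1" and \<xi>: "dirichlet_character M \<xi>" and x: "x > 1"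
  shows "3 * Re (log_deriv_series (principal_character M) (of_real x)) +
    4 * Re (log_deriv_series \<xi> (of_real x + \<i> * of_real t)) +
    Re (log_deriv_series (\<lambda>n. \<xi> n * \<xi> n) (of_real x + \<i> * of_real (2 * t))) \<ge> 0"
proof -
  let ?p = "principal_character M"
  have p: "dirichlet_character M ?p" by (rule dirichlet_character_principal)
  have \<xi>2: "dirichlet_character M (\<lambda>n. \<xi> n * \<xi> n)" by (rule dirichlet_character_mult[OF \<xi> \<xi>])
  let ?T = "\<lambda>n. 3 * Re (?p n * mangoldt n * of_nat n powr (- of_real x)) +
      4 * Re (\<xi> n * mangoldt n * of_nat n powr (- (of_real x + \<i> * of_real t))) +
      Re (\<xi> n * \<xi> n * mangoldt n * of_nat n powr (- (of_real x + \<i> * of_real (2 * t))))"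
  have sums: "?T sums (3 * Re (log_deriv_series ?p (of_real x)) +
    4 * Re (log_deriv_series \<xi> (of_real x + \<i> * of_real t)) +
    Re (log_deriv_series (\<lambda>n. \<xi> n * \<xi> n) (of_real x + \<i> * of_real (2 * t))))"
    using x by (intro sums_add sums_mult sums_Re log_deriv_sums[OF M] p \<xi> \<xi>2) auto
  have "?T n \<ge> 0" for n
  proof (cases "n = 0 \<or> \<not> coprime n M")
    case True
    thus ?thesis using dirichlet_characterD(3)[OF \<xi>, of n] by (auto simp: principal_character_def)
  next
    case False
    \<comment> \<open>A number of modulus 1, the exponential of i \<theta> in the inequality; the
      whole term then becomes 2 r (1 + Re w)^2.\<close>
    define w where "w = \<xi> n * of_nat n powr (- (\<i> * of_real t))"
    have nw: "norm w = 1"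
      using False dirichlet_character_norm[OF \<xi>, of n] M by (simp add: w_def norm_mult norm_nat_powr)
    define r where "r = mangoldt n * real n powr (-x)"
    have r: "r \<ge> 0" unfolding r_def by (intro mult_nonneg_nonneg mangoldt_nonneg) auto
    have px: "complex_of_nat n powr (- of_real x) = of_real (real n powr (-x))"
      using False by (simp flip: powr_of_real)
    have e1: "?p n * mangoldt n * of_nat n powr (- of_real x) = of_real r"
      using False by (simp add: principal_character_def px r_def)
    have e2: "\<xi> n * mangoldt n * of_nat n powr (- (of_real x + \<i> * of_real t)) = of_real r * w"
    proof -
      have "complex_of_nat n powr (- (of_real x + \<i> * of_real t)) = of_real (real n powr (-x)) * of_nat n powr (- (\<i> * of_real t))"
        unfolding minus_add_distrib powr_add px ..
      thus ?thesis by (simp add: r_def w_def)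
    qed
    have e3: "\<xi> n * \<xi> n * mangoldt n * of_nat n powr (- (of_real x + \<i> * of_real (2 * t))) = of_real r * w\<^sup>2"
    proof -
      have "- (of_real x + \<i> * of_real (2 * t)) = - of_real x + (- (\<i> * of_real t) + - (\<i> * complex_of_real t))"
        by simp
      hence "complex_of_nat n powr (- (of_real x + \<i> * of_real (2 * t))) =
          of_real (real n powr (-x)) * (of_nat n powr (- (\<i> * of_real t)) * of_nat n powr (- (\<i> * of_real t)))"
        by (simp only: powr_add px)
      thus ?thesis by (simp add: r_def w_def power2_eq_square)
    qed
    have "(Re w)\<^sup>2 + (Im w)\<^sup>2 = 1" using nw by (simp add: cmod_def)
    hence "Re (w\<^sup>2) = 2 * (Re w)\<^sup>2 - 1" by (simp add: power2_eq_square)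
    moreover have "Re (of_real r * z) = r * Re z" for z by simp
    ultimately have "?T n = 2 * r * (1 + Re w)\<^sup>2"
      unfolding e1 e2 e3 Re_complex_of_real by (simp only:) (simp add: power2_eq_square algebra_simps)
    thus ?thesis using r by simp
  qed
  thus ?thesis using sums by (intro sums_le[OF _ sums_zero sums])
qed

text \<open>Without zeros of \<open>Q\<close> on Re s = 1, the function -Q'/Q continues across the
  line. For the principal character a simple pole at 1 with residue 1 remains; lowering each
  coefficient with n > 0 by 1 subtracts zeta, which has the same pole.\<close>

theorem character_log_deriv_continuation:
  assumes M: "M > 1" and \<xi>: "dirichlet_character M \<xi>"
  shows "\<exists>\<Phi> U. open U \<and> {s. Re s \<ge> 1} \<subseteq> U \<and> \<Phi> holomorphic_on U \<and>
    (\<forall>s. Re s > 1 \<longrightarrow>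
       (\<lambda>n. (\<xi> n * mangoldt n - (if \<xi> = principal_character M \<and> n > 0 then 1 else 0)) * of_nat n powr (-s)) sums \<Phi> s)"
proof -
  let ?p = "principal_character M"
  obtain Q where Q: "L_numerator M \<xi> Q" using L_numerator_exists[OF M \<xi>] ..
  have Q_nonzero: "Q z0 \<noteq> 0" if z0: "Re z0 \<ge> 1" for z0
  proof (cases "Re z0 = 1")
    case False
    thus ?thesis using Q_nonzero_gt_1[OF M \<xi> Q] z0 by simp
  next
    case True
    define t where "t = Im z0"
    have z0_eq: "z0 = 1 + \<i> * of_real t" using True by (simp add: t_def complex_eq_iff)
    show ?thesis
    proof
      assume Q0: "Q z0 = 0"
      have p: "dirichlet_character M ?p" by (rule dirichlet_character_principal)
      have \<xi>2: "dirichlet_character M (\<lambda>n. \<xi> n * \<xi> n)" by (rule dirichlet_character_mult[OF \<xi> \<xi>])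
      obtain Qp where Qp: "L_numerator M ?p Qp" using L_numerator_exists[OF M p] ..
      obtain Q2 where Q2: "L_numerator M (\<lambda>n. \<xi> n * \<xi> n) Q2" using L_numerator_exists[OF M \<xi>2] ..
      have one_re: "Re 1 \<ge> 1" and t_re: "Re (1 + \<i> * of_real (2 * t)) \<ge> 1" by simp_all
      from log_deriv_residue[OF M p Qp one_re]
      obtain m0 :: int where m0': "((\<lambda>s. (s - 1) * log_deriv_series ?p s) \<longlongrightarrow> of_int m0) (at 1 within {s. Re s > 1}) \<and>
          m0 \<le> (if ?p = ?p \<and> (1::complex) = 1 then 1 else 0) \<and> (Qp 1 = 0 \<longrightarrow> m0 < 0) \<and>
          (?p = ?p \<and> (1::complex) = 1 \<longrightarrow> m0 = 1)"
        by (rule exE)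
      have m0: "((\<lambda>s. (s - 1) * log_deriv_series ?p s) \<longlongrightarrow> of_int m0) (at 1 within {s. Re s > 1})" "m0 = 1"
        using m0' by (blast, simp)
      obtain m1 :: int where m1: "((\<lambda>s. (s - z0) * log_deriv_series \<xi> s) \<longlongrightarrow> of_int m1) (at z0 within {s. Re s > 1})"
        "m1 < 0"
        using log_deriv_residue[OF M \<xi> Q z0] Q0 by blast
      from log_deriv_residue[OF M \<xi>2 Q2 t_re]
      obtain m2 :: int where m2': "((\<lambda>s. (s - (1 + \<i> * of_real (2 * t))) * log_deriv_series (\<lambda>n. \<xi> n * \<xi> n) s) \<longlongrightarrow> of_int m2)
          (at (1 + \<i> * of_real (2 * t)) within {s. Re s > 1}) \<and>
          m2 \<le> (if (\<lambda>n. \<xi> n * \<xi> n) = ?p \<and> 1 + \<i> * of_real (2 * t) = 1 then 1 else 0) \<and>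
          (Q2 (1 + \<i> * of_real (2 * t)) = 0 \<longrightarrow> m2 < 0) \<and>
          ((\<lambda>n. \<xi> n * \<xi> n) = ?p \<and> 1 + \<i> * of_real (2 * t) = 1 \<longrightarrow> m2 = 1)"
        by (rule exE)
      note m2 = conjunct1[OF m2'] conjunct1[OF conjunct2[OF m2']]
      have l0: "((\<lambda>x. (x - 1) * Re (log_deriv_series ?p (of_real x))) \<longlongrightarrow> m0) (at_right 1)"
        using tendsto_vertical_Re[of 0 "log_deriv_series ?p" m0] m0(1) by simp
      have l1: "((\<lambda>x. (x - 1) * Re (log_deriv_series \<xi> (of_real x + \<i> * of_real t))) \<longlongrightarrow> m1) (at_right 1)"
        by (rule tendsto_vertical_Re[OF m1(1)[unfolded z0_eq]])
      have l2: "((\<lambda>x. (x - 1) * Re (log_deriv_series (\<lambda>n. \<xi> n * \<xi> n) (of_real x + \<i> * of_real (2 * t)))) \<longlongrightarrow> m2) (at_right 1)"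
        by (rule tendsto_vertical_Re[OF m2(1)])
      have "((\<lambda>x. 3 * ((x - 1) * Re (log_deriv_series ?p (of_real x))) +
          4 * ((x - 1) * Re (log_deriv_series \<xi> (of_real x + \<i> * of_real t))) +
          (x - 1) * Re (log_deriv_series (\<lambda>n. \<xi> n * \<xi> n) (of_real x + \<i> * of_real (2 * t)))) \<longlongrightarrow> 3 * real_of_int m0 + 4 * real_of_int m1 + real_of_int m2) (at_right 1)"
        by (intro tendsto_intros l0 l1 l2)
      moreover have "eventually (\<lambda>x. 3 * ((x - 1) * Re (log_deriv_series ?p (of_real x))) +
          4 * ((x - 1) * Re (log_deriv_series \<xi> (of_real x + \<i> * of_real t))) +
          (x - 1) * Re (log_deriv_series (\<lambda>n. \<xi> n * \<xi> n) (of_real x + \<i> * of_real (2 * t))) \<ge> 0) (at_right 1)"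
        using eventually_at_right_less[of 1]
      proof eventually_elim
        case (elim x)
        have "0 \<le> (x - 1) * (3 * Re (log_deriv_series ?p (of_real x)) +
          4 * Re (log_deriv_series \<xi> (of_real x + \<i> * of_real t)) +
          Re (log_deriv_series (\<lambda>n. \<xi> n * \<xi> n) (of_real x + \<i> * of_real (2 * t))))"
          using log_deriv_3_4_1[OF M \<xi> elim, of t] elim by (intro mult_nonneg_nonneg) auto
        thus ?case by (simp only: distrib_left mult.left_commute)
      qed
      ultimately have "0 \<le> 3 * real_of_int m0 + 4 * real_of_int m1 + real_of_int m2"
        by (rule tendsto_lowerbound) auto
      \<comment> \<open>With m0 = 1 and m1 \<le> -1 this forces m2 \<ge> 1. That is possible only if
        the square of \<xi> is principal and t = 0, so \<xi> is real and the zero lies at 1, where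
        \<open>real_character_sum_nonzero\<close> takes over.\<close>
      hence "0 \<le> 3 * m0 + 4 * m1 + m2" by linarith
      hence "(\<lambda>n. \<xi> n * \<xi> n) = ?p" "1 + \<i> * of_real (2 * t) = 1"
        using m0(2) m1(2) m2(2) by (auto split: if_splits)
      hence real: "\<xi> n * \<xi> n = ?p n" and "z0 = 1" for n using z0_eq by (auto dest: fun_cong)
      hence np: "\<xi> \<noteq> ?p" using Q0 Q_1[OF M \<xi> Q] by auto
      have \<xi>_val: "\<xi> n \<in> {-1, 0, 1}" for n
        using real[of n] dirichlet_characterD(3)[OF \<xi>, of n]
        by (cases "coprime n M") (auto simp: principal_character_def square_eq_1_iff)
      have \<xi>_Re: "\<xi> n = of_real (Re (\<xi> n))" for n using \<xi>_val[of n] by auto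
      have "\<bar>\<Sum>j\<le>n. Re (\<xi> j)\<bar> \<le> real M" for n
      proof -
        have "norm (\<Sum>j<Suc n. \<xi> j) \<le> real M"
          using periodic_partial_sums[of \<xi> M "Suc n"] character_mod[OF M \<xi>] character_norm_le[OF M \<xi>] M
            sum_dirichlet_character[OF \<xi> np] by simp
        thus ?thesis using abs_Re_le_cmod[of "\<Sum>j<Suc n. \<xi> j"] by (simp add: lessThan_Suc_atMost)
      qed
      note part = this
      have im: "Im (\<xi> n) = 0" for n using \<xi>_val[of n] by auto
      have "\<not> (\<lambda>n. Re (\<xi> n) / real n) sums 0"
      proof (rule real_character_sum_nonzero[OF _ _ _ _ part])
        show "Re (\<xi> n) \<in> {-1, 0, 1}" for n using \<xi>_val[of n] by auto
        show "Re (\<xi> (x * y)) = Re (\<xi> x) * Re (\<xi> y)" for x y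
          by (simp add: dirichlet_characterD(2)[OF \<xi>] im)
        show "Re (\<xi> 1) = 1" unfolding dirichlet_characterD(4)[OF \<xi>] by simp
        show "Re (\<xi> 0) = 0" using character_zero[OF M \<xi>] by simp
      qed
      moreover have "(\<lambda>n. \<xi> n * of_nat n powr (-1)) sums 0"
        using Q_sums'[OF M \<xi> Q np, of 1] Q0 \<open>z0 = 1\<close> by simp
      hence "(\<lambda>n. Re (\<xi> n * of_nat n powr (-1))) sums Re 0" by (rule sums_Re)
      moreover have "Re (\<xi> n * of_nat n powr (-1)) = Re (\<xi> n) / real n" for n
      proof -
        have "complex_of_nat n powr (-1) = of_real (inverse (real n))"
          by (cases "n = 0") (simp_all add: powr_minus)
        hence eq: "\<xi> n * of_nat n powr (-1) = \<xi> n * of_real (inverse (real n))" by (rule arg_cong)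
        show ?thesis unfolding eq divide_inverse by (simp del: of_real_inverse)
      qed
      ultimately have "\<not> (\<lambda>n. Re (\<xi> n) / real n) sums 0" "(\<lambda>n. Re (\<xi> n) / real n) sums 0" by simp_all
      thus False by contradiction
    qed
  qed
  define U where "U = {s. Re s > 0} \<inter> Q -` (- {0})"
  have U: "open U" unfolding U_def
    by (intro continuous_open_preimage holomorphic_on_imp_continuous_on Q_hol[OF M \<xi> Q] open_halfspace_Re_gt) auto
  have U1: "{s. Re s \<ge> 1} \<subseteq> U" using Q_nonzero by (auto simp: U_def)
  have dQ: "(\<lambda>s. deriv Q s / Q s) holomorphic_on U"
    unfolding U_def
    by (intro holomorphic_on_divide holomorphic_on_subset[OF holomorphic_deriv[OF Q_hol[OF M \<xi> Q] open_halfspace_Re_gt]]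
        holomorphic_on_subset[OF Q_hol[OF M \<xi> Q]]) auto
  have D: "log_deriv_series \<xi> s = - (deriv Q s / Q s) + (if \<xi> = ?p then 1 / (s - 1) else 0)" if "Re s > 1" for s
    using log_deriv_Q[OF M \<xi> Q that] Q_nonzero[of s] that by simp
  show ?thesis
  proof (cases "\<xi> = ?p")
    case False
    show ?thesis
      by (rule exI[of _ "\<lambda>s. - (deriv Q s / Q s)"], rule exI[of _ U])
         (use U U1 False D log_deriv_sums[OF M \<xi>] in \<open>auto intro!: holomorphic_intros dQ\<close>)
  next
    case True
    obtain Z where Z: "Z holomorphic_on {s. Re s > 0}" "Z 1 = 1"
      "\<And>s. Re s > 1 \<Longrightarrow> (\<lambda>n. of_nat n powr (-s)) sums (Z s / (s - 1))"
      using zeta_continuation by metis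
    \<comment> \<open>This is zeta(s) - 1 / (s - 1) with its singularity at 1 removed.\<close>
    define W where "W = (\<lambda>s. if s = 1 then deriv Z 1 else (Z s - Z 1) / (s - 1))"
    have W: "W holomorphic_on U"
      unfolding W_def using Z(1) by (intro pole_lemma_open[OF holomorphic_on_subset[OF Z(1)] U]) (auto simp: U_def)
    show ?thesis
    proof (rule exI[of _ "\<lambda>s. - (deriv Q s / Q s) - W s"], rule exI[of _ U], intro conjI allI impI U U1)
      fix s :: complex assume s: "Re s > 1"
      hence s1: "s \<noteq> 1" by auto
      have "(\<lambda>n. \<xi> n * mangoldt n * of_nat n powr (-s) - of_nat n powr (-s)) sums (log_deriv_series \<xi> s - Z s / (s - 1))"
        using s by (intro sums_diff log_deriv_sums[OF M \<xi>] Z(3))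
      also have "log_deriv_series \<xi> s - Z s / (s - 1) = - (deriv Q s / Q s) - W s"
        using s1 Z(2) True D[OF s] by (simp add: W_def diff_divide_distrib)
      also have "(\<lambda>n. \<xi> n * mangoldt n * of_nat n powr (-s) - of_nat n powr (-s)) =
          (\<lambda>n. (\<xi> n * mangoldt n - (if \<xi> = ?p \<and> n > 0 then 1 else 0)) * of_nat n powr (-s))"
        using True by (auto simp: fun_eq_iff algebra_simps)
      finally show "(\<lambda>n. (\<xi> n * mangoldt n - (if \<xi> = ?p \<and> n > 0 then 1 else 0)) * of_nat n powr (-s)) sums (- (deriv Q s / Q s) - W s)" .
    qed (intro holomorphic_intros dQ W)
  qed
qed

section \<open>The prime number theorem in arithmetic progressions\<close>

lemma ln_fact_mangoldt:
  "ln (fact n) = (\<Sum>d=1..n. mangoldt d * real (n div d))"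
proof -
  have "ln (fact n) = (\<Sum>k=1..n. ln (real k))"
    by (induction n) (auto simp: ln_mult sum.nat_ivl_Suc' simp del: of_nat_Suc)
  also have "\<dots> = (\<Sum>k=1..n. \<Sum>d\<in>{1..n}. if d dvd k then mangoldt d else 0)"
  proof (intro sum.cong refl)
    fix k assume k: "k \<in> {1..n}"
    have "ln (real k) = (\<Sum>d | d dvd k. mangoldt d)"
      using mangoldt_sum[of k, where 'a = real] k by auto
    also have "{d. d dvd k} = {d \<in> {1..n}. d dvd k}"
    proof -
      have "d \<in> {1..n}" if "d dvd k" for d
        using that k dvd_imp_le[of d k] dvd_pos_nat[of k d] by force
      thus ?thesis by blast
    qed
    also have "(\<Sum>d\<in>{d \<in> {1..n}. d dvd k}. mangoldt d) = (\<Sum>d\<in>{1..n}. if d dvd k then mangoldt d else (0::real))"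
      by (intro sum.inter_filter) auto
    finally show "ln (real k) = (\<Sum>d\<in>{1..n}. if d dvd k then mangoldt d else 0)" .
  qed
  also have "\<dots> = (\<Sum>d=1..n. \<Sum>k=1..n. if d dvd k then mangoldt d else 0)"
    by (rule sum.swap)
  also have "\<dots> = (\<Sum>d=1..n. mangoldt d * real (n div d))"
  proof (intro sum.cong refl)
    fix d assume d: "d \<in> {1..n}"
    have "{k \<in> {1..n}. d dvd k} = (\<lambda>q. d * q) ` {1..n div d}"
    proof safe
      fix k assume "k \<in> {1..n}" "d dvd k"
      then obtain q where "k = d * q" by auto
      thus "k \<in> (\<lambda>q. d * q) ` {1..n div d}" using \<open>k \<in> {1..n}\<close> d
        by (intro image_eqI[of _ _ q]) (auto simp: less_eq_div_iff_mult_less_eq mult.commute intro!: Suc_leI Nat.gr0I)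
    next
      fix q assume "q \<in> {1..n div d}"
      thus "d * q \<in> {1..n}" using d by (auto simp: less_eq_div_iff_mult_less_eq mult.commute intro!: Suc_leI Nat.gr0I)
    qed auto
    hence "card {k \<in> {1..n}. d dvd k} = n div d"
      using d by (simp add: card_image inj_on_def)
    moreover have "(\<Sum>k=1..n. if d dvd k then mangoldt d else (0::real)) = (\<Sum>k\<in>{k \<in> {1..n}. d dvd k}. mangoldt d)"
      by (intro sum.inter_filter[symmetric]) auto
    ultimately show "(\<Sum>k=1..n. if d dvd k then mangoldt d else 0) = mangoldt d * real (n div d)"
      by simp
  qed
  finally show ?thesis .
qed

text \<open>Chebyshev's argument with the central binomial coefficient, which is at most 4^n. In its
  logarithm \<open>mangoldt d\<close> has the coefficient (2n div d) - 2 (n div d), which is never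
  negative and is at least 1 for n < d \<le> 2n.\<close>

lemma chebyshev_doubling:
  "(\<Sum>d=1..2*n. mangoldt d) - (\<Sum>d=1..n. mangoldt d) \<le> real n * ln 4"
proof -
  let ?L = "mangoldt :: nat \<Rightarrow> real"
  have "ln (fact (2 * n)) - 2 * ln (fact n) = ln (real ((2 * n) choose n))"
  proof -
    have "real ((2 * n) choose n) = fact (2 * n) / (fact n * fact n)"
      by (simp add: binomial_fact)
    thus ?thesis by (simp add: ln_div ln_mult)
  qed
  also have "\<dots> \<le> ln (2 ^ (2 * n))"
  proof -
    have "real ((2 * n) choose n) \<le> 2 ^ (2 * n)"
      by (metis binomial_le_pow2 of_nat_le_iff of_nat_numeral of_nat_power)
    thus ?thesis by (subst ln_le_cancel_iff) auto
  qed
  also have "\<dots> = real n * ln 4" by (simp add: power_mult ln_realpow)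
  finally have le: "ln (fact (2 * n)) - 2 * ln (fact n) \<le> real n * ln 4" .
  have "(\<Sum>d=1..2*n. ?L d) - (\<Sum>d=1..n. ?L d) = (\<Sum>d=1..2*n. if d \<le> n then 0 else ?L d)"
  proof -
    have "(\<Sum>d=1..n. ?L d) = (\<Sum>d=1..2*n. if d \<le> n then ?L d else 0)"
      by (intro sum.mono_neutral_cong_left) auto
    thus ?thesis by (simp add: sum_subtractf[symmetric] if_distrib cong: if_cong)
  qed
  also have "\<dots> \<le> (\<Sum>d=1..2*n. ?L d * (real ((2 * n) div d) - 2 * real (n div d)))"
  proof (intro sum_mono)
    fix d assume d: "d \<in> {1..2*n}"
    have "2 * (n div d) \<le> (2 * n) div d"
      using d by (simp add: less_eq_div_iff_mult_less_eq)
    hence ge0: "real ((2 * n) div d) - 2 * real (n div d) \<ge> 0" by linarith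
    show "(if d \<le> n then 0 else ?L d) \<le> ?L d * (real ((2 * n) div d) - 2 * real (n div d))"
    proof (cases "d \<le> n")
      case True
      thus ?thesis using ge0 mangoldt_nonneg by simp
    next
      case False
      hence "n div d = 0" "(2 * n) div d \<ge> 1" using d by (auto simp: less_eq_div_iff_mult_less_eq)
      thus ?thesis using False mangoldt_nonneg[of d] by (simp add: mult_left_le mult_le_cancel_left1)
    qed
  qed
  also have "\<dots> = (\<Sum>d=1..2*n. ?L d * real ((2 * n) div d)) - 2 * (\<Sum>d=1..2*n. ?L d * real (n div d))"
    by (simp add: algebra_simps sum_subtractf sum_distrib_left)
  also have "(\<Sum>d=1..2*n. ?L d * real (n div d)) = (\<Sum>d=1..n. ?L d * real (n div d))"
    by (intro sum.mono_neutral_right) auto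
  finally show ?thesis using le unfolding ln_fact_mangoldt by linarith
qed

theorem chebyshev_bound: "(\<Sum>d=1..n. mangoldt d) \<le> 4 * real n"
proof (induction n rule: less_induct)
  case (less n)
  let ?L = "mangoldt :: nat \<Rightarrow> real"
  show ?case
  proof (cases "n \<le> 1")
    case True
    hence "n = 0 \<or> n = 1" by auto
    thus ?thesis by auto
  next
    case False
    define m where "m = n div 2"
    have m: "m < n" "n = 2 * m \<or> n = Suc (2 * m)" using False by (auto simp: m_def)
    have "ln (4::real) = 2 * ln 2" using ln_realpow[of 2 2] by simp
    hence "ln (4::real) \<le> 2" using ln_le_minus_one[of 2] by simp
    hence "real m * ln 4 \<le> real m * 2" by (intro mult_left_mono) auto
    \<comment> \<open>This is 4 m by induction plus 2 m from the doubling step. A last odd term adds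
      at most ln n \<le> 2 m, and 8 m is still below 4 n; the constant 4 is chosen for this
      slack.\<close>
    hence even: "(\<Sum>d=1..2*m. ?L d) \<le> 6 * real m"
      using chebyshev_doubling[of m] less.IH[OF m(1)] by linarith
    show ?thesis
    proof (cases "n = 2 * m")
      case True
      thus ?thesis using even by simp
    next
      case False
      hence n: "n = Suc (2 * m)" using m by auto
      have "?L n \<le> ln (real n)" using n by (intro mangoldt_le) auto
      also have "\<dots> \<le> real n - 1" using n by (intro ln_le_minus_one) auto
      finally have "?L n \<le> 2 * real m" using n by simp
      thus ?thesis using even by (simp add: n)
    qed
  qed
qed

section \<open>From a convergent series to primes in progressions\<close>

text \<open>If \<open>B\<close> were large in absolute value at \<open>N\<close>, the one-sided bound would keep it large on an interval of
  length proportional to \<open>N\<close> to the right or to the left of \<open>N\<close>, against convergence.\<close>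

lemma tauberian_one_sided_lipschitz:
  fixes B :: "nat \<Rightarrow> real"
  assumes lip: "\<And>m n. m \<le> n \<Longrightarrow> B n - B m \<ge> - (real n - real m)"
    and summable: "summable (\<lambda>n. B n * (1 / real n - 1 / real (Suc n)))"
  shows "(\<lambda>n. B n / real n) \<longlonglongrightarrow> 0"
proof (rule LIMSEQ_I)
  fix r :: real assume "r > 0"
  define \<epsilon> where "\<epsilon> = min (r / 2) (1 / 2)"
  have \<epsilon>: "0 < \<epsilon>" "\<epsilon> < r" "\<epsilon> < 1" using \<open>r > 0\<close> by (auto simp: \<epsilon>_def)
  let ?c = "\<lambda>n. B n * (1 / real n - 1 / real (Suc n))"
  obtain N0 where N0: "\<And>m n. m \<ge> N0 \<Longrightarrow> \<bar>\<Sum>k=m..<n. ?c k\<bar> < \<epsilon>\<^sup>2 / 16"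
    using summable[unfolded summable_Cauchy] \<epsilon> by (metis real_norm_def zero_less_divide_iff zero_less_numeral zero_less_power)
  define N1 where "N1 = max (2 * N0 + 2) (nat \<lceil>4 / \<epsilon>\<rceil>)"
  have tele: "(\<Sum>k=m..<n. 1 / real k - 1 / real (Suc k)) = 1 / real m - 1 / real n" if "m \<le> n" for m n
    using sum_Suc_diff'[OF that, of "\<lambda>k. - 1 / real k"] by simp
  have "\<bar>B N\<bar> \<le> \<epsilon> * real N" if N: "N \<ge> N1" for N
  proof -
    have N': "N \<ge> 2 * N0 + 2" "real N \<ge> 4 / \<epsilon>" using N by (auto simp: N1_def)
    hence N4: "\<epsilon> * real N \<ge> 4" using \<epsilon> by (simp add: field_simps)
    have Npos: "real N > 0" using N' by simp
    \<comment> \<open>Over \<open>d\<close> steps the adverse change of \<open>B\<close> is at most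
      \<epsilon> N / 2, so half of the assumed size \<epsilon> N survives. As d \<ge> \<epsilon> N /
      4, the block contributes at least \<epsilon>^2 / 16, the threshold used in the Cauchy
      criterion. A large positive value persists to the right of N, a large negative one to its
      left.\<close>
    define d where "d = nat \<lfloor>\<epsilon> * real N / 2\<rfloor>"
    have d: "real d \<le> \<epsilon> * real N / 2" "real d \<ge> \<epsilon> * real N / 4" using N4 unfolding d_def by linarith+
    have "\<epsilon> * real N \<le> 1 * real N" using \<epsilon> Npos by (intro mult_right_mono) auto
    hence dN: "real d \<le> real N / 2" using d by linarith
    show ?thesis
    proof (rule ccontr)
      assume "\<not> \<bar>B N\<bar> \<le> \<epsilon> * real N"
      then consider "B N > \<epsilon> * real N" | "B N < - (\<epsilon> * real N)" by linarith
      thus False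
      proof cases
        case 1
        have "\<epsilon>\<^sup>2 / 16 \<le> (\<epsilon> * real N / 2) * (1 / real N - 1 / real (N + d))"
        proof -
          have "\<epsilon>\<^sup>2 / 16 = (\<epsilon> * real N / 2) * ((\<epsilon> * real N / 4) / (real N * (2 * real N)))"
            using Npos by (simp add: power2_eq_square field_simps)
          also have "\<dots> \<le> (\<epsilon> * real N / 2) * (real d / (real N * real (N + d)))"
            using d dN \<epsilon> Npos by (intro mult_left_mono frac_le mult_left_mono) auto
          also have "real d / (real N * real (N + d)) = 1 / real N - 1 / real (N + d)"
            using Npos by (simp add: field_simps)
          finally show ?thesis .
        qed
        also have "\<dots> = (\<Sum>k=N..<N+d. (\<epsilon> * real N / 2) * (1 / real k - 1 / real (Suc k)))"
          by (subst sum_distrib_left[symmetric], subst tele) auto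
        also have "\<dots> \<le> (\<Sum>k=N..<N+d. ?c k)"
        proof (intro sum_mono mult_right_mono)
          fix k assume k: "k \<in> {N..<N+d}"
          show "\<epsilon> * real N / 2 \<le> B k" using lip[of N k] k 1 d(1) by auto
          show "0 \<le> 1 / real k - 1 / real (Suc k)" using k Npos by (simp add: frac_le)
        qed
        finally show False using N0[of N "N + d"] N' by linarith
      next
        case 2
        have dN': "d < N" using dN Npos by linarith
        have "\<epsilon>\<^sup>2 / 16 \<le> (\<epsilon> * real N / 2) * (1 / real (N - d) - 1 / real N)"
        proof -
          have "\<epsilon>\<^sup>2 / 16 \<le> (\<epsilon> * real N / 2) * ((\<epsilon> * real N / 4) / (real N * real N))"
            using Npos \<epsilon> by (simp add: power2_eq_square field_simps)
          also have "\<dots> \<le> (\<epsilon> * real N / 2) * (real d / (real (N - d) * real N))"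
            using d dN' \<epsilon> Npos by (intro mult_left_mono frac_le mult_right_mono) auto
          also have "real d / (real (N - d) * real N) = 1 / real (N - d) - 1 / real N"
            using Npos dN' by (simp add: field_simps of_nat_diff)
          finally show ?thesis .
        qed
        also have "\<dots> = (\<Sum>k=N-d..<N. (\<epsilon> * real N / 2) * (1 / real k - 1 / real (Suc k)))"
          by (subst sum_distrib_left[symmetric], subst tele) auto
        also have "\<dots> \<le> (\<Sum>k=N-d..<N. - ?c k)"
          unfolding mult_minus_left[symmetric]
        proof (intro sum_mono mult_right_mono)
          fix k assume k: "k \<in> {N-d..<N}"
          hence "real N - real k \<le> real d" using dN' by auto
          thus "\<epsilon> * real N / 2 \<le> - B k" using lip[of k N] k 2 d(1) by auto
          show "0 \<le> 1 / real k - 1 / real (Suc k)" using k dN' by (intro diff_ge_0_iff_ge[THEN iffD2] frac_le) auto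
        qed
        finally have "\<epsilon>\<^sup>2 / 16 \<le> - (\<Sum>k=N-d..<N. ?c k)" by (simp add: sum_negf)
        moreover have "N - d \<ge> N0" using N' dN by linarith
        ultimately show False using N0[of "N - d" N] by linarith
      qed
    qed
  qed
  hence "\<bar>B N / real N\<bar> < r" if "N \<ge> max N1 1" for N
  proof -
    have "\<bar>B N\<bar> / real N \<le> \<epsilon>"
      using that \<open>\<And>N. N \<ge> N1 \<Longrightarrow> \<bar>B N\<bar> \<le> \<epsilon> * real N\<close>[of N] by (simp add: divide_le_eq)
    thus ?thesis using \<epsilon> by (simp add: abs_divide)
  qed
  thus "\<exists>no. \<forall>n\<ge>no. norm (B n / real n - 0) < r" by (intro exI[of _ "max N1 1"]) auto
qed

text \<open>The same Abel summation read backwards, since Newman's theorem expects the series in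
  \<open>cell\<close> form.\<close>

lemma dirichlet_partial_summation_inverse:
  fixes a :: "nat \<Rightarrow> complex"
  assumes s: "s \<noteq> 0"
    and lim: "(\<lambda>N. (\<Sum>j\<le>N. a j) * of_nat N powr (-s)) \<longlonglongrightarrow> 0"
    and sums: "(\<lambda>n. a n * of_nat n powr (-s)) sums S"
  shows "(\<lambda>k. (\<Sum>j\<le>k. a j) * cell k s) sums (S / s)"
proof -
  have eq: "(\<Sum>k<N. (\<Sum>j\<le>k. a j) * cell k s) =
      ((\<Sum>k\<le>N. a k * of_nat k powr (-s)) - (\<Sum>j\<le>N. a j) * of_nat N powr (-s)) / s" for N
  proof -
    have "s * (\<Sum>k<N. (\<Sum>j\<le>k. a j) * cell k s) =
      (\<Sum>k\<le>N. a k * of_nat k powr (-s)) - (\<Sum>j\<le>N. a j) * of_nat N powr (-s)"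
      unfolding partial_summation sum_distrib_left add_diff_cancel_right'
      using s by (intro sum.cong refl) (simp add: cell_nonzero del: of_nat_Suc)
    thus ?thesis using s by (simp add: field_simps)
  qed
  have "(\<lambda>N. ((\<Sum>k\<le>N. a k * of_nat k powr (-s)) - (\<Sum>j\<le>N. a j) * of_nat N powr (-s)) / s) \<longlonglongrightarrow> (S - 0) / s"
    using sums[unfolded sums_def_le] lim s by (intro tendsto_intros) auto
  thus ?thesis unfolding sums_def eq by simp
qed

text \<open>At s = 1 the cell is 1 / n - 1 / (n + 1), so this is the discrete form of the
  convergence of the integral of (\<psi>(x) - x) / x^2, twisted by \<xi>. The required bound 5 n is
  Chebyshev's 4 n plus n for the subtracted ones.\<close>

theorem character_psi_summable:
  assumes M: "M > 1" and \<xi>: "dirichlet_character M \<xi>"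
  defines "A \<equiv> (\<lambda>n. \<Sum>j\<le>n. \<xi> j * mangoldt j - (if \<xi> = principal_character M \<and> j > 0 then 1 else 0))"
  shows "summable (\<lambda>n. A n * (1 / of_nat n - 1 / of_nat (Suc n)))"
proof -
  define a where "a = (\<lambda>j. \<xi> j * mangoldt j - (if \<xi> = principal_character M \<and> j > 0 then 1 else 0))"
  have A: "A = (\<lambda>n. \<Sum>j\<le>n. a j)" by (simp add: A_def a_def)
  have A_bound: "norm (A n) \<le> 5 * real n" for n
  proof -
    have "norm (A n) \<le> (\<Sum>j\<le>n. mangoldt j + (if j > 0 then 1 else 0))"
      unfolding A
    proof (rule sum_norm_le)
      fix j
      have "norm (\<xi> j * mangoldt j) \<le> 1 * mangoldt j"
        using character_norm_le[OF M \<xi>, of j] mangoldt_nonneg[of j]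
        by (simp only: norm_mult norm_mangoldt) (intro mult_right_mono)
      thus "norm (a j) \<le> mangoldt j + (if j > 0 then 1 else 0)"
        unfolding a_def by (intro norm_triangle_le_diff add_mono) auto
    qed
    also have "\<dots> = (\<Sum>j\<in>insert 0 {1..n}. mangoldt j + (if j > 0 then 1 else 0))"
      by (intro sum.cong) auto
    also have "\<dots> = (\<Sum>j=1..n. mangoldt j) + real n"
      by (simp add: sum.distrib)
    finally show ?thesis using chebyshev_bound[of n] by linarith
  qed
  from character_log_deriv_continuation[OF M \<xi>] obtain \<Phi> where
    "\<exists>U. open U \<and> {s. Re s \<ge> 1} \<subseteq> U \<and> \<Phi> holomorphic_on U \<and>
      (\<forall>s. Re s > 1 \<longrightarrow> (\<lambda>n. a n * of_nat n powr (-s)) sums \<Phi> s)"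
    unfolding a_def by (rule exE)
  then obtain U where U_all: "open U \<and> {s. Re s \<ge> 1} \<subseteq> U \<and> \<Phi> holomorphic_on U \<and>
      (\<forall>s. Re s > 1 \<longrightarrow> (\<lambda>n. a n * of_nat n powr (-s)) sums \<Phi> s)"
    by (rule exE)
  hence U: "open U" "{s. Re s \<ge> 1} \<subseteq> U" and \<Phi>: "\<Phi> holomorphic_on U" by simp_all
  have sums: "(\<lambda>n. a n * of_nat n powr (-s)) sums \<Phi> s" if "Re s > 1" for s
    using U_all that by simp
  \<comment> \<open>The variable is shifted by 1 as in Newman's theorem; s = 0 is removed because
    passing to cells divides by s.\<close>
  define U' where "U' = (\<lambda>z. z + 1) -` (U - {0})"
  have op: "open U'" unfolding U'_def by (intro open_vimage continuous_intros) (use U in auto)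
  have sub: "{z. Re z \<ge> 0} \<subseteq> U'"
  proof
    fix z :: complex assume "z \<in> {z. Re z \<ge> 0}"
    hence "z + 1 \<in> U" "z + 1 \<noteq> 0" using U(2) by (auto simp: complex_eq_iff)
    thus "z \<in> U'" by (simp add: U'_def)
  qed
  have hol: "(\<lambda>z. \<Phi> (z + 1) / (z + 1)) holomorphic_on U'"
  proof -
    have "(\<Phi> \<circ> (\<lambda>z. z + 1)) holomorphic_on U'"
      by (rule holomorphic_on_compose_gen[OF _ \<Phi>]) (auto simp: U'_def intro!: holomorphic_intros)
    thus ?thesis by (intro holomorphic_intros) (auto simp: U'_def o_def)
  qed
  have sm: "(\<lambda>n. A n * cell n (1 + z)) sums (\<Phi> (z + 1) / (z + 1))" if z: "Re z > 0" for z
  proof -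
    have lim: "(\<lambda>N. 5 * real N powr (- Re z)) \<longlonglongrightarrow> 0"
      using z by (intro tendsto_mult_right_zero tendsto_neg_powr filterlim_real_sequentially) auto
    have ev: "eventually (\<lambda>N. norm (A N * of_nat N powr (-(1 + z))) \<le> 5 * real N powr (- Re z)) sequentially"
      using eventually_gt_at_top[of 0]
    proof eventually_elim
      case (elim N)
      have "norm (A N * of_nat N powr (-(1 + z))) \<le> 5 * real N * real N powr (-(1 + Re z))"
        using A_bound[of N] elim by (simp add: norm_mult norm_nat_powr mult_right_mono)
      also have "\<dots> = 5 * real N powr (- Re z)"
        using elim by (simp add: powr_diff powr_minus field_simps)
      finally show ?case .
    qed
    have "(\<lambda>N. A N * of_nat N powr (-(1 + z))) \<longlonglongrightarrow> 0"
      by (rule Lim_null_comparison[OF ev lim])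
    moreover have "1 + z \<noteq> 0" using z by (auto simp: complex_eq_iff)
    ultimately have "(\<lambda>n. A n * cell n (1 + z)) sums (\<Phi> (1 + z) / (1 + z))"
      using sums[of "1 + z"] z unfolding A by (intro dirichlet_partial_summation_inverse) auto
    thus ?thesis by (simp add: add.commute)
  qed
  have "(\<lambda>n. A n * cell n 1) sums (\<Phi> (0 + 1) / (0 + 1))"
    by (rule newman_tauberian[OF A_bound op sub hol sm])
  hence "summable (\<lambda>n. A n * cell n 1)" by (rule sums_summable)
  moreover have "A n * cell n 1 = A n * (1 / of_nat n - 1 / of_nat (Suc n))" for n
    by (simp add: cell_nonzero powr_minus inverse_eq_divide del: of_nat_Suc)
  ultimately show ?thesis by simp
qed

text \<open>The sums of single characters are complex and not monotone. Their combination
  \<open>B\<close> by orthogonality is real, and because the sum of \<open>mangoldt\<close> over a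
  residue class never decreases, \<open>B\<close> falls by at most 1 per step. That is the one-sided
  bound the Tauberian lemma asks for.\<close>

theorem prime_number_theorem_progression:
  assumes M: "M > 1" and a: "coprime a M"
  shows "(\<lambda>n. (\<Sum>k | k \<le> n \<and> [k = a] (mod M). mangoldt k) / real n) \<longlonglongrightarrow> 1 / real (totient M)"
proof -
  let ?X = "{\<xi>. dirichlet_character M \<xi>}" and ?p = "principal_character M"
  define \<psi> :: "nat \<Rightarrow> real" where "\<psi> = (\<lambda>n. \<Sum>k | k \<le> n \<and> [k = a] (mod M). mangoldt k)"
  define B where "B = (\<lambda>n. real (totient M) * \<psi> n - real n)"
  define A where "A = (\<lambda>(\<xi> :: nat \<Rightarrow> complex) (n :: nat). \<Sum>j\<le>n. \<xi> j * mangoldt j - (if \<xi> = ?p \<and> j > 0 then 1 else 0))"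
  have fin: "finite ?X" using M by (intro finite_dirichlet_characters) auto
  have \<psi>_eq: "\<psi> n = (\<Sum>k\<le>n. if [k = a] (mod M) then mangoldt k else 0)" for n
    unfolding \<psi>_def by (simp add: sum.inter_filter[symmetric])
  have B_eq: "of_real (B n) = (\<Sum>\<xi>\<in>?X. cnj (\<xi> a) * A \<xi> n)" for n
  proof -
    have "(\<Sum>\<xi>\<in>?X. cnj (\<xi> a) * A \<xi> n) =
        (\<Sum>j\<le>n. (\<Sum>\<xi>\<in>?X. cnj (\<xi> a) * \<xi> j) * mangoldt j - (\<Sum>\<xi>\<in>?X. cnj (\<xi> a) * (if \<xi> = ?p \<and> j > 0 then 1 else 0)))"
      unfolding A_def sum_distrib_left
      by (subst sum.swap) (simp add: right_diff_distrib sum_subtractf sum_distrib_right mult.assoc)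
    also have "\<dots> = (\<Sum>j\<le>n. of_real (real (totient M) * (if [j = a] (mod M) then mangoldt j else 0) - (if j > 0 then 1 else 0)))"
    proof (intro sum.cong refl)
      fix j :: nat
      have "(\<Sum>\<xi>\<in>?X. cnj (\<xi> a) * (if \<xi> = ?p \<and> j > 0 then 1 else 0)) = (\<Sum>\<xi>\<in>{?p}. cnj (\<xi> a) * (if \<xi> = ?p \<and> j > 0 then 1 else 0))"
        using fin dirichlet_character_principal by (intro sum.mono_neutral_right) auto
      also have "\<dots> = (if j > 0 then 1 else 0)" using a by (simp add: principal_character_def)
      finally show "(\<Sum>\<xi>\<in>?X. cnj (\<xi> a) * \<xi> j) * mangoldt j - (\<Sum>\<xi>\<in>?X. cnj (\<xi> a) * (if \<xi> = ?p \<and> j > 0 then 1 else 0)) =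
          of_real (real (totient M) * (if [j = a] (mod M) then mangoldt j else 0) - (if j > 0 then 1 else 0))"
        using dirichlet_character_orthogonality[OF M a, of j] by simp
    qed
    also have "\<dots> = of_real (B n)"
    proof -
      have "(\<Sum>j\<le>n. if j > 0 then 1 else 0 :: real) = real n" by (induction n) auto
      thus ?thesis unfolding of_real_sum[symmetric] B_def \<psi>_eq sum_subtractf sum_distrib_left[symmetric] by simp
    qed
    finally show ?thesis by simp
  qed
  have "summable (\<lambda>n. \<Sum>\<xi>\<in>?X. cnj (\<xi> a) * (A \<xi> n * (1 / of_nat n - 1 / of_nat (Suc n))))"
    unfolding A_def using M by (intro summable_sum summable_mult character_psi_summable) auto
  also have "(\<lambda>n. \<Sum>\<xi>\<in>?X. cnj (\<xi> a) * (A \<xi> n * (1 / of_nat n - 1 / of_nat (Suc n)))) =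
      (\<lambda>n. complex_of_real (B n * (1 / real n - 1 / real (Suc n))))"
    by (simp add: B_eq sum_distrib_right mult.assoc)
  finally have summable: "summable (\<lambda>n. B n * (1 / real n - 1 / real (Suc n)))"
    by (simp only: summable_of_real_iff)
  have "(\<lambda>n. B n / real n) \<longlonglongrightarrow> 0"
  proof (rule tauberian_one_sided_lipschitz[OF _ summable])
    fix m n :: nat assume "m \<le> n"
    hence "\<psi> m \<le> \<psi> n" unfolding \<psi>_def by (intro sum_mono2) (auto simp: mangoldt_nonneg)
    hence "real (totient M) * \<psi> m \<le> real (totient M) * \<psi> n" by (intro mult_left_mono) auto
    thus "B n - B m \<ge> - (real n - real m)" unfolding B_def by linarith
  qed
  hence "(\<lambda>n. (B n / real n + 1) / real (totient M)) \<longlonglongrightarrow> (0 + 1) / real (totient M)"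
    using M by (intro tendsto_intros) auto
  moreover have "eventually (\<lambda>n. (B n / real n + 1) / real (totient M) = \<psi> n / real n) sequentially"
    using eventually_gt_at_top[of 0] by eventually_elim (use M in \<open>auto simp: B_def field_simps\<close>)
  ultimately show ?thesis unfolding \<psi>_def by (auto elim: Lim_transform_eventually)
qed

section \<open>Multiplicative functions on squarefree numbers\<close>

text \<open>This is F N = o(ln N). The additive constant makes each inequality hold from N = 2 on,
  so that inequalities can be added and summed without moving thresholds.\<close>

definition log_small :: "(nat \<Rightarrow> complex) \<Rightarrow> bool" where
  "log_small F \<longleftrightarrow> (\<forall>\<delta>>0. \<exists>C. \<forall>N\<ge>2. norm (F N) \<le> \<delta> * ln (real N) + C)"

lemma log_smallD:
  assumes "log_small F" "\<delta> > 0"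
  obtains C where "C \<ge> 0" "\<And>N. N \<ge> 2 \<Longrightarrow> norm (F N) \<le> \<delta> * ln (real N) + C"
proof -
  obtain C where C: "\<And>N. N \<ge> 2 \<Longrightarrow> norm (F N) \<le> \<delta> * ln (real N) + C"
    using assms unfolding log_small_def by blast
  show ?thesis by (rule that[of "max C 0"]) (auto intro: order_trans[OF C])
qed

lemma log_small_add:
  assumes "log_small F" "log_small G"
  shows "log_small (\<lambda>N. F N + G N)"
  unfolding log_small_def
proof (intro allI impI)
  fix \<delta> :: real assume "\<delta> > 0"
  hence d: "\<delta> / 2 > 0" by simp
  obtain C D where "\<And>N. N \<ge> 2 \<Longrightarrow> norm (F N) \<le> \<delta> / 2 * ln (real N) + C"
    "\<And>N. N \<ge> 2 \<Longrightarrow> norm (G N) \<le> \<delta> / 2 * ln (real N) + D"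
    using log_smallD[OF assms(1) d] log_smallD[OF assms(2) d] by metis
  hence "norm (F N + G N) \<le> \<delta> * ln (real N) + (C + D)" if "N \<ge> 2" for N
    using norm_triangle_ineq[of "F N" "G N"] that by fastforce
  thus "\<exists>C. \<forall>N\<ge>2. norm (F N + G N) \<le> \<delta> * ln (real N) + C" by blast
qed

lemma log_small_cmult:
  assumes "log_small F"
  shows "log_small (\<lambda>N. c * F N)"
  unfolding log_small_def
proof (intro allI impI)
  fix \<delta> :: real assume "\<delta> > 0"
  define k where "k = norm c + 1"
  have k: "k > 0" "norm c \<le> k" by (auto simp: k_def add_nonneg_pos)
  hence "\<delta> / k > 0" using \<open>\<delta> > 0\<close> by simp
  then obtain C where C: "\<And>N. N \<ge> 2 \<Longrightarrow> norm (F N) \<le> \<delta> / k * ln (real N) + C"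
    using log_smallD[OF assms] by metis
  have "norm (c * F N) \<le> \<delta> * ln (real N) + k * C" if "N \<ge> 2" for N
  proof -
    have "norm (c * F N) \<le> k * (\<delta> / k * ln (real N) + C)"
      using C[OF that] k by (simp only: norm_mult) (intro mult_mono, auto)
    also have "\<dots> = \<delta> * ln (real N) + k * C" using k by (simp add: distrib_left)
    finally show ?thesis .
  qed
  thus "\<exists>C. \<forall>N\<ge>2. norm (c * F N) \<le> \<delta> * ln (real N) + C" by blast
qed

lemma log_small_bounded:
  assumes "\<And>N. N \<ge> 2 \<Longrightarrow> norm (F N) \<le> C"
  shows "log_small F"
  unfolding log_small_def
proof (intro allI impI)
  fix \<delta> :: real assume "\<delta> > 0"
  hence "\<delta> * ln (real N) \<ge> 0" if "N \<ge> 2" for N using that by simp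
  thus "\<exists>C. \<forall>N\<ge>2. norm (F N) \<le> \<delta> * ln (real N) + C"
    using assms by (intro exI[of _ C] allI impI) (metis add.commute add_increasing2)
qed

lemma sum_inverse_le_ln: "N \<ge> 1 \<Longrightarrow> (\<Sum>n=2..N. 1 / real n) \<le> ln (real N)"
proof (induction N rule: dec_induct)
  case (step N)
  have "ln (real N / real (Suc N)) \<le> real N / real (Suc N) - 1"
    using step.hyps by (intro ln_le_minus_one) auto
  also have "\<dots> = - (1 / real (Suc N))" by (simp add: field_simps)
  finally have "1 / real (Suc N) \<le> ln (real (Suc N)) - ln (real N)"
    using step.hyps by (simp add: ln_div)
  thus ?case using step by simp
qed simp

text \<open>Dividing by n ln n turns o(ln n) into o(1 / n), and the sum of 1 / n up to N is about ln
  N; finitely many early terms go into the constant.\<close>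

lemma log_small_sum:
  assumes "log_small F"
  shows "log_small (\<lambda>N. \<Sum>n=2..N. F n / (real n * ln (real n)))"
  unfolding log_small_def
proof (intro allI impI)
  fix \<delta> :: real assume "\<delta> > 0"
  hence "\<delta> / 2 > 0" by simp
  then obtain C where C: "C \<ge> 0" "\<And>N. N \<ge> 2 \<Longrightarrow> norm (F N) \<le> \<delta> / 2 * ln (real N) + C"
    using log_smallD[OF assms] by metis
  have "eventually (\<lambda>n. C \<le> \<delta> / 2 * ln (real n)) sequentially"
    using \<open>\<delta> > 0\<close> by real_asymp
  then obtain n0 where n0: "\<And>n. n \<ge> n0 \<Longrightarrow> C \<le> \<delta> / 2 * ln (real n)"
    by (auto simp: eventually_at_top_linorder)
  define b where "b = (\<lambda>n. norm (F n / (real n * ln (real n))))"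
  have b: "b n \<le> \<delta> * (1 / real n) + (if n < n0 then b n else 0)" if "n \<ge> 2" for n
  proof (cases "n < n0")
    case False
    have ln: "ln (real n) > 0" using that by simp
    have "norm (F n) \<le> \<delta> * ln (real n)" using C(2)[OF that] n0[of n] False by linarith
    moreover have "b n = norm (F n) / (real n * ln (real n))"
      unfolding b_def using ln by (simp add: norm_divide norm_mult)
    ultimately have "b n \<le> \<delta> * ln (real n) / (real n * ln (real n))"
      using ln by (simp only:) (intro divide_right_mono, auto)
    thus ?thesis using False ln by simp
  qed (use \<open>\<delta> > 0\<close> in simp)
  have "norm (\<Sum>n=2..N. F n / (real n * ln (real n))) \<le> \<delta> * ln (real N) + (\<Sum>n<n0. b n)" if "N \<ge> 2" for N
  proof -
    have "norm (\<Sum>n=2..N. F n / (real n * ln (real n))) \<le> (\<Sum>n=2..N. b n)"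
      unfolding b_def by (rule norm_sum)
    also have "\<dots> \<le> (\<Sum>n=2..N. \<delta> * (1 / real n) + (if n < n0 then b n else 0))"
      by (intro sum_mono b) auto
    also have "\<dots> = \<delta> * (\<Sum>n=2..N. 1 / real n) + (\<Sum>n=2..N. if n < n0 then b n else 0)"
      by (simp add: sum.distrib sum_distrib_left)
    also have "\<dots> \<le> \<delta> * ln (real N) + (\<Sum>n<n0. b n)"
    proof (intro add_mono mult_left_mono sum_inverse_le_ln)
      have "(\<Sum>n=2..N. if n < n0 then b n else 0) = (\<Sum>n\<in>{n\<in>{2..N}. n < n0}. b n)"
        by (intro sum.inter_filter[symmetric]) auto
      also have "\<dots> \<le> (\<Sum>n<n0. b n)" by (intro sum_mono2) (auto simp: b_def)
      finally show "(\<Sum>n=2..N. if n < n0 then b n else 0) \<le> (\<Sum>n<n0. b n)" .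
    qed (use that \<open>\<delta> > 0\<close> in auto)
    finally show ?thesis .
  qed
  thus "\<exists>C. \<forall>N\<ge>2. norm (\<Sum>n=2..N. F n / (real n * ln (real n))) \<le> \<delta> * ln (real N) + C" by blast
qed

text \<open>The tangent at \<open>x\<close> lies above the concave function with exponent \<theta>;
  in homogeneous form this is weighted AM-GM for 1 and y / x, obtained from convexity of
  \<open>exp\<close>.\<close>

lemma powr_concave:
  fixes x y \<theta> :: real
  assumes "0 < y" "0 < x" "0 \<le> \<theta>" "\<theta> \<le> 1"
  shows "y powr \<theta> \<le> x powr \<theta> - \<theta> * x powr (\<theta> - 1) * (x - y)"
proof -
  have "exp ((1 - \<theta>) *\<^sub>R 0 + \<theta> *\<^sub>R ln (y / x)) \<le> (1 - \<theta>) * exp 0 + \<theta> * exp (ln (y / x))"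
    by (rule convex_onD[OF exp_convex]) (use assms in auto)
  hence "(y / x) powr \<theta> \<le> 1 - \<theta> + \<theta> * (y / x)" using assms by (simp add: powr_def mult.commute)
  hence "x powr \<theta> * (y / x) powr \<theta> \<le> x powr \<theta> * (1 - \<theta> + \<theta> * (y / x))" by (intro mult_left_mono) auto
  also have "x powr \<theta> * (y / x) powr \<theta> = y powr \<theta>" using assms by (simp flip: powr_mult)
  also have "x powr \<theta> * (1 - \<theta> + \<theta> * (y / x)) = x powr \<theta> - \<theta> * x powr (\<theta> - 1) * (x - y)"
    using assms by (simp add: powr_diff field_simps)
  finally show ?thesis .
qed

text \<open>A discrete analogue of \<open>V' = \<tau> V / (u log u) + o(1/u)\<close>, whose solutions are \<open>o(log u)\<close> because
  \<open>\<bar>(log u)\<^sup>\<tau>\<bar> = (log u)\<^bsup>Re \<tau>\<^esup>\<close>.\<close>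

lemma log_small_recurrence:
  fixes V E :: "nat \<Rightarrow> complex"
  assumes \<tau>: "Re \<tau> < 1" and E: "log_small E"
    and rec: "\<And>N. N \<ge> 2 \<Longrightarrow> V (Suc N) = V N + (\<tau> * V (Suc N) + E (Suc N)) / (real (Suc N) * ln (real (Suc N)))"
  shows "log_small V"
  unfolding log_small_def
proof (intro allI impI)
  fix \<delta> :: real assume "\<delta> > 0"
  define \<rho> where "\<rho> = Re \<tau>"
  \<comment> \<open>An exponent between max \<rho> 0 and 1: \<rho> \<le> \<theta> lets the power of
    ln N majorize the solution, \<theta> \<ge> 0 allows the concavity bound, and \<theta> < 1 makes
    the power o(ln N).\<close>
  define \<theta> where "\<theta> = (max \<rho> 0 + 1) / 2"
  have \<theta>: "0 < \<theta>" "\<theta> < 1" "\<rho> \<le> \<theta>" using \<tau> by (auto simp: \<theta>_def \<rho>_def)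
  define K where "K = \<delta> / 2"
  \<comment> \<open>The comparison function is K ln N + D (ln N)^\<theta>. Its linear part grows by
    about K / N in a step, of which the equation uses up K \<rho> / N; the difference \<eta> / N is
    what pays for the error \<open>E\<close>. The second part absorbs the initial value.\<close>
  define \<eta> where "\<eta> = K * (1 - \<rho>)"
  have K: "K > 0" "\<eta> > 0" using \<tau> \<open>\<delta> > 0\<close> by (auto simp: K_def \<eta>_def \<rho>_def)
  hence "\<eta> / 2 > 0" by simp
  then obtain C where C: "C \<ge> 0" "\<And>N. N \<ge> 2 \<Longrightarrow> norm (E N) \<le> \<eta> / 2 * ln (real N) + C"
    using log_smallD[OF E] by metis
  have "eventually (\<lambda>n. C \<le> \<eta> / 2 * ln (real n)) sequentially" using K by real_asymp
  moreover have "eventually (\<lambda>n::nat. n \<ge> 3) sequentially" by (rule eventually_ge_at_top)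
  ultimately have "eventually (\<lambda>n. C \<le> \<eta> / 2 * ln (real n) \<and> n \<ge> 3) sequentially" by eventually_elim auto
  then obtain n0 where n0: "\<And>n. n \<ge> n0 \<Longrightarrow> C \<le> \<eta> / 2 * ln (real n) \<and> n \<ge> 3"
    by (auto simp: eventually_at_top_linorder)
  have n03: "n0 \<ge> 3" using n0[of n0] by simp
  have ln1: "ln (real n) \<ge> 1" if "n \<ge> 3" for n
  proof -
    have "exp 1 \<le> real n" using exp_le that by linarith
    thus ?thesis using that by (subst ln_ge_iff) auto
  qed
  define D where "D = norm (V n0)"
  have D: "D \<ge> 0" by (simp add: D_def)
  have bound: "norm (V N) \<le> K * ln (real N) + D * ln (real N) powr \<theta>" if "N \<ge> n0" for N
    using that
  proof (induction N rule: dec_induct)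
    case base
    have "ln (real n0) powr \<theta> \<ge> 1" using ln1[OF n03] \<theta> by (intro ge_one_powr_ge_zero) auto
    hence "D * 1 \<le> D * ln (real n0) powr \<theta>" using D by (intro mult_left_mono)
    moreover have "K * ln (real n0) \<ge> 0" using K ln1[OF n03] by simp
    ultimately show ?case by (simp add: D_def)
  next
    case (step n)
    define N where "N = Suc n"
    have n3: "n \<ge> 3" "N \<ge> 3" using step.hyps n03 by (auto simp: N_def)
    define L where "L = ln (real N)"
    have L: "L \<ge> 1" unfolding L_def using ln1 n3 by simp
    define q where "q = real N * L"
    have "3 * 1 \<le> q" unfolding q_def using n3 L by (intro mult_mono) auto
    hence q: "q \<ge> 3" by simp
    have gap: "ln (real n) \<le> L - 1 / real N"
    proof -
      have "ln (real n / real N) \<le> real n / real N - 1" using n3 by (intro ln_le_minus_one) auto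
      also have "\<dots> = - (1 / real N)" using n3 by (simp add: N_def field_simps)
      finally show ?thesis unfolding L_def using n3 by (simp add: ln_div)
    qed
    have lnn: "ln (real n) > 0" using ln1[OF n3(1)] by linarith
    have rec': "V N - \<tau> * V N / of_real q = V n + E N / of_real q"
    proof -
      have "V N = V n + (\<tau> * V N + E N) / of_real q"
        using rec[of n] n3 unfolding N_def q_def L_def by simp
      thus ?thesis by (simp only: add_divide_distrib diff_eq_eq add_ac)
    qed
    \<comment> \<open>The new value stands on both sides of the recurrence. Collecting it on the
      left and bounding the factor below by its real part is the point where only Re \<tau>
      matters.\<close>
    have "norm (1 - \<tau> / of_real q) \<ge> 1 - \<rho> / q"
      using complex_Re_le_cmod[of "1 - \<tau> / of_real q"] by (simp add: \<rho>_def)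
    hence "(1 - \<rho> / q) * norm (V N) \<le> norm (1 - \<tau> / of_real q) * norm (V N)"
      by (intro mult_right_mono) auto
    also have "\<dots> = norm (V n + E N / of_real q)"
      unfolding rec'[symmetric] norm_mult[symmetric] by (simp add: algebra_simps)
    also have "\<dots> \<le> norm (V n) + norm (E N / of_real q)" by (rule norm_triangle_ineq)
    also have "norm (E N / of_real q) \<le> \<eta> * L / q"
    proof -
      have "norm (E N) \<le> \<eta> * L"
        using C(2)[of N] n0[of N] step.hyps n3 unfolding L_def N_def by force
      thus ?thesis using q by (simp add: norm_divide divide_right_mono)
    qed
    also have "\<eta> * L / q = \<eta> / real N" using L by (simp add: q_def)
    also have "norm (V n) \<le> K * ln (real n) + D * ln (real n) powr \<theta>" by (rule step.IH)
    also have "\<dots> \<le> K * (L - 1 / real N) + D * (L powr \<theta> - \<theta> * L powr (\<theta> - 1) * (1 / real N))"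
    proof (intro add_mono mult_left_mono gap)
      have "ln (real n) powr \<theta> \<le> L powr \<theta> - \<theta> * L powr (\<theta> - 1) * (L - ln (real n))"
        using lnn L \<theta> by (intro powr_concave) auto
      also have "\<dots> \<le> L powr \<theta> - \<theta> * L powr (\<theta> - 1) * (1 / real N)"
        using gap \<theta> by (intro diff_left_mono mult_left_mono) auto
      finally show "ln (real n) powr \<theta> \<le> L powr \<theta> - \<theta> * L powr (\<theta> - 1) * (1 / real N)" .
    qed (use K D in auto)
    finally have "(1 - \<rho> / q) * norm (V N) \<le>
        K * (L - 1 / real N) + D * (L powr \<theta> - \<theta> * L powr (\<theta> - 1) * (1 / real N)) + \<eta> / real N" by simp
    also have "\<dots> = K * (L - \<rho> / real N) + D * (L powr \<theta> - \<theta> * (L powr \<theta> / q))"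
    proof -
      have "\<eta> / real N = K / real N - K * \<rho> / real N"
        by (simp add: \<eta>_def right_diff_distrib diff_divide_distrib)
      moreover have "\<theta> * L powr (\<theta> - 1) * (1 / real N) = \<theta> * (L powr \<theta> / q)"
        using L by (simp add: q_def powr_diff field_simps)
      ultimately show ?thesis by (simp add: algebra_simps)
    qed
    also have "\<dots> \<le> K * (L - \<rho> / real N) + D * (L powr \<theta> - \<rho> * (L powr \<theta> / q))"
      using \<theta> q D by (intro add_left_mono mult_left_mono diff_left_mono mult_right_mono) auto
    also have "\<dots> = (1 - \<rho> / q) * (K * L + D * L powr \<theta>)"
      using L n3 by (simp add: q_def field_simps)
    finally have "(1 - \<rho> / q) * norm (V N) \<le> (1 - \<rho> / q) * (K * L + D * L powr \<theta>)" .
    moreover have "1 - \<rho> / q > 0" using q \<tau> by (simp add: \<rho>_def)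
    ultimately show ?case unfolding N_def[symmetric] L_def[symmetric] by simp
  qed
  have "eventually (\<lambda>n. D * ln (real n) powr \<theta> \<le> K * ln (real n)) sequentially"
    using K \<theta> by real_asymp
  then obtain n1 where n1: "\<And>n. n \<ge> n1 \<Longrightarrow> D * ln (real n) powr \<theta> \<le> K * ln (real n)"
    by (auto simp: eventually_at_top_linorder)
  define C' where "C' = (\<Sum>n<max n0 n1. norm (V n))"
  have "norm (V N) \<le> \<delta> * ln (real N) + C'" if "N \<ge> 2" for N
  proof (cases "N < max n0 n1")
    case True
    hence "norm (V N) \<le> C'" unfolding C'_def by (intro member_le_sum) auto
    moreover have "\<delta> * ln (real N) \<ge> 0" using \<open>\<delta> > 0\<close> that by simp
    ultimately show ?thesis by linarith
  next
    case False
    moreover have "C' \<ge> 0" unfolding C'_def by (intro sum_nonneg) auto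
    moreover have "norm (V N) \<le> K * ln (real N) + D * ln (real N) powr \<theta>" "D * ln (real N) powr \<theta> \<le> K * ln (real N)"
      using False bound n1 by auto
    moreover have "\<delta> * ln (real N) = K * ln (real N) + K * ln (real N)" by (simp add: K_def)
    ultimately show ?thesis by linarith
  qed
  thus "\<exists>C. \<forall>N\<ge>2. norm (V N) \<le> \<delta> * ln (real N) + C" by blast
qed


text \<open>For each prime p the powers with exponent at least 2 give a geometric series of size at
  most 2 ln p / p^2, and these are summable.\<close>

lemma mangoldt_higher_powers_bound:
  "\<exists>C. \<forall>N. (\<Sum>d=1..N. (if prime d then 0 else mangoldt d) / real d) \<le> C"
proof -
  have smb: "summable (\<lambda>n. 2 * (ln (real n) * real n powr (-2)))"
    by (intro summable_mult summable_ln_powr) auto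
  define C where "C = (\<Sum>n. 2 * (ln (real n) * real n powr (-2)))"
  have nonneg: "2 * (ln (real n) * real n powr (-2)) \<ge> 0" for n
    by (cases "n = 0") auto
  have "(\<Sum>d=1..N. (if prime d then 0 else mangoldt d) / real d) \<le> C" for N
  proof -
    define g :: "nat \<Rightarrow> real" where "g = (\<lambda>d. mangoldt d / real d)"
    define P where "P = {p. prime p \<and> p \<le> N}"
    have g_nonneg: "g d \<ge> 0" for d unfolding g_def using mangoldt_nonneg[of d] by simp
    have "(\<Sum>d=1..N. (if prime d then 0 else mangoldt d) / real d) =
        (\<Sum>d\<in>{d\<in>{1..N}. primepow d \<and> \<not> prime d}. g d)"
      by (intro sum.mono_neutral_cong_right) (auto simp: g_def mangoldt_def)
    also have "\<dots> \<le> (\<Sum>d\<in>(\<lambda>(p, j). p ^ j) ` (P \<times> {2..<N+2}). g d)"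
    proof (rule sum_mono2)
      show "{d\<in>{1..N}. primepow d \<and> \<not> prime d} \<subseteq> (\<lambda>(p, j). p ^ j) ` (P \<times> {2..<N+2})"
      proof
        fix d assume d: "d \<in> {d\<in>{1..N}. primepow d \<and> \<not> prime d}"
        then obtain p k where pk: "prime p" "k > 0" "d = p ^ k" by (auto simp: primepow_def)
        have "k \<noteq> 1" using d pk by auto
        hence "k \<ge> 2" using pk by simp
        have "p \<le> p ^ k" using pk prime_gt_0_nat[OF pk(1)] by (intro self_le_power) auto
        moreover have "k < p ^ k" using power_gt_expt[OF prime_gt_Suc_0_nat[OF pk(1)]] .
        ultimately show "d \<in> (\<lambda>(p, j). p ^ j) ` (P \<times> {2..<N+2})"
          using d pk \<open>k \<ge> 2\<close> by (auto simp: P_def intro!: image_eqI[of _ _ "(p, k)"])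
      qed
    qed (use g_nonneg in \<open>auto simp: P_def\<close>)
    also have "\<dots> \<le> (\<Sum>(p, j)\<in>P \<times> {2..<N+2}. g (p ^ j))"
      using sum_image_le[of "P \<times> {2..<N+2}" g "\<lambda>(p, j). p ^ j"] g_nonneg
      by (simp add: P_def o_def case_prod_unfold)
    also have "\<dots> = (\<Sum>p\<in>P. \<Sum>j=2..<N+2. g (p ^ j))" by (rule sum.cartesian_product[symmetric])
    also have "\<dots> \<le> (\<Sum>p\<in>P. 2 * (ln (real p) * real p powr (-2)))"
    proof (rule sum_mono)
      fix p assume "p \<in> P"
      hence p: "prime p" "p \<ge> 2" by (auto simp: P_def prime_ge_2_nat)
      define x where "x = 1 / real p"
      have x: "0 < x" "x \<le> 1 / 2" using p by (auto simp: x_def field_simps)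
      have "(\<Sum>j=2..<N+2. g (p ^ j)) = (\<Sum>j<N. g (p ^ (j + 2)))"
        by (subst sum.atLeastLessThan_shift_0) (simp add: lessThan_atLeast0)
      also have "\<dots> = (\<Sum>j<N. ln (real p) * x\<^sup>2 * x ^ j)"
      proof (intro sum.cong refl)
        fix j
        have "(mangoldt (p ^ (j + 2)) :: real) = ln (real p)" using mangoldt_primepow'[OF p(1), of "j + 2", where 'a = real] by (simp only: of_real_eq_id id_apply)
        moreover have "x ^ (j + 2) = 1 / real p ^ (j + 2)" by (simp only: x_def power_one_over)
        ultimately have "g (p ^ (j + 2)) = ln (real p) * x ^ (j + 2)" by (simp only: g_def of_nat_power) simp
        thus "g (p ^ (j + 2)) = ln (real p) * x\<^sup>2 * x ^ j" by (simp only: power_add mult_ac)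
      qed
      also have "\<dots> = ln (real p) * x\<^sup>2 * (\<Sum>j<N. x ^ j)" by (simp add: sum_distrib_left)
      also have "\<dots> \<le> ln (real p) * x\<^sup>2 * 2"
      proof (intro mult_left_mono)
        have "(\<Sum>j<N. x ^ j) \<le> (\<Sum>j. x ^ j)" using x by (intro sum_le_suminf summable_geometric) auto
        also have "\<dots> = 1 / (1 - x)" using x by (intro suminf_geometric) auto
        also have "\<dots> \<le> 2" using x by (simp add: field_simps)
        finally show "(\<Sum>j<N. x ^ j) \<le> 2" .
      qed (use p x in auto)
      also have "x\<^sup>2 = real p powr (-2)" using p by (simp add: x_def powr_minus power_divide inverse_eq_divide powr_numeral)
      finally show "(\<Sum>j=2..<N+2. g (p ^ j)) \<le> 2 * (ln (real p) * real p powr (-2))" by simp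
    qed
    also have "\<dots> \<le> C" unfolding C_def using smb nonneg by (intro sum_le_suminf) (auto simp: P_def)
    finally show ?thesis .
  qed
  thus ?thesis by blast
qed

lemma sum_divisor_pairs:
  fixes F :: "nat \<Rightarrow> nat \<Rightarrow> 'a :: comm_monoid_add"
  shows "(\<Sum>n=1..N. \<Sum>d | d dvd n. F d (n div d)) = (\<Sum>m=1..N. \<Sum>d=1..N div m. F d m)"
proof -
  have "(\<Sum>n=1..N. \<Sum>d | d dvd n. F d (n div d)) = (\<Sum>(n, d)\<in>Sigma {1..N} (\<lambda>n. {d. d dvd n}). F d (n div d))"
    by (rule sum.Sigma) auto
  also have "\<dots> = (\<Sum>(m, d)\<in>Sigma {1..N} (\<lambda>m. {1..N div m}). F d m)"
  proof (rule sum.reindex_bij_witness[of _ "\<lambda>(m, d). (d * m, d)" "\<lambda>(n, d). (n div d, d)"], goal_cases)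
    case (2 p)
    then obtain n d where p: "p = (n, d)" "n \<in> {1..N}" "d dvd n" by auto
    then obtain m where m: "n = d * m" by auto
    have "d > 0" "m > 0" using m p by (auto intro!: Nat.gr0I)
    moreover have "m \<le> N" using m p \<open>d > 0\<close> by (auto intro: order_trans[of m "d * m"])
    ultimately show ?case using m p by (auto simp: less_eq_div_iff_mult_less_eq)
  next
    case (4 p)
    then obtain m d where p: "p = (m, d)" "m \<in> {1..N}" "d \<in> {1..N div m}" by auto
    hence "d * m \<le> N" "d * m > 0" by (auto simp: less_eq_div_iff_mult_less_eq)
    thus ?case using p by auto
  qed auto
  also have "\<dots> = (\<Sum>m=1..N. \<Sum>d=1..N div m. F d m)"
    by (rule sum.Sigma[symmetric]) auto
  finally show ?thesis .
qed

section \<open>The convolution identity and the mean value of f\<close>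

text \<open>The hypotheses on \<open>f\<close> say that \<open>f n = \<Prod>\<^bsub>p | n\<^esub> h p\<close> (up to a constant) for squarefree \<open>n\<close> and \<open>f n = 0\<close>
  otherwise.\<close>

locale squarefree_multiplicative =
  fixes f h :: "nat \<Rightarrow> complex"
  assumes f_prime: "\<And>p k. \<lbrakk>prime p; \<not> p dvd k\<rbrakk> \<Longrightarrow> f (p * k) = h p * f k"
    and f_zero: "\<And>n. \<not> squarefree n \<Longrightarrow> f n = 0"
    and f_norm: "\<And>n. norm (f n) \<le> 1" and h_norm: "\<And>n. norm (h n) \<le> 1"
begin

definition conv :: "nat \<Rightarrow> complex" where
  "conv n = (\<Sum>d | d dvd n. h d * mangoldt d * f (n div d))"

text \<open>A squarefree n has no prime power divisors except primes, and for a prime d dividing it,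
  d does not divide n / d, so \<open>f_prime\<close> applies to every nonzero term.\<close>

lemma f_ln_squarefree:
  assumes "squarefree n"
  shows "f n * ln (real n) = conv n"
proof -
  have n: "n \<noteq> 0" using assms by (metis not_squarefree_0)
  have "conv n = (\<Sum>d | d dvd n. f n * mangoldt d)"
    unfolding conv_def
  proof (intro sum.cong refl)
    fix d assume "d \<in> {d. d dvd n}"
    hence d: "d dvd n" by simp
    show "h d * mangoldt d * f (n div d) = f n * mangoldt d"
    proof (cases "prime d")
      case True
      have dd: "d * (n div d) = n" using d by simp
      have "\<not> d dvd n div d"
      proof
        assume "d dvd n div d"
        hence "d\<^sup>2 dvd n" using dd by (metis mult_dvd_mono dvd_refl power2_eq_square)
        thus False using assms True by (auto simp: squarefree_def)
      qed
      from f_prime[OF True this] show ?thesis using dd by simp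
    next
      case False
      have "\<not> primepow d"
      proof
        assume "primepow d"
        then obtain p k where pk: "prime p" "k > 0" "d = p ^ k" by (auto simp: primepow_def)
        hence "k \<ge> 2" using False by (cases "k = 1") auto
        hence "p\<^sup>2 dvd n" using pk d by (meson dvd_trans le_imp_power_dvd)
        thus False using assms pk by (auto simp: squarefree_def)
      qed
      thus ?thesis by (simp add: mangoldt_def)
    qed
  qed
  also have "\<dots> = f n * of_real (ln (real n))"
    using mangoldt_sum[OF n, where 'a = complex] by (simp flip: sum_distrib_left)
  finally show ?thesis by simp
qed

text \<open>Here \<open>f n\<close> is 0 but \<open>conv n\<close> need not be. A prime d with d^2
  not dividing n leaves n / d non-squarefree and gives no contribution; only higher prime powers and
  primes whose square divides n are left.\<close>

lemma conv_not_squarefree: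
  assumes n: "n > 0" "\<not> squarefree n"
  shows "norm (conv n) \<le> (\<Sum>d | d dvd n. (if prime d then 0 else mangoldt d)) +
    (\<Sum>d=1..n. if d\<^sup>2 dvd n then ln (real d) else 0)"
proof -
  have "norm (conv n) \<le> (\<Sum>d | d dvd n. (if prime d then 0 else mangoldt d) + (if d\<^sup>2 dvd n then ln (real d) else 0))"
    unfolding conv_def
  proof (rule sum_norm_le)
    fix d assume "d \<in> {d. d dvd n}"
    hence d: "d dvd n" "d > 0" using n by (auto intro: dvd_pos_nat)
    have "norm (h d * mangoldt d * f (n div d)) \<le> 1 * mangoldt d * 1"
      unfolding norm_mult norm_mangoldt using f_norm h_norm mangoldt_nonneg by (intro mult_mono) auto
    hence le: "norm (h d * mangoldt d * f (n div d)) \<le> mangoldt d" by simp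
    have ln: "ln (real d) \<ge> 0" using d by simp
    show "norm (h d * mangoldt d * f (n div d)) \<le> (if prime d then 0 else mangoldt d) + (if d\<^sup>2 dvd n then ln (real d) else 0)"
    proof (cases "prime d \<and> \<not> d\<^sup>2 dvd n")
      case True
      have dd: "d * (n div d) = n" using d by simp
      have nd: "\<not> d dvd n div d" using True dd by (metis mult_dvd_mono dvd_refl power2_eq_square)
      have "\<not> squarefree (n div d)"
      proof
        assume "squarefree (n div d)"
        moreover have "coprime d (n div d)" using True nd by (intro prime_imp_coprime) auto
        ultimately have "squarefree (d * (n div d))" using True squarefree_mult_coprime[of d "n div d"] squarefree_prime[of d] by blast
        thus False using n dd by simp
      qed
      thus ?thesis using f_zero ln mangoldt_nonneg[of d] by auto
    next
      case False
      thus ?thesis using le ln by auto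
    qed
  qed
  also have "\<dots> = (\<Sum>d | d dvd n. (if prime d then 0 else mangoldt d)) + (\<Sum>d | d dvd n. if d\<^sup>2 dvd n then ln (real d) else 0)"
    by (rule sum.distrib)
  also have "(\<Sum>d | d dvd n. if d\<^sup>2 dvd n then ln (real d) else 0) \<le> (\<Sum>d=1..n. if d\<^sup>2 dvd n then ln (real d) else 0)"
    using n by (intro sum_mono2) (auto dest: dvd_imp_le intro: Suc_leI dvd_pos_nat)
  finally show ?thesis by simp
qed

text \<open>Both exceptional terms are O(N) on average: the higher prime powers because the sum of
  \<open>mangoldt d / d\<close> over them is bounded, the square divisors because the sum of ln d /
  d^2 converges. An error O(N) is negligible against N ln N.\<close>

lemma conv_error:
  "\<exists>C. \<forall>N. norm ((\<Sum>n=1..N. f n * ln (real n)) - (\<Sum>n=1..N. conv n)) \<le> C * real N"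
proof -
  obtain C1 where C1: "\<And>N. (\<Sum>d=1..N. (if prime d then 0 else mangoldt d) / real d) \<le> C1"
    using mangoldt_higher_powers_bound by blast
  define C2 where "C2 = (\<Sum>n. ln (real n) * real n powr (-2))"
  have smb: "summable (\<lambda>n. ln (real n) * real n powr (-2))" by (rule summable_ln_powr) simp
  have "norm ((\<Sum>n=1..N. f n * ln (real n)) - (\<Sum>n=1..N. conv n)) \<le> (C1 + C2) * real N" for N
  proof -
    define u :: "nat \<Rightarrow> real" where "u = (\<lambda>d. if prime d then 0 else mangoldt d)"
    have u: "u d \<ge> 0" for d using mangoldt_nonneg[of d] by (simp add: u_def)
    have ln0: "ln (real d) \<ge> 0" for d by (cases "d = 0") auto
    have "norm ((\<Sum>n=1..N. f n * ln (real n)) - (\<Sum>n=1..N. conv n)) \<le>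
        (\<Sum>n=1..N. (\<Sum>d | d dvd n. u d) + (\<Sum>d=1..n. if d\<^sup>2 dvd n then ln (real d) else 0))"
      unfolding sum_subtractf[symmetric]
    proof (rule sum_norm_le)
      fix n assume n: "n \<in> {1..N}"
      show "norm (f n * ln (real n) - conv n) \<le> (\<Sum>d | d dvd n. u d) + (\<Sum>d=1..n. if d\<^sup>2 dvd n then ln (real d) else 0)"
      proof (cases "squarefree n")
        case True
        have "(\<Sum>d | d dvd n. u d) + (\<Sum>d=1..n. if d\<^sup>2 dvd n then ln (real d) else 0) \<ge> 0"
          using u ln0 by (intro add_nonneg_nonneg sum_nonneg) auto
        thus ?thesis using f_ln_squarefree[OF True] by simp
      next
        case False
        thus ?thesis using conv_not_squarefree[of n] n f_zero[of n] by (simp add: u_def)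
      qed
    qed
    also have "\<dots> = (\<Sum>n=1..N. \<Sum>d | d dvd n. u d) + (\<Sum>n=1..N. \<Sum>d=1..n. if d\<^sup>2 dvd n then ln (real d) else 0)"
      by (rule sum.distrib)
    also have "(\<Sum>n=1..N. \<Sum>d | d dvd n. u d) \<le> C1 * real N"
    proof -
      have "(\<Sum>n=1..N. \<Sum>d | d dvd n. u d) = (\<Sum>n=1..N. \<Sum>d | d dvd n. u (n div d))"
      proof (rule sum.cong[OF refl])
        fix n assume "n \<in> {1..N}"
        thus "(\<Sum>d | d dvd n. u d) = (\<Sum>d | d dvd n. u (n div d))"
          by (intro sum.reindex_bij_witness[of _ "\<lambda>d. n div d" "\<lambda>d. n div d"]) (auto elim!: dvdE)
      qed
      also have "\<dots> = (\<Sum>m=1..N. u m * real (N div m))"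
        using sum_divisor_pairs[of "\<lambda>d m. u m" N] by (simp add: mult.commute)
      also have "\<dots> \<le> (\<Sum>m=1..N. u m / real m * real N)"
      proof (rule sum_mono)
        fix m assume "m \<in> {1..N}"
        have "u m * real (N div m) \<le> u m * (real N / real m)" using u of_nat_div_le_of_nat by (intro mult_left_mono) auto
        thus "u m * real (N div m) \<le> u m / real m * real N" by simp
      qed
      also have "\<dots> = (\<Sum>m=1..N. u m / real m) * real N" by (simp add: sum_distrib_right)
      also have "\<dots> \<le> C1 * real N" using C1[of N] by (intro mult_right_mono) (auto simp: u_def)
      finally show ?thesis .
    qed
    also have "(\<Sum>n=1..N. \<Sum>d=1..n. if d\<^sup>2 dvd n then ln (real d) else 0) \<le> C2 * real N"
    proof -
      have "(\<Sum>n=1..N. \<Sum>d=1..n. if d\<^sup>2 dvd n then ln (real d) else 0) \<le>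
          (\<Sum>n=1..N. \<Sum>d=1..N. if d\<^sup>2 dvd n then ln (real d) else 0)"
        using ln0 by (intro sum_mono sum_mono2) auto
      also have "\<dots> = (\<Sum>d=1..N. \<Sum>n=1..N. if d\<^sup>2 dvd n then ln (real d) else 0)" by (rule sum.swap)
      also have "\<dots> \<le> (\<Sum>d=1..N. ln (real d) * real d powr (-2) * real N)"
      proof (rule sum_mono)
        fix d assume d: "d \<in> {1..N}"
        have "(\<Sum>n=1..N. if d\<^sup>2 dvd n then ln (real d) else 0) = (\<Sum>n\<in>{n\<in>{1..N}. d\<^sup>2 dvd n}. ln (real d))"
          by (intro sum.inter_filter[symmetric]) auto
        also have "\<dots> = real (card {n\<in>{1..N}. d\<^sup>2 dvd n}) * ln (real d)" by simp
        also have "card {n\<in>{1..N}. d\<^sup>2 dvd n} \<le> card ((\<lambda>q. d\<^sup>2 * q) ` {1..N div d\<^sup>2})"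
        proof (rule card_mono)
          show "{n\<in>{1..N}. d\<^sup>2 dvd n} \<subseteq> (\<lambda>q. d\<^sup>2 * q) ` {1..N div d\<^sup>2}"
          proof
            fix n assume n: "n \<in> {n\<in>{1..N}. d\<^sup>2 dvd n}"
            then obtain q where q: "n = d\<^sup>2 * q" by auto
            have "q > 0" using q n by (intro Nat.gr0I) auto
            thus "n \<in> (\<lambda>q. d\<^sup>2 * q) ` {1..N div d\<^sup>2}"
              using q n d by (auto simp: less_eq_div_iff_mult_less_eq mult.commute)
          qed
        qed auto
        also have "\<dots> \<le> N div d\<^sup>2" using card_image_le[of "{1..N div d\<^sup>2}" "\<lambda>q. d\<^sup>2 * q"] by simp
        finally have "(\<Sum>n=1..N. if d\<^sup>2 dvd n then ln (real d) else 0) \<le> real (N div d\<^sup>2) * ln (real d)"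
          using ln0[of d] by (simp add: mult_right_mono)
        also have "\<dots> \<le> real N / real (d\<^sup>2) * ln (real d)"
          using ln0[of d] by (intro mult_right_mono of_nat_div_le_of_nat)
        also have "\<dots> = ln (real d) * real d powr (-2) * real N"
          using d by (simp add: powr_minus powr_numeral inverse_eq_divide)
        finally show "(\<Sum>n=1..N. if d\<^sup>2 dvd n then ln (real d) else 0) \<le> ln (real d) * real d powr (-2) * real N" .
      qed
      also have "\<dots> = (\<Sum>d=1..N. ln (real d) * real d powr (-2)) * real N" by (simp add: sum_distrib_right)
      also have "\<dots> \<le> C2 * real N"
        unfolding C2_def using ln0 by (intro mult_right_mono sum_le_suminf smb) auto
      finally show ?thesis .
    qed
    finally show ?thesis by (simp add: algebra_simps)
  qed
  thus ?thesis by blast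
qed

lemma conv_sum: "(\<Sum>n=1..N. conv n) = (\<Sum>m=1..N. f m * (\<Sum>d=1..N div m. h d * mangoldt d))"
  unfolding conv_def sum_divisor_pairs[of "\<lambda>d m. h d * mangoldt d * f m"] sum_distrib_left
  by (simp add: mult_ac)

text \<open>The aim is S N ln N = o(N ln N). As S N ln N is close to \<tau> N T N, it is enough that
  T N = o(ln N), and T is in turn recovered from S by Abel summation; closing this loop gives the
  recurrence for \<open>V\<close>.\<close>

theorem mean_value_zero:
  assumes lim: "(\<lambda>n. (\<Sum>d=1..n. h d * mangoldt d) / of_nat n) \<longlonglongrightarrow> \<tau>" and \<tau>: "Re \<tau> < 1"
  shows "(\<lambda>N. (\<Sum>n=1..N. f n) / of_nat N) \<longlonglongrightarrow> 0"
proof -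
  define \<Psi> where "\<Psi> = (\<lambda>n. \<Sum>d=1..n. h d * mangoldt d)"
  define S where "S = (\<lambda>N. \<Sum>n=1..N. f n)"
  define T where "T = (\<lambda>N. \<Sum>n=1..N. f n / of_nat n)"
  define V where "V = (\<lambda>N. \<Sum>n=2..N. T n / (real n * ln (real n)))"
  have S_norm: "norm (S N) \<le> real N" for N
    using sum_norm_le[of "{1..N}" f "\<lambda>_. 1"] f_norm by (simp add: S_def)
  have \<Psi>_approx: "\<exists>C. \<forall>n. norm (\<Psi> n - \<tau> * of_nat n) \<le> \<delta> * real n + C" if "\<delta> > 0" for \<delta>
  proof -
    obtain n0 where n0: "\<And>n. n \<ge> n0 \<Longrightarrow> norm (\<Psi> n / of_nat n - \<tau>) < \<delta>"
      using LIMSEQ_D[OF lim \<open>\<delta> > 0\<close>] unfolding \<Psi>_def by blast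
    have "norm (\<Psi> n - \<tau> * of_nat n) \<le> \<delta> * real n + (\<Sum>k\<le>n0. norm (\<Psi> k - \<tau> * of_nat k))" for n
    proof (cases "n \<le> n0")
      case True
      hence "norm (\<Psi> n - \<tau> * of_nat n) \<le> (\<Sum>k\<le>n0. norm (\<Psi> k - \<tau> * of_nat k))"
        by (intro member_le_sum) auto
      thus ?thesis using that by (simp add: add_increasing)
    next
      case False
      hence "n > 0" by simp
      have "\<Psi> n - \<tau> * of_nat n = (\<Psi> n / of_nat n - \<tau>) * of_nat n" using \<open>n > 0\<close> by (simp add: field_simps)
      hence "norm (\<Psi> n - \<tau> * of_nat n) \<le> \<delta> * real n"
        using n0[of n] False by (simp add: norm_mult mult_right_mono)
      moreover have "(\<Sum>k\<le>n0. norm (\<Psi> k - \<tau> * of_nat k)) \<ge> 0" by (intro sum_nonneg) auto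
      ultimately show ?thesis by linarith
    qed
    thus ?thesis by blast
  qed
  have ln_sum: "(\<Sum>n=1..N. ln (real N) - ln (real n)) \<le> real N" for N
  proof (induction N)
    case (Suc N)
    show ?case
    proof (cases "N = 0")
      case False
      have "ln (real (Suc N) / real N) \<le> real (Suc N) / real N - 1"
        using False by (intro ln_le_minus_one) auto
      hence "ln (real (Suc N)) - ln (real N) \<le> 1 / real N" using False by (simp add: ln_div field_simps)
      hence "real N * (ln (real (Suc N)) - ln (real N)) \<le> real N * (1 / real N)" by (intro mult_left_mono) auto
      moreover have "(\<Sum>n=1..Suc N. ln (real (Suc N)) - ln (real n)) =
          (\<Sum>n=1..N. ln (real N) - ln (real n)) + real N * (ln (real (Suc N)) - ln (real N))"
        by (simp add: sum_subtractf algebra_simps)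
      ultimately show ?thesis using Suc False by simp
    qed auto
  qed auto
  \<comment> \<open>Three errors enter, before division by N: replacing ln n by ln N costs N,
    replacing f n ln n by \<open>conv n\<close> costs O(N), and replacing \<Psi> (N div m) by \<tau>
    N / m costs \<delta> N ln N + O(N).\<close>
  define F where "F = (\<lambda>N. S N * of_real (ln (real N)) / of_nat N - \<tau> * T N)"
  have F: "log_small F"
    unfolding log_small_def
  proof (intro allI impI)
    fix \<delta> :: real assume "\<delta> > 0"
    obtain C1 where C1: "\<And>n. norm (\<Psi> n - \<tau> * of_nat n) \<le> \<delta> * real n + C1"
      using \<Psi>_approx[OF \<open>\<delta> > 0\<close>] by blast
    obtain C2 where C2: "\<And>N. norm ((\<Sum>n=1..N. f n * ln (real n)) - (\<Sum>n=1..N. conv n)) \<le> C2 * real N"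
      using conv_error by blast
    have "norm (F N) \<le> \<delta> * ln (real N) + (1 + C2 + \<delta> + C1 + norm \<tau>)" if N: "N \<ge> 2" for N
    proof -
      have e1: "norm (S N * of_real (ln (real N)) - (\<Sum>n=1..N. f n * ln (real n))) \<le> real N"
      proof -
        have "S N * of_real (ln (real N)) - (\<Sum>n=1..N. f n * ln (real n)) =
            (\<Sum>n=1..N. f n * of_real (ln (real N) - ln (real n)))"
          unfolding S_def sum_distrib_right sum_subtractf[symmetric]
          by (intro sum.cong refl) (simp add: algebra_simps)
        also have "norm \<dots> \<le> (\<Sum>n=1..N. ln (real N) - ln (real n))"
        proof (rule sum_norm_le)
          fix n assume n: "n \<in> {1..N}"
          have "norm (f n * of_real (ln (real N) - ln (real n))) = norm (f n) * (ln (real N) - ln (real n))"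
            using n by (simp only: norm_mult norm_of_real) simp
          also have "\<dots> \<le> 1 * (ln (real N) - ln (real n))"
            using n f_norm by (intro mult_right_mono) auto
          finally show "norm (f n * of_real (ln (real N) - ln (real n))) \<le> ln (real N) - ln (real n)" by simp
        qed
        also have "\<dots> \<le> real N" by (rule ln_sum)
        finally show ?thesis .
      qed
      have e3: "norm ((\<Sum>n=1..N. conv n) - \<tau> * of_nat N * T N) \<le> \<delta> * real N * (1 + ln (real N)) + (C1 + norm \<tau>) * real N"
      proof -
        have "(\<Sum>n=1..N. conv n) - \<tau> * of_nat N * T N = (\<Sum>m=1..N. f m * (\<Psi> (N div m) - \<tau> * (of_nat N / of_nat m)))"
        proof -
          have "\<tau> * of_nat N * T N = (\<Sum>m=1..N. f m * (\<tau> * (of_nat N / of_nat m)))"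
            unfolding T_def sum_distrib_left by (intro sum.cong refl) simp
          thus ?thesis by (simp only: conv_sum \<Psi>_def right_diff_distrib sum_subtractf)
        qed
        also have "norm \<dots> \<le> (\<Sum>m=1..N. \<delta> * real N * (1 / real m) + (C1 + norm \<tau>))"
        proof (rule sum_norm_le)
          fix m assume m: "m \<in> {1..N}"
          have d1: "real (N div m) \<le> real N / real m" by (rule of_nat_div_le_of_nat)
          have "real N = real m * real (N div m) + real (N mod m)"
            by (metis of_nat_add of_nat_mult mult_div_mod_eq)
          moreover have "real (N mod m) \<le> real m" using m by (simp add: less_imp_le)
          ultimately have d2: "real N / real m - real (N div m) \<le> 1" using m by (simp add: field_simps)
          have "\<Psi> (N div m) - \<tau> * (of_nat N / of_nat m) = (\<Psi> (N div m) - \<tau> * of_nat (N div m)) -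
              \<tau> * of_real (real N / real m - real (N div m))"
            by (simp add: algebra_simps)
          also have "norm \<dots> \<le> (\<delta> * real (N div m) + C1) + norm \<tau> * 1"
          proof (rule order_trans[OF norm_triangle_ineq4 add_mono[OF C1]])
            have "\<bar>real N / real m - real (N div m)\<bar> \<le> 1" using d1 d2 by linarith
            thus "norm (\<tau> * of_real (real N / real m - real (N div m))) \<le> norm \<tau> * 1"
              by (simp only: norm_mult norm_of_real) (intro mult_left_mono, auto)
          qed
          also have "\<dots> \<le> \<delta> * real N * (1 / real m) + (C1 + norm \<tau>)"
            using mult_left_mono[OF d1, of \<delta>] \<open>\<delta> > 0\<close> by simp
          finally have "norm (\<Psi> (N div m) - \<tau> * (of_nat N / of_nat m)) \<le> \<delta> * real N * (1 / real m) + (C1 + norm \<tau>)" .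
          hence "norm (f m) * norm (\<Psi> (N div m) - \<tau> * (of_nat N / of_nat m)) \<le> 1 * (\<delta> * real N * (1 / real m) + (C1 + norm \<tau>))"
            using f_norm by (intro mult_mono) auto
          thus "norm (f m * (\<Psi> (N div m) - \<tau> * (of_nat N / of_nat m))) \<le> \<delta> * real N * (1 / real m) + (C1 + norm \<tau>)"
            by (simp only: norm_mult mult_1)
        qed
        also have "\<dots> = \<delta> * real N * (\<Sum>m=1..N. 1 / real m) + (C1 + norm \<tau>) * real N"
          by (simp add: sum.distrib sum_distrib_left mult.commute)
        also have "(\<Sum>m=1..N. 1 / real m) = 1 + (\<Sum>m=2..N. 1 / real m)"
          using N by (subst sum.atLeast_Suc_atMost) (auto simp: numeral_2_eq_2)
        also have "\<dots> \<le> 1 + ln (real N)" using sum_inverse_le_ln[of N] N by simp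
        finally show ?thesis using \<open>\<delta> > 0\<close> by (simp add: mult_left_mono)
      qed
      have "norm (S N * of_real (ln (real N)) - \<tau> * of_nat N * T N) \<le>
          real N + C2 * real N + (\<delta> * real N * (1 + ln (real N)) + (C1 + norm \<tau>) * real N)"
        using norm_triangle_le[OF add_mono[OF e1 C2[of N]]] e3
        by (smt (verit, best) diff_add_cancel norm_triangle_ineq add_diff_eq)
      also have "\<dots> = (\<delta> * ln (real N) + (1 + C2 + \<delta> + C1 + norm \<tau>)) * real N" by (simp add: algebra_simps)
      finally have "norm (S N * of_real (ln (real N)) - \<tau> * of_nat N * T N) / real N \<le> \<delta> * ln (real N) + (1 + C2 + \<delta> + C1 + norm \<tau>)"
        using N by (simp add: divide_le_eq)
      moreover have "F N = (S N * of_real (ln (real N)) - \<tau> * of_nat N * T N) / of_nat N"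
        using N by (simp add: F_def field_simps)
      ultimately show ?thesis by (simp add: norm_divide)
    qed
    thus "\<exists>C. \<forall>N\<ge>2. norm (F N) \<le> \<delta> * ln (real N) + C" by blast
  qed
  \<comment> \<open>Abel summation gives T N as the sum of S n / n^2 up to a bounded amount, and by
    the choice of \<open>F\<close> the quotient S n / n^2 equals (F n + \<tau> T n) / (n ln n) for n
    \<ge> 2. So \<open>B\<close> is the bounded remainder of a discrete integral equation.\<close>
  define B where "B = (\<lambda>N. T N - \<tau> * V N - (\<Sum>n=2..N. F n / (real n * ln (real n))))"
  have "norm (B N) \<le> 3" if N: "N \<ge> 2" for N
  proof -
    have Abel: "T N = (\<Sum>n=1..N. S n * (1 / of_nat n - 1 / of_nat (Suc n))) + S N / of_nat (Suc N)" for N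
      by (induction N) (simp_all add: T_def S_def algebra_simps add_divide_distrib del: of_nat_Suc)
    have "T N = S 1 * (1 - 1 / 2) + (\<Sum>n=2..N. S n * (1 / of_nat n - 1 / of_nat (Suc n))) + S N / of_nat (Suc N)"
      unfolding Abel[of N] using N by (subst sum.atLeast_Suc_atMost) (auto simp: numeral_2_eq_2)
    moreover have "(\<Sum>n=2..N. F n / (real n * ln (real n))) = (\<Sum>n=2..N. S n / (of_nat n)\<^sup>2) - \<tau> * V N"
      unfolding V_def sum_distrib_left sum_subtractf[symmetric]
    proof (intro sum.cong refl)
      fix n assume "n \<in> {2..N}"
      hence "ln (real n) \<noteq> 0" "n \<noteq> 0" by auto
      thus "F n / complex_of_real (real n * ln (real n)) = S n / (of_nat n)\<^sup>2 - \<tau> * (T n / complex_of_real (real n * ln (real n)))"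
        by (simp add: F_def diff_divide_distrib power2_eq_square)
    qed
    ultimately have B_eq: "B N = S 1 * (1 - 1 / 2) + S N / of_nat (Suc N) +
        (\<Sum>n=2..N. S n * (1 / of_nat n - 1 / of_nat (Suc n)) - S n / (of_nat n)\<^sup>2)"
      unfolding B_def sum_subtractf by simp
    have "norm (\<Sum>n=2..N. S n * (1 / of_nat n - 1 / of_nat (Suc n)) - S n / (of_nat n)\<^sup>2) \<le> (\<Sum>n=2..N. 1 / real n - 1 / real (Suc n))"
    proof (rule sum_norm_le)
      fix n assume n: "n \<in> {2..N}"
      hence n0: "complex_of_nat n \<noteq> 0" "complex_of_nat (Suc n) \<noteq> 0" by (auto simp del: of_nat_Suc)
      have "S n * (1 / of_nat n - 1 / of_nat (Suc n)) - S n / (of_nat n)\<^sup>2 = - S n / ((of_nat n)\<^sup>2 * of_nat (Suc n))"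
        using n0 by (simp add: field_simps power2_eq_square del: of_nat_Suc) (simp add: algebra_simps)
      also have "norm \<dots> \<le> real n / ((real n)\<^sup>2 * real (Suc n))"
        using S_norm[of n] by (simp add: norm_divide norm_mult norm_power divide_right_mono del: of_nat_Suc)
      also have "\<dots> = 1 / real n - 1 / real (Suc n)"
      proof -
        have n1: "real n > 0" using n by simp
        have "real n / ((real n)\<^sup>2 * real (Suc n)) = 1 / (real n * real (Suc n))"
          using n1 by (simp add: power2_eq_square del: of_nat_Suc)
        also have "\<dots> = 1 / real n - 1 / real (Suc n)" using n1 by (simp add: diff_frac_eq)
        finally show ?thesis .
      qed
      finally show "norm (S n * (1 / of_nat n - 1 / of_nat (Suc n)) - S n / (of_nat n)\<^sup>2) \<le> 1 / real n - 1 / real (Suc n)" .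
    qed
    also have "\<dots> \<le> 1"
    proof -
      have "(\<Sum>n=2..N. 1 / real n - 1 / real (Suc n)) = 1 / 2 - 1 / real (Suc N)"
        using sum_Suc_diff[of 2 "N" "\<lambda>n. - (1 / real n)"] N by simp
      moreover have "1 / real (Suc N) \<ge> 0" by simp
      ultimately show ?thesis by linarith
    qed
    finally have "norm (\<Sum>n=2..N. S n * (1 / of_nat n - 1 / of_nat (Suc n)) - S n / (of_nat n)\<^sup>2) \<le> 1" .
    moreover have "norm (S 1 * (1 - 1 / 2)) \<le> 1" using S_norm[of 1] by (simp add: norm_mult)
    moreover have "norm (S N / of_nat (Suc N)) \<le> 1"
      using S_norm[of N] by (simp add: norm_divide divide_le_eq del: of_nat_Suc)
    ultimately show ?thesis unfolding B_eq by (smt (verit) norm_triangle_ineq)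
  qed
  hence "log_small B" by (rule log_small_bounded)
  from log_small_add[OF log_small_sum[OF F] this] have E: "log_small (\<lambda>N. T N - \<tau> * V N)"
    by (simp add: B_def)
  \<comment> \<open>By definition \<open>V\<close> grows by T n / (n ln n), and T = \<tau> V + E
    with \<open>E\<close> already of size o(ln N).\<close>
  have V: "log_small V"
    by (rule log_small_recurrence[OF \<tau> E]) (simp add: V_def)
  have "log_small T" using log_small_add[OF E log_small_cmult[OF V, of \<tau>]] by simp
  from log_small_add[OF F log_small_cmult[OF this, of \<tau>]]
  have SL: "log_small (\<lambda>N. S N * of_real (ln (real N)) / of_nat N)" by (simp add: F_def)
  show ?thesis
  proof (rule LIMSEQ_I)
    fix r :: real assume "r > 0"
    hence "r / 2 > 0" by simp
    then obtain C where C: "\<And>N. N \<ge> 2 \<Longrightarrow> norm (S N * of_real (ln (real N)) / of_nat N) \<le> r / 2 * ln (real N) + C"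
      using log_smallD[OF SL] by metis
    have "eventually (\<lambda>N. C < r / 2 * ln (real N)) sequentially" using \<open>r > 0\<close> by real_asymp
    then obtain N0 where N0: "\<And>N. N \<ge> N0 \<Longrightarrow> C < r / 2 * ln (real N)" by (auto simp: eventually_at_top_linorder)
    have "norm (S N / of_nat N - 0) < r" if "N \<ge> max N0 2" for N
    proof -
      have ln: "ln (real N) > 0" using that by simp
      have "norm (S N * of_real (ln (real N)) / of_nat N) < r * ln (real N)"
        using C[of N] N0[of N] that by (simp add: field_simps)
      moreover have "norm (S N * of_real (ln (real N)) / of_nat N) = norm (S N / of_nat N) * ln (real N)"
        using ln by (simp add: norm_mult norm_divide)
      ultimately show ?thesis using ln by simp
    qed
    thus "\<exists>no. \<forall>n\<ge>no. norm ((\<Sum>n=1..n. f n) / of_nat n - 0) < r" unfolding S_def by blast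
  qed
qed

end

section \<open>Squarefree numbers coprime to \<open>M\<close>\<close>

lemma coprime_count_asymp:
  assumes M: "M > 1"
  shows "\<bar>real (card {n. n > 0 \<and> n \<le> N \<and> coprime n M}) - real (totient M) / real M * real N\<bar> \<le> 2 * real M"
proof -
  let ?p = "principal_character M"
  have p: "dirichlet_character M ?p" by (rule dirichlet_character_principal)
  have "of_nat (card {n. n > 0 \<and> n \<le> N \<and> coprime n M}) = (\<Sum>j<Suc N. ?p j)"
  proof -
    have "(\<Sum>j<Suc N. ?p j) = of_nat (card ({..<Suc N} \<inter> {n. coprime n M}))"
      unfolding principal_character_def by (subst sum.If_cases) auto
    also have "{..<Suc N} \<inter> {n. coprime n M} = {n. n > 0 \<and> n \<le> N \<and> coprime n M}"
      using M by (auto simp: less_Suc_eq_le intro!: Nat.gr0I)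
    finally show ?thesis ..
  qed
  moreover have "norm ((\<Sum>j<Suc N. ?p j) - of_nat (Suc N div M) * (\<Sum>j<M. ?p j)) \<le> real M"
    using M by (intro periodic_partial_sums character_mod[OF M p] character_norm_le[OF M p]) auto
  ultimately have "norm (of_real (real (card {n. n > 0 \<and> n \<le> N \<and> coprime n M}) - real (Suc N div M) * real (totient M)) :: complex) \<le> real M"
    using sum_principal_character[OF M] by simp
  hence 1: "\<bar>real (card {n. n > 0 \<and> n \<le> N \<and> coprime n M}) - real (Suc N div M) * real (totient M)\<bar> \<le> real M"
    by (simp only: norm_of_real)
  have "real (Suc N) = real (Suc N div M) * real M + real (Suc N mod M)"
    by (metis of_nat_add of_nat_mult div_mult_mod_eq)
  moreover have "real (Suc N mod M) \<le> real M" using M by (simp add: less_imp_le)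
  ultimately have "\<bar>real (Suc N div M) * real M - real N\<bar> \<le> real M" using M by linarith
  hence le: "\<bar>(real (Suc N div M) * real M - real N) * (real (totient M) / real M)\<bar> \<le> real M * 1"
    unfolding abs_mult using M totient_le[of M] by (intro mult_mono) auto
  have eq: "(real (Suc N div M) * real M - real N) * (real (totient M) / real M) =
      real (Suc N div M) * real (totient M) - real (totient M) / real M * real N"
    using M by (simp add: field_simps)
  have "\<bar>x - z\<bar> \<le> 2 * m" if "\<bar>x - y\<bar> \<le> m" "\<bar>y - z\<bar> \<le> m" for x y z m :: real
    using that by linarith
  thus ?thesis using 1 le[unfolded eq mult_1_right] by blast
qed

text \<open>Adjoining q removes the multiples of q from the index set. They are the q k with k in
  the old set, because no prime of P divides q, and they carry the fraction 1 / q^2 of the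
  sum.\<close>

lemma coprime_zeta_two:
  assumes "finite P" "\<And>p. p \<in> P \<Longrightarrow> prime p"
  shows "((\<lambda>k. 1 / (real k)\<^sup>2) has_sum (pi\<^sup>2 / 6 * (\<Prod>p\<in>P. 1 - 1 / (real p)\<^sup>2))) {k. k > 0 \<and> (\<forall>p\<in>P. \<not> p dvd k)}"
  using assms
proof (induction P rule: finite_induct)
  case empty
  have "((\<lambda>n. 1 / (real n + 1)\<^sup>2) has_sum (pi\<^sup>2 / 6)) UNIV"
    using inverse_squares_sums by (intro norm_summable_imp_has_sum) (auto simp: sums_iff add.commute)
  also have "?this \<longleftrightarrow> ((\<lambda>k. 1 / (real k)\<^sup>2) has_sum (pi\<^sup>2 / 6)) {k. k > 0}"
    by (rule has_sum_reindex_bij_witness[where i = "\<lambda>k. k - 1" and j = Suc]) (auto simp: add.commute)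
  finally show ?case by simp
next
  case (insert q P)
  let ?A = "{k. k > 0 \<and> (\<forall>p\<in>P. \<not> p dvd k)}"
  define Z where "Z = pi\<^sup>2 / 6 * (\<Prod>p\<in>P. 1 - 1 / (real p)\<^sup>2)"
  have q: "prime q" "q \<notin> P" and P: "\<And>p. p \<in> P \<Longrightarrow> prime p" using insert by auto
  have IH: "((\<lambda>k. 1 / (real k)\<^sup>2) has_sum Z) ?A" unfolding Z_def using insert by auto
  have "((\<lambda>k. 1 / (real q)\<^sup>2 * (1 / (real k)\<^sup>2)) has_sum (1 / (real q)\<^sup>2 * Z)) ?A"
    by (rule has_sum_cmult_right[OF IH])
  also have "?this \<longleftrightarrow> ((\<lambda>k. 1 / (real k)\<^sup>2) has_sum (1 / (real q)\<^sup>2 * Z)) {k\<in>?A. q dvd k}"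
  proof (rule has_sum_reindex_bij_witness[where i = "\<lambda>k. k div q" and j = "\<lambda>k. q * k"], goal_cases)
    case (2 k)
    have "\<not> p dvd q * k" if "p \<in> P" for p
      using that 2 P[OF that] q primes_dvd_imp_eq[of p q] by (auto simp: prime_dvd_mult_iff)
    thus ?case using 2 q by (auto simp: prime_gt_0_nat)
  next
    case (4 k)
    then obtain m where m: "k = q * m" by auto
    thus ?case using 4 q by (auto simp: prime_gt_0_nat intro!: Nat.gr0I)
  qed (use q in \<open>auto simp: power_mult_distrib prime_gt_0_nat\<close>)
  finally have "((\<lambda>k. 1 / (real k)\<^sup>2) has_sum (Z - 1 / (real q)\<^sup>2 * Z)) (?A - {k\<in>?A. q dvd k})"
    by (intro has_sum_Diff IH) auto
  also have "?A - {k\<in>?A. q dvd k} = {k. k > 0 \<and> (\<forall>p\<in>insert q P. \<not> p dvd k)}" by auto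
  also have "Z - 1 / (real q)\<^sup>2 * Z = pi\<^sup>2 / 6 * (\<Prod>p\<in>insert q P. 1 - 1 / (real p)\<^sup>2)"
    using insert.hyps by (simp add: Z_def algebra_simps)
  finally show ?case .
qed

section \<open>Counting squarefree integers coprime to M\<close>

lemma coprime_iff_primes:
  fixes k M :: nat
  shows "coprime k M \<longleftrightarrow> (\<forall>p. prime p \<and> p dvd M \<longrightarrow> \<not> p dvd k)"
proof
  assume "coprime k M"
  thus "\<forall>p. prime p \<and> p dvd M \<longrightarrow> \<not> p dvd k"
    using coprime_common_divisor not_prime_unit by blast
next
  assume *: "\<forall>p. prime p \<and> p dvd M \<longrightarrow> \<not> p dvd k"
  show "coprime k M"
  proof (rule ccontr)
    assume "\<not> coprime k M"
    hence "gcd k M \<noteq> 1" by (metis coprime_iff_gcd_eq_1)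
    then obtain p where "prime p" "p dvd gcd k M" using prime_factor_nat by blast
    thus False using * by auto
  qed
qed

definition sqf_count :: "nat \<Rightarrow> nat \<Rightarrow> nat" where
  "sqf_count M N = card {n. n \<le> N \<and> squarefree n \<and> coprime n M}"

text \<open>At each prime the exponents of \<open>a\<close> and \<open>b\<close> are 0 or 1, so they
  are determined by parity, and the exponents of \<open>k\<close> and \<open>l\<close>
  agree.\<close>

lemma squarefree_square_unique:
  fixes a b k l :: nat
  assumes "squarefree a" "squarefree b" "a * k\<^sup>2 = b * l\<^sup>2" "k > 0" "l > 0"
  shows "k = l"
proof -
  have *: "multiplicity p k = multiplicity p l" if p: "prime p" for p
  proof -
    have nz: "a \<noteq> 0" "b \<noteq> 0"
      using assms(1,2) not_squarefree_0[where 'a = nat] by metis+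
    have "multiplicity p a + 2 * multiplicity p k = multiplicity p b + 2 * multiplicity p l"
      using arg_cong[OF assms(3), of "multiplicity p"] nz assms(4,5) p
      by (simp add: prime_elem_multiplicity_mult_distrib prime_elem_multiplicity_power_distrib)
    moreover have "multiplicity p x \<le> 1" if "squarefree x" for x
    proof (rule ccontr)
      assume "\<not> multiplicity p x \<le> 1"
      hence "p\<^sup>2 dvd x" by (intro multiplicity_dvd') auto
      thus False using squarefreeD[OF that] p not_prime_unit by blast
    qed
    hence "multiplicity p a \<le> 1" "multiplicity p b \<le> 1" using assms(1,2) by blast+
    ultimately show ?thesis by presburger
  qed
  show ?thesis
    by (rule multiplicity_eq_nat[OF assms(4,5) *])
qed

text \<open>Every positive n is b k^2 for exactly one squarefree b and one k > 0, and n is coprime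
  to M exactly when both are.\<close>

lemma coprime_count_sqf:
  "card {n. n > 0 \<and> n \<le> N \<and> coprime n M} = (\<Sum>k | k > 0 \<and> k \<le> N \<and> coprime k M. sqf_count M (N div k\<^sup>2))"
proof -
  let ?K = "{k. k > 0 \<and> k \<le> N \<and> coprime k M}"
  let ?B = "\<lambda>k. {n. n \<le> N div k\<^sup>2 \<and> squarefree n \<and> coprime n M}"
  have "{n. n > 0 \<and> n \<le> N \<and> coprime n M} = (\<lambda>(k, b). b * k\<^sup>2) ` (Sigma ?K ?B)"
  proof safe
    fix n assume n: "n > 0" "n \<le> N" "coprime n M"
    define k b where "k = square_part n" and "b = squarefree_part n"
    have eq: "n = b * k\<^sup>2" unfolding k_def b_def by (rule squarefree_decompose)
    have kb: "k > 0" "b > 0" using eq n by (auto intro!: Nat.gr0I)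
    have "squarefree b" unfolding b_def by (rule squarefree_squarefree_part)
    moreover have "coprime k M" "coprime b M" using n(3) eq by (auto simp: coprime_mult_left_iff)
    moreover have "k \<le> k\<^sup>2" using kb by (simp add: power2_eq_square)
    hence "k \<le> N" using eq n(2) kb by (metis le_trans mult_le_mono1 mult_1 Suc_leI One_nat_def)
    moreover have "b \<le> N div k\<^sup>2" using eq n(2) kb by (simp add: less_eq_div_iff_mult_less_eq)
    ultimately show "n \<in> (\<lambda>(k, b). b * k\<^sup>2) ` (Sigma ?K ?B)"
      using eq kb by (intro image_eqI[of _ _ "(k, b)"]) auto
  next
    fix k b assume kb: "k > 0" "k \<le> N" "coprime k M" "b \<le> N div k\<^sup>2" "squarefree b" "coprime b M"
    have "b > 0" using kb(5) by (intro Nat.gr0I) auto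
    thus "b * k\<^sup>2 > 0" using kb by simp
    show "b * k\<^sup>2 \<le> N" using kb by (simp add: less_eq_div_iff_mult_less_eq)
    show "coprime (b * k\<^sup>2) M" using kb by simp
  qed
  moreover have "inj_on (\<lambda>(k, b). b * k\<^sup>2) (Sigma ?K ?B)"
  proof (rule inj_onI, safe)
    fix k b k' b' :: nat assume *: "k > 0" "k' > 0" "squarefree b" "squarefree b'" "b * k\<^sup>2 = b' * k'\<^sup>2"
    from squarefree_square_unique[OF *(3,4,5,1,2)] show "k = k'" .
    thus "b = b'" using * by simp
  qed
  ultimately have "card {n. n > 0 \<and> n \<le> N \<and> coprime n M} = card (Sigma ?K ?B)"
    using card_image[of "\<lambda>(k, b). b * k\<^sup>2" "Sigma ?K ?B"] by (simp only:)
  also have "\<dots> = (\<Sum>k\<in>?K. sqf_count M (N div k\<^sup>2))"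
    unfolding sqf_count_def by (rule card_SigmaI) auto
  finally show ?thesis .
qed


text \<open>Instead of inverting the relation in \<open>coprime_count_sqf\<close>, its expected
  solution \<beta> N is inserted, which satisfies it up to o(N). The error \<open>E N\<close> is
  then o(N) minus the sum of E (N div k^2) over k \<ge> 2, and iterating this inequality drives E N
  / N to 0.\<close>

theorem sqf_count_asymp:
  assumes M: "M > 1"
  shows "(\<lambda>N. real (sqf_count M N) / real N) \<longlonglongrightarrow> 6 / (pi\<^sup>2 * (\<Prod>p | prime p \<and> p dvd M. 1 + 1 / real p))"
proof -
  define P where "P = {p. prime p \<and> p dvd M}"
  have P: "finite P" "\<And>p. p \<in> P \<Longrightarrow> prime p" "P = prime_factors M"
    using M by (auto simp: P_def prime_factors_dvd)
  define \<zeta> where "\<zeta> = pi\<^sup>2 / 6 * (\<Prod>p\<in>P. 1 - 1 / (real p)\<^sup>2)"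
  define \<alpha> where "\<alpha> = real (totient M) / real M"
  define \<beta> where "\<beta> = 6 / (pi\<^sup>2 * (\<Prod>p\<in>P. 1 + 1 / real p))"
  define A where "A = {k. k > 0 \<and> coprime k M}"
  \<comment> \<open>Prime by prime, 1 - 1/p^2 = (1 - 1/p)(1 + 1/p). This identity fixes the value of
    \<beta>.\<close>
  have \<alpha>: "\<alpha> = \<beta> * \<zeta>"
  proof -
    have "\<alpha> = (\<Prod>p\<in>P. 1 - 1 / real p)" using totient_formula2[of M] M by (simp add: \<alpha>_def P)
    moreover have "(\<Prod>p\<in>P. 1 - 1 / (real p)\<^sup>2) = (\<Prod>p\<in>P. 1 - 1 / real p) * (\<Prod>p\<in>P. 1 + 1 / real p)"
      unfolding prod.distrib[symmetric] by (intro prod.cong refl) (simp add: algebra_simps power2_eq_square)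
    moreover have "(\<Prod>p\<in>P. 1 + 1 / real p) > 0" by (intro prod_pos) (auto intro: add_pos_nonneg)
    ultimately show ?thesis by (simp add: \<beta>_def \<zeta>_def)
  qed
  have \<beta>: "\<beta> \<ge> 0" unfolding \<beta>_def by (intro divide_nonneg_nonneg mult_nonneg_nonneg prod_nonneg) auto
  have "A = {k. k > 0 \<and> (\<forall>p\<in>P. \<not> p dvd k)}" by (auto simp: A_def P_def coprime_iff_primes)
  hence hs: "((\<lambda>k. 1 / (real k)\<^sup>2) has_sum \<zeta>) A"
    using coprime_zeta_two[OF P(1,2)] by (simp add: \<zeta>_def)
  define K where "K = (\<lambda>N. {k\<in>A. k \<le> N})"
  have K: "finite (K N)" "K N \<subseteq> A" for N by (auto simp: K_def)
  have div_zero: "N div k\<^sup>2 = 0" if "k > N" for k N :: nat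
  proof -
    have "k * 1 \<le> k * k" using that by (intro mult_left_mono) auto
    hence "N < k * k" using that by linarith
    thus ?thesis by (simp add: power2_eq_square)
  qed
  have zeta_approx: "\<exists>C. \<forall>N. \<bar>\<zeta> * real N - (\<Sum>k\<in>K N. real (N div k\<^sup>2))\<bar> \<le> \<delta> * real N + C" if "\<delta> > 0" for \<delta>
  proof -
    obtain F where F: "finite F" "F \<subseteq> A" "dist (\<Sum>k\<in>F. 1 / (real k)\<^sup>2) \<zeta> \<le> \<delta>"
      using has_sum_finite_approximation[OF hs \<open>\<delta> > 0\<close>] by auto
    have "\<bar>\<zeta> * real N - (\<Sum>k\<in>K N. real (N div k\<^sup>2))\<bar> \<le> \<delta> * real N + real (card F)" for N
    proof -
      have "(\<Sum>k\<in>K N. real (N div k\<^sup>2)) \<le> (\<Sum>k\<in>K N. 1 / (real k)\<^sup>2 * real N)"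
        using of_nat_div_le_of_nat[of N "_\<^sup>2", where 'a = real] by (intro sum_mono) simp
      also have "\<dots> = (\<Sum>k\<in>K N. 1 / (real k)\<^sup>2) * real N" by (simp add: sum_distrib_right)
      also have "\<dots> \<le> \<zeta> * real N"
        using K by (intro mult_right_mono has_sum_mono_neutral[OF has_sum_finite hs]) auto
      finally have upper: "(\<Sum>k\<in>K N. real (N div k\<^sup>2)) \<le> \<zeta> * real N" .
      have "(\<zeta> - \<delta>) * real N \<le> (\<Sum>k\<in>F. 1 / (real k)\<^sup>2) * real N"
        using F(3) by (intro mult_right_mono) (auto simp: dist_real_def)
      also have "\<dots> = (\<Sum>k\<in>F. real N / real (k\<^sup>2))" by (simp add: sum_distrib_right)
      also have "\<dots> \<le> (\<Sum>k\<in>F. real (N div k\<^sup>2) + 1)"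
      proof (rule sum_mono)
        fix k assume "k \<in> F"
        hence k: "k\<^sup>2 > 0" using F by (auto simp: A_def)
        have "real N = real (k\<^sup>2) * real (N div k\<^sup>2) + real (N mod k\<^sup>2)"
          by (metis of_nat_add of_nat_mult mult_div_mod_eq)
        moreover have "real (N mod k\<^sup>2) \<le> real (k\<^sup>2)" using k by (simp add: less_imp_le del: of_nat_power)
        ultimately have "real N \<le> (real (N div k\<^sup>2) + 1) * real (k\<^sup>2)" by (simp add: algebra_simps)
        thus "real N / real (k\<^sup>2) \<le> real (N div k\<^sup>2) + 1" using k by (simp add: divide_le_eq del: of_nat_power)
      qed
      also have "\<dots> = (\<Sum>k\<in>F. real (N div k\<^sup>2)) + real (card F)" by (simp add: sum.distrib)
      also have "(\<Sum>k\<in>F. real (N div k\<^sup>2)) \<le> (\<Sum>k\<in>F \<union> K N. real (N div k\<^sup>2))"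
        using F K by (intro sum_mono2) auto
      also have "\<dots> = (\<Sum>k\<in>K N. real (N div k\<^sup>2))"
      proof (intro sum.mono_neutral_right ballI)
        fix k assume "k \<in> F \<union> K N - K N"
        hence "k > N" using F(2) by (auto simp: K_def)
        thus "real (N div k\<^sup>2) = 0" by (simp add: div_zero)
      qed (use F K in auto)
      finally show ?thesis using upper by (simp add: algebra_simps abs_le_iff)
    qed
    thus ?thesis by blast
  qed
  define E where "E = (\<lambda>N. real (sqf_count M N) - \<beta> * real N)"
  have E0: "E 0 = 0" 
  proof -
    have "{n. n \<le> 0 \<and> squarefree n \<and> coprime n M} = {}" using not_squarefree_0[where 'a = nat] by auto
    thus ?thesis unfolding E_def sqf_count_def by (simp only: card.empty)
  qed
  have E_rec: "E N = (real (card (K N)) - \<alpha> * real N) + \<beta> * (\<zeta> * real N - (\<Sum>k\<in>K N. real (N div k\<^sup>2)))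
      - (\<Sum>k\<in>K N - {1}. E (N div k\<^sup>2))" if "N \<ge> 1" for N
  proof -
    have K_eq: "K N = {k. k > 0 \<and> k \<le> N \<and> coprime k M}" by (auto simp: K_def A_def)
    have "real (card (K N)) = (\<Sum>k\<in>K N. real (sqf_count M (N div k\<^sup>2)))"
      using coprime_count_sqf[of N M] unfolding K_eq by (simp flip: of_nat_sum)
    also have "\<dots> = (\<Sum>k\<in>K N. E (N div k\<^sup>2)) + \<beta> * (\<Sum>k\<in>K N. real (N div k\<^sup>2))"
      by (simp add: E_def sum_subtractf sum_distrib_left)
    also have "(\<Sum>k\<in>K N. E (N div k\<^sup>2)) = E N + (\<Sum>k\<in>K N - {1}. E (N div k\<^sup>2))"
      using that K by (subst sum.remove[of _ 1]) (auto simp: K_eq)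
    finally show ?thesis by (simp add: \<alpha> algebra_simps)
  qed
  define good where "good = (\<lambda>e. \<exists>C. \<forall>N. \<bar>E N\<bar> \<le> e * real N + C)"
  have zeta_lt: "pi\<^sup>2 / 6 - 1 \<le> 65 / 100"
  proof -
    have "pi\<^sup>2 \<le> 3.1416\<^sup>2" using pi_approx(2) pi_gt_zero by (intro power_mono) auto
    thus ?thesis by (simp add: power2_eq_square)
  qed
  \<comment> \<open>the recursion contracts because \<open>\<Sum>\<^bsub>k \<ge> 2\<^esub> 1 / k\<^sup>2 = \<pi>\<^sup>2 / 6 - 1 < 1\<close>\<close>
  have step: "good (7 / 10 * e)" if "good e" "e > 0" for e
  proof -
    obtain C where C: "\<And>N. \<bar>E N\<bar> \<le> e * real N + C" using \<open>good e\<close> unfolding good_def by blast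
    have C0: "C \<ge> 0" using C[of 0] E0 by simp
    \<comment> \<open>Two error terms of size \<delta> N are met, and 65/100 + 2/40 = 7/10.\<close>
    define \<delta> where "\<delta> = e / 40"
    have \<delta>: "\<delta> > 0" using \<open>e > 0\<close> by (simp add: \<delta>_def)
    hence "\<delta> / (\<beta> + 1) > 0" using \<beta> by simp
    then obtain C1 where C1: "\<And>N. \<bar>\<zeta> * real N - (\<Sum>k\<in>K N. real (N div k\<^sup>2))\<bar> \<le> \<delta> / (\<beta> + 1) * real N + C1"
      using zeta_approx by blast
    have C1': "C1 \<ge> 0" using C1[of 0] by simp
    have "eventually (\<lambda>N. C * sqrt (real N) \<le> \<delta> * real N) sequentially"
      using \<delta> by real_asymp
    then obtain N0 where N0: "\<And>N. N \<ge> N0 \<Longrightarrow> C * sqrt (real N) \<le> \<delta> * real N"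
      by (auto simp: eventually_at_top_linorder)
    have sq: "C * sqrt (real N) \<le> \<delta> * real N + C * sqrt (real N0)" for N
    proof (cases "N \<ge> N0")
      case True
      thus ?thesis using N0[of N] C0 by (simp add: add_increasing2)
    next
      case False
      hence "C * sqrt (real N) \<le> C * sqrt (real N0)" using C0 by (intro mult_left_mono) auto
      thus ?thesis using \<delta> by (simp add: add_increasing)
    qed
    have "\<bar>E N\<bar> \<le> 7 / 10 * e * real N + (2 * real M + \<beta> * C1 + C * sqrt (real N0))" for N
    proof (cases "N = 0")
      case True
      thus ?thesis using E0 C0 C1' \<beta> by simp
    next
      case False
      hence N: "N \<ge> 1" by simp
      have e1: "\<bar>real (card (K N)) - \<alpha> * real N\<bar> \<le> 2 * real M"
        using coprime_count_asymp[OF M, of N] by (simp add: K_def A_def \<alpha>_def conj_ac)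
      have e2: "\<bar>\<beta> * (\<zeta> * real N - (\<Sum>k\<in>K N. real (N div k\<^sup>2)))\<bar> \<le> \<delta> * real N + \<beta> * C1"
      proof -
        have "\<bar>\<beta> * (\<zeta> * real N - (\<Sum>k\<in>K N. real (N div k\<^sup>2)))\<bar> \<le> \<beta> * (\<delta> / (\<beta> + 1) * real N + C1)"
          using C1[of N] \<beta> by (simp only: abs_mult abs_of_nonneg) (intro mult_left_mono)
        also have "\<dots> = (\<beta> / (\<beta> + 1)) * (\<delta> * real N) + \<beta> * C1" by (simp add: algebra_simps)
        also have "\<dots> \<le> 1 * (\<delta> * real N) + \<beta> * C1"
          using \<beta> \<delta> by (intro add_right_mono mult_right_mono) auto
        finally show ?thesis by simp
      qed
      have e3: "\<bar>\<Sum>k\<in>K N - {1}. E (N div k\<^sup>2)\<bar> \<le> 65 / 100 * e * real N + C * sqrt (real N)"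
      proof -
        \<comment> \<open>For k > R the quotient N div k^2 is 0 and E 0 = 0, so the additive
          constant \<open>C\<close> is incurred at most sqrt N times, which is o(N).\<close>
        define R where "R = nat \<lfloor>sqrt (real N)\<rfloor>"
        have R: "real R \<le> sqrt (real N)" unfolding R_def by simp
        have zero: "N div k\<^sup>2 = 0" if "k > R" for k
        proof -
          have "sqrt (real N) < real k" using that unfolding R_def by linarith
          hence "(sqrt (real N))\<^sup>2 < (real k)\<^sup>2" by (intro power_strict_mono) auto
          hence "real N < real (k\<^sup>2)" by simp
          hence "N < k\<^sup>2" by (simp only: of_nat_less_iff)
          thus ?thesis by simp
        qed
        have "\<bar>\<Sum>k\<in>K N - {1}. E (N div k\<^sup>2)\<bar> \<le> (\<Sum>k\<in>K N - {1}. \<bar>E (N div k\<^sup>2)\<bar>)" by (rule sum_abs)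
        also have "\<dots> \<le> (\<Sum>k\<in>K N - {1}. if k \<le> R then e * (1 / (real k)\<^sup>2) * real N + C else 0)"
        proof (rule sum_mono)
          fix k assume k: "k \<in> K N - {1}"
          show "\<bar>E (N div k\<^sup>2)\<bar> \<le> (if k \<le> R then e * (1 / (real k)\<^sup>2) * real N + C else 0)"
          proof (cases "k \<le> R")
            case True
            have "real (N div k\<^sup>2) \<le> 1 / (real k)\<^sup>2 * real N"
              using of_nat_div_le_of_nat[of N "k\<^sup>2", where 'a = real] by simp
            hence "e * real (N div k\<^sup>2) \<le> e * (1 / (real k)\<^sup>2 * real N)" using \<open>e > 0\<close> by (intro mult_left_mono) auto
            thus ?thesis using True C[of "N div k\<^sup>2"] by simp
          qed (use zero E0 in auto)
        qed
        also have "\<dots> \<le> (\<Sum>k\<in>{2..R}. e * (1 / (real k)\<^sup>2) * real N + C)"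
        proof -
          have "(\<Sum>k\<in>K N - {1}. if k \<le> R then e * (1 / (real k)\<^sup>2) * real N + C else 0) =
              (\<Sum>k\<in>{k \<in> K N - {1}. k \<le> R}. e * (1 / (real k)\<^sup>2) * real N + C)"
            using K by (intro sum.inter_filter[symmetric]) auto
          also have "\<dots> \<le> (\<Sum>k\<in>{2..R}. e * (1 / (real k)\<^sup>2) * real N + C)"
            using \<open>e > 0\<close> C0 by (intro sum_mono2) (auto simp: K_def A_def)
          finally show ?thesis .
        qed
        also have "\<dots> = e * real N * (\<Sum>k\<in>{2..R}. 1 / (real k)\<^sup>2) + real (card {2..R}) * C"
          by (simp add: sum.distrib sum_distrib_left mult_ac)
        also have "\<dots> \<le> e * real N * (65 / 100) + sqrt (real N) * C"
        proof (intro add_mono mult_left_mono mult_right_mono)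
          have sq: "(\<lambda>n. 1 / (real n + 2)\<^sup>2) sums (pi\<^sup>2 / 6 - 1)"
            using sums_split_initial_segment[OF inverse_squares_sums, of 1] by (simp add: add_ac)
          have "(\<Sum>k\<in>{2..R}. 1 / (real k)\<^sup>2) = (\<Sum>n<R - 1. 1 / (real n + 2)\<^sup>2)"
            by (rule sum.reindex_bij_witness[of _ "\<lambda>n. n + 2" "\<lambda>k. k - 2"]) auto
          also have "\<dots> \<le> (\<Sum>n. 1 / (real n + 2)\<^sup>2)"
            using sq by (intro sum_le_suminf) (auto simp: sums_iff)
          also have "\<dots> = pi\<^sup>2 / 6 - 1" using sq by (simp add: sums_iff)
          finally show "(\<Sum>k\<in>{2..R}. 1 / (real k)\<^sup>2) \<le> 65 / 100" using zeta_lt by linarith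
          have "real (card {2..R}) \<le> real R" by simp
          thus "real (card {2..R}) \<le> sqrt (real N)" using R by linarith
        qed (use \<open>e > 0\<close> C0 in auto)
        finally show ?thesis by (simp add: mult_ac)
      qed
      have "\<bar>E N\<bar> \<le> 2 * real M + (\<delta> * real N + \<beta> * C1) + (65 / 100 * e * real N + (\<delta> * real N + C * sqrt (real N0)))"
        unfolding E_rec[OF N] using e1 e2 e3 sq[of N] by linarith
      also have "\<dots> = 7 / 10 * e * real N + (2 * real M + \<beta> * C1 + C * sqrt (real N0))"
        by (simp add: \<delta>_def algebra_simps)
      finally show ?thesis .
    qed
    thus ?thesis unfolding good_def by blast
  qed
  have "good ((7 / 10) ^ j * (1 + \<beta>))" for j
  proof (induction j)
    case 0
    have "\<bar>E N\<bar> \<le> (1 + \<beta>) * real N + 1" for N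
    proof -
      have "sqf_count M N \<le> card {..N}" unfolding sqf_count_def by (intro card_mono) auto
      hence "real (sqf_count M N) \<le> real N + 1" by simp
      moreover have "\<beta> * real N \<ge> 0" using \<beta> by simp
      ultimately show ?thesis unfolding E_def by (simp add: algebra_simps abs_le_iff)
    qed
    thus ?case unfolding good_def by auto
  next
    case (Suc j)
    thus ?case using step[of "(7 / 10) ^ j * (1 + \<beta>)"] \<beta> by (simp add: mult.assoc add_pos_nonneg)
  qed
  note good_pow = this
  have "(\<lambda>N. E N / real N) \<longlonglongrightarrow> 0"
  proof (rule LIMSEQ_I)
    fix r :: real assume "r > 0"
    have "(\<lambda>j. (7 / 10) ^ j * (1 + \<beta>)) \<longlonglongrightarrow> 0 * (1 + \<beta>)" by (intro tendsto_intros LIMSEQ_realpow_zero) auto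
    hence "eventually (\<lambda>j. (7 / 10) ^ j * (1 + \<beta>) < r / 2) sequentially"
      using \<open>r > 0\<close> by (intro order_tendstoD(2)) auto
    then obtain j where j: "(7 / 10) ^ j * (1 + \<beta>) < r / 2" by (auto simp: eventually_at_top_linorder)
    obtain C where C: "\<And>N. \<bar>E N\<bar> \<le> (7 / 10) ^ j * (1 + \<beta>) * real N + C" using good_pow[of j] unfolding good_def by blast
    have "eventually (\<lambda>N. C < r / 2 * real N) sequentially" using \<open>r > 0\<close> by real_asymp
    then obtain N0 where N0: "\<And>N. N \<ge> N0 \<Longrightarrow> C < r / 2 * real N" by (auto simp: eventually_at_top_linorder)
    have "norm (E N / real N - 0) < r" if "N \<ge> max N0 1" for N
    proof -
      have "(7 / 10) ^ j * (1 + \<beta>) * real N \<le> r / 2 * real N" using j by (intro mult_right_mono) auto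
      moreover have "C < r / 2 * real N" using N0 that by simp
      moreover have "r / 2 * real N + r / 2 * real N = r * real N" by simp
      ultimately have "\<bar>E N\<bar> < r * real N" using C[of N] by linarith
      thus ?thesis using that by (simp add: abs_divide divide_less_eq)
    qed
    thus "\<exists>no. \<forall>n\<ge>no. norm (E n / real n - 0) < r" by blast
  qed
  hence "(\<lambda>N. E N / real N + \<beta>) \<longlonglongrightarrow> 0 + \<beta>" by (intro tendsto_intros)
  moreover have "eventually (\<lambda>N. E N / real N + \<beta> = real (sqf_count M N) / real N) sequentially"
    using eventually_gt_at_top[of 0] by eventually_elim (simp add: E_def field_simps)
  ultimately have "(\<lambda>N. real (sqf_count M N) / real N) \<longlonglongrightarrow> \<beta>" by (auto elim: Lim_transform_eventually)
  thus ?thesis by (simp add: \<beta>_def P_def)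
qed

section \<open>Detecting residues by roots of unity\<close>

lemma cis_2pi_fraction_eq_1_iff:
  fixes m :: int and l :: nat
  assumes l: "l > 0"
  shows "cis (2 * pi * real_of_int m / real l) = 1 \<longleftrightarrow> int l dvd m"
proof
  assume "int l dvd m"
  then obtain q where "m = int l * q" by auto
  hence "2 * pi * real_of_int m / real l = 2 * pi * real_of_int q" using l by simp
  moreover have "cis (2 * pi * real_of_int q) = 1" by (rule cis_multiple_2pi) simp
  ultimately show "cis (2 * pi * real_of_int m / real l) = 1" by simp
next
  assume "cis (2 * pi * real_of_int m / real l) = 1"
  hence "cos (2 * pi * real_of_int m / real l) = 1" by (simp add: complex_eq_iff)
  then obtain j :: int where "2 * pi * real_of_int m / real l = real_of_int j * 2 * pi"
    by (auto simp: cos_one_2pi_int)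
  hence "real_of_int m = real_of_int (j * int l)" using l by (simp add: field_simps)
  hence "m = j * int l" by (simp only: of_int_eq_iff)
  thus "int l dvd m" by simp
qed

lemma sum_roots_of_unity:
  fixes m :: int and l :: nat
  assumes l: "l > 0"
  shows "(\<Sum>c<l. cis (2 * pi * real_of_int m / real l) ^ c) = (if int l dvd m then of_nat l else 0)"
proof -
  define w where "w = cis (2 * pi * real_of_int m / real l)"
  show ?thesis
  proof (cases "int l dvd m")
    case True
    hence "w = 1" using cis_2pi_fraction_eq_1_iff[OF l] by (simp add: w_def)
    thus ?thesis using True by (simp flip: w_def)
  next
    case False
    hence "w \<noteq> 1" using cis_2pi_fraction_eq_1_iff[OF l] by (simp add: w_def)
    moreover have "w ^ l = 1"
    proof -
      have "w ^ l = cis (2 * pi * real_of_int m)" unfolding w_def Complex.DeMoivre using l by simp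
      also have "\<dots> = 1" by (rule cis_multiple_2pi) simp
      finally show ?thesis .
    qed
    moreover have "1 - w ^ l = (1 - w) * (\<Sum>c<l. w ^ c)" by (rule one_diff_power_eq)
    ultimately have "(\<Sum>c<l. w ^ c) = 0" by simp
    thus ?thesis using False by (simp flip: w_def)
  qed
qed

section \<open>The multiplicative functions attached to tuples of roots of unity\<close>

locale unit_representatives =
  fixes M :: nat and r :: "nat \<Rightarrow> int"
  assumes M: "M > 1" and reps: "unit_reps M r"
begin

definition idx :: "nat \<Rightarrow> nat" where
  "idx n = (THE i. i \<in> {1..totient M} \<and> [int n = r i] (mod int M))"

lemma idx:
  assumes "coprime n M"
  shows "idx n \<in> {1..totient M}" "[int n = r (idx n)] (mod int M)"
proof -
  have "\<exists>!i. i \<in> {1..totient M} \<and> [int n = r i] (mod int M)"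
    using reps assms unfolding unit_reps_def by simp
  from theI'[OF this] show "idx n \<in> {1..totient M}" "[int n = r (idx n)] (mod int M)"
    unfolding idx_def by auto
qed

lemma rep_coprime:
  assumes "i \<in> {1..totient M}" "[int n = r i] (mod int M)"
  shows "coprime n M"
proof -
  have "coprime (r i) (int M)" using reps assms(1) unfolding unit_reps_def by blast
  hence "coprime (int n) (int M)" using cong_imp_coprime[OF cong_sym[OF assms(2)]] by blast
  thus ?thesis by simp
qed

lemma idx_unique:
  assumes "i \<in> {1..totient M}" "[int n = r i] (mod int M)"
  shows "idx n = i"
proof -
  have c: "coprime n M" by (rule rep_coprime[OF assms])
  hence "\<exists>!i. i \<in> {1..totient M} \<and> [int n = r i] (mod int M)"
    using reps unfolding unit_reps_def by simp
  thus ?thesis using idx[OF c] assms by blast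
qed

definition weight :: "(nat \<Rightarrow> complex) \<Rightarrow> nat \<Rightarrow> complex" where
  "weight \<zeta> n = (if coprime n M then \<zeta> (idx n) else 0)"

definition twist :: "(nat \<Rightarrow> complex) \<Rightarrow> nat \<Rightarrow> complex" where
  "twist \<zeta> N = (if squarefree N \<and> coprime N M then \<Prod>i\<in>{1..totient M}. \<zeta> i ^ num_prime_divs M r i N else 0)"

lemma num_prime_divs_mult_prime:
  assumes "prime p" "\<not> p dvd k" "coprime p M" and i: "i \<in> {1..totient M}"
  shows "num_prime_divs M r i (p * k) = num_prime_divs M r i k + (if i = idx p then 1 else 0)"
proof -
  let ?S = "{q. prime q \<and> q dvd k \<and> [int q = r i] (mod int M)}"
  have k: "k > 0" using assms(2) by (auto intro!: Nat.gr0I)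
  have fin: "finite ?S" using k by (intro finite_subset[OF _ finite_divisors_nat[OF k]]) auto
  have dv: "q dvd p * k \<longleftrightarrow> q = p \<or> q dvd k" if "prime q" for q
    using that assms(1) by (auto simp: prime_dvd_mult_iff primes_dvd_imp_eq)
  show ?thesis
  proof (cases "i = idx p")
    case True
    have "{q. prime q \<and> q dvd p * k \<and> [int q = r i] (mod int M)} = insert p ?S"
      using True idx(2)[OF assms(3)] dv assms(1) by auto
    moreover have "p \<notin> ?S" using assms(2) by simp
    ultimately show ?thesis using True fin unfolding num_prime_divs_def by simp
  next
    case False
    hence "\<not> [int p = r i] (mod int M)" using idx_unique[OF i] by blast
    hence "{q. prime q \<and> q dvd p * k \<and> [int q = r i] (mod int M)} = ?S" using dv by auto
    thus ?thesis using False unfolding num_prime_divs_def by simp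
  qed
qed

lemma twist_squarefree_multiplicative:
  assumes \<zeta>: "\<And>i. i \<in> {1..totient M} \<Longrightarrow> norm (\<zeta> i) = 1"
  shows "squarefree_multiplicative (twist \<zeta>) (weight \<zeta>)"
proof
  fix p k :: nat assume p: "prime p" and pk: "\<not> p dvd k"
  have cop: "coprime p k" using p pk by (rule prime_imp_coprime)
  have sq: "squarefree (p * k) \<longleftrightarrow> squarefree k"
    using squarefree_mult_coprime[OF cop squarefree_prime[OF p]] squarefree_mono[of k "p * k"] by auto
  show "twist \<zeta> (p * k) = weight \<zeta> p * twist \<zeta> k"
  proof (cases "coprime p M \<and> squarefree k \<and> coprime k M")
    case False
    thus ?thesis using sq by (auto simp: twist_def weight_def)
  next
    case True
    have "(\<Prod>i\<in>{1..totient M}. \<zeta> i ^ num_prime_divs M r i (p * k)) =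
        (\<Prod>i\<in>{1..totient M}. (if i = idx p then \<zeta> i else 1) * \<zeta> i ^ num_prime_divs M r i k)"
      using num_prime_divs_mult_prime[OF p pk] True by (intro prod.cong refl) auto
    also have "\<dots> = \<zeta> (idx p) * (\<Prod>i\<in>{1..totient M}. \<zeta> i ^ num_prime_divs M r i k)"
      using idx(1)[of p] True by (simp add: prod.distrib prod.delta)
    finally show ?thesis using True sq by (simp add: twist_def weight_def)
  qed
next
  show "\<not> squarefree n \<Longrightarrow> twist \<zeta> n = 0" for n by (simp add: twist_def)
  show "norm (twist \<zeta> n) \<le> 1" for n
    using \<zeta> by (simp add: twist_def prod_norm[symmetric] norm_power)
  show "norm (weight \<zeta> n) \<le> 1" for n
    using \<zeta> idx(1)[of n] by (simp add: weight_def)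
qed

lemma weight_prime_mean:
  "(\<lambda>n. (\<Sum>d=1..n. weight \<zeta> d * mangoldt d) / of_nat n) \<longlonglongrightarrow> (\<Sum>i=1..totient M. \<zeta> i) / of_nat (totient M)"
proof -
  let ?I = "{1..totient M}"
  \<comment> \<open>The prime number theorem above concerns natural residues, while the
    representatives \<open>r i\<close> may be negative integers.\<close>
  define b where "b = (\<lambda>i. nat (r i mod int M))"
  have b: "int (b i) = r i mod int M" for i using M by (simp add: b_def)
  have b_cong: "[k = b i] (mod M) \<longleftrightarrow> [int k = r i] (mod int M)" for k i
    unfolding cong_int_iff[of k "b i", symmetric] b by simp
  have b_cop: "coprime (b i) M" if "i \<in> ?I" for i
    by (rule rep_coprime[OF that]) (simp flip: b_cong)
  define \<psi> :: "nat \<Rightarrow> nat \<Rightarrow> real" where "\<psi> = (\<lambda>i n. \<Sum>k | k \<le> n \<and> [k = b i] (mod M). mangoldt k)"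
  have "(\<lambda>n. \<Sum>i\<in>?I. \<zeta> i * of_real (\<psi> i n / real n)) \<longlonglongrightarrow> (\<Sum>i\<in>?I. \<zeta> i * of_real (1 / real (totient M)))"
    unfolding \<psi>_def by (intro tendsto_intros prime_number_theorem_progression M b_cop)
  also have "(\<Sum>i\<in>?I. \<zeta> i * of_real (1 / real (totient M))) = (\<Sum>i\<in>?I. \<zeta> i) / of_nat (totient M)"
    by (simp add: sum_divide_distrib)
  also have "(\<lambda>n. \<Sum>i\<in>?I. \<zeta> i * of_real (\<psi> i n / real n)) = (\<lambda>n. (\<Sum>d=1..n. weight \<zeta> d * mangoldt d) / of_nat n)"
  proof
    fix n
    have "(\<Sum>d=1..n. weight \<zeta> d * mangoldt d) = (\<Sum>d=1..n. \<Sum>i\<in>?I. if [d = b i] (mod M) then \<zeta> i * mangoldt d else 0)"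
    proof (rule sum.cong[OF refl])
      fix d
      have "(\<Sum>i\<in>?I. if [d = b i] (mod M) then \<zeta> i * mangoldt d else 0) =
          (\<Sum>i\<in>?I. if i = idx d \<and> coprime d M then \<zeta> i * mangoldt d else 0)"
      proof (rule sum.cong[OF refl])
        fix i assume i: "i \<in> ?I"
        have "[d = b i] (mod M) \<longleftrightarrow> i = idx d \<and> coprime d M"
        proof
          assume "[d = b i] (mod M)"
          hence c: "[int d = r i] (mod int M)" by (simp only: b_cong)
          show "i = idx d \<and> coprime d M" using idx_unique[OF i c] rep_coprime[OF i c] by simp
        next
          assume "i = idx d \<and> coprime d M"
          thus "[d = b i] (mod M)" unfolding b_cong using idx(2)[of d] by simp
        qed
        thus "(if [d = b i] (mod M) then \<zeta> i * mangoldt d else 0) =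
            (if i = idx d \<and> coprime d M then \<zeta> i * mangoldt d else 0)" by simp
      qed
      also have "\<dots> = weight \<zeta> d * mangoldt d"
        using idx(1)[of d] by (cases "coprime d M") (simp_all add: weight_def sum.delta)
      finally show "weight \<zeta> d * mangoldt d = (\<Sum>i\<in>?I. if [d = b i] (mod M) then \<zeta> i * mangoldt d else 0)" ..
    qed
    also have "\<dots> = (\<Sum>i\<in>?I. \<Sum>d=1..n. if [d = b i] (mod M) then \<zeta> i * mangoldt d else 0)" by (rule sum.swap)
    also have "\<dots> = (\<Sum>i\<in>?I. \<zeta> i * of_real (\<psi> i n))"
    proof (rule sum.cong[OF refl])
      fix i
      have "of_real (\<psi> i n) = (\<Sum>d | d \<le> n \<and> [d = b i] (mod M). mangoldt d :: complex)"
        unfolding \<psi>_def by simp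
      also have "\<dots> = (\<Sum>d\<in>{d\<in>{1..n}. [d = b i] (mod M)}. mangoldt d)"
      proof (rule sum.mono_neutral_right)
        show "\<forall>d\<in>{d. d \<le> n \<and> [d = b i] (mod M)} - {d\<in>{1..n}. [d = b i] (mod M)}. mangoldt d = (0::complex)"
        proof
          fix d assume "d \<in> {d. d \<le> n \<and> [d = b i] (mod M)} - {d\<in>{1..n}. [d = b i] (mod M)}"
          hence "d = 0" by auto
          thus "mangoldt d = (0::complex)" by simp
        qed
      qed auto
      also have "\<zeta> i * \<dots> = (\<Sum>d\<in>{d\<in>{1..n}. [d = b i] (mod M)}. \<zeta> i * mangoldt d)" by (rule sum_distrib_left)
      also have "\<dots> = (\<Sum>d=1..n. if [d = b i] (mod M) then \<zeta> i * mangoldt d else 0)"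
        by (rule sum.inter_filter) simp
      finally show "(\<Sum>d=1..n. if [d = b i] (mod M) then \<zeta> i * mangoldt d else 0) = \<zeta> i * of_real (\<psi> i n)" ..
    qed
    finally show "(\<Sum>i\<in>?I. \<zeta> i * of_real (\<psi> i n / real n)) = (\<Sum>d=1..n. weight \<zeta> d * mangoldt d) / of_nat n"
      by (simp add: sum_divide_distrib)
  qed
  finally show ?thesis .
qed

text \<open>On the unit circle only the point 1 has real part 1, so a single \<zeta> j \<noteq> 1
  makes the mean of the real parts strictly less than 1.\<close>

theorem twist_mean_zero:
  assumes \<zeta>: "\<And>i. i \<in> {1..totient M} \<Longrightarrow> norm (\<zeta> i) = 1" and j: "j \<in> {1..totient M}" "\<zeta> j \<noteq> 1"
  shows "(\<lambda>N. (\<Sum>n=1..N. twist \<zeta> n) / of_nat N) \<longlonglongrightarrow> 0"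
proof -
  interpret squarefree_multiplicative "twist \<zeta>" "weight \<zeta>"
    by (rule twist_squarefree_multiplicative[OF \<zeta>])
  have Re_le: "Re (\<zeta> i) \<le> 1" if "i \<in> {1..totient M}" for i
    using complex_Re_le_cmod[of "\<zeta> i"] \<zeta>[OF that] by simp
  have "Re (\<zeta> j) \<noteq> 1"
  proof
    assume "Re (\<zeta> j) = 1"
    moreover have "(Re (\<zeta> j))\<^sup>2 + (Im (\<zeta> j))\<^sup>2 = 1" using \<zeta>[OF j(1)] by (simp add: cmod_def)
    ultimately show False using j(2) by (simp add: complex_eq_iff)
  qed
  hence "Re (\<zeta> j) < 1" using Re_le[OF j(1)] by simp
  hence "(\<Sum>i=1..totient M. Re (\<zeta> i)) < (\<Sum>i=1..totient M. 1)"
    using Re_le j(1) by (intro sum_strict_mono_ex1) auto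
  hence "(\<Sum>i=1..totient M. Re (\<zeta> i)) / real (totient M) < 1"
    using M by (simp add: divide_less_eq)
  moreover have "Re ((\<Sum>i=1..totient M. \<zeta> i) / of_nat (totient M)) = (\<Sum>i=1..totient M. Re (\<zeta> i)) / real (totient M)"
    using Re_divide_of_real[of "\<Sum>i=1..totient M. \<zeta> i" "real (totient M)"] by simp
  ultimately show ?thesis by (intro mean_value_zero[OF weight_prime_mean]) simp
qed

theorem residue_count_limit:
  fixes l a :: "nat \<Rightarrow> int"
  assumes l: "\<And>i. i \<in> {1..totient M} \<Longrightarrow> l i \<ge> 1"
  shows "(\<lambda>N. real (card (A_set M r l a (real N))) / real N) \<longlonglongrightarrow>
    6 / (pi\<^sup>2 * (\<Prod>p | prime p \<and> p dvd M. 1 + 1 / real p)) / real_of_int (\<Prod>i\<in>{1..totient M}. l i)"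
proof -
  let ?I = "{1..totient M}"
  define \<beta> where "\<beta> = 6 / (pi\<^sup>2 * (\<Prod>p | prime p \<and> p dvd M. 1 + 1 / real p))"
  define len where "len = (\<lambda>i. nat (l i))"
  have len: "len i > 0" "int (len i) = l i" if "i \<in> ?I" for i using l[OF that] by (auto simp: len_def)
  define L where "L = real_of_int (\<Prod>i\<in>?I. l i)"
  have L: "L > 0"
  proof -
    have "(\<Prod>i\<in>?I. l i) > 0" using l by (intro prod_pos) force
    thus ?thesis unfolding L_def by (simp only: of_int_0_less_iff)
  qed
  \<comment> \<open>The tuples of roots of unity are indexed by exponents c i < l i;
    \<open>c0\<close> is the trivial tuple.\<close>
  define X where "X = PiE ?I (\<lambda>i. {..<len i})"
  have X: "finite X" unfolding X_def by (intro finite_PiE) auto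
  define \<zeta> where "\<zeta> = (\<lambda>(c :: nat \<Rightarrow> nat) i. cis (2 * pi * real_of_int (int (c i)) / real (len i)))"
  \<comment> \<open>The coefficient of finite Fourier inversion, the product of the (- a i)-th
    powers of the roots.\<close>
  define w where "w = (\<lambda>(c :: nat \<Rightarrow> nat). \<Prod>i\<in>?I. cis (- (2 * pi * real (c i) * real_of_int (a i) / real (len i))))"
  define c0 where "c0 = (\<lambda>i\<in>?I. 0 :: nat)"
  have c0: "c0 \<in> X" using len by (auto simp: X_def c0_def)
  define n where "n = num_prime_divs M r"
  have detect: "(if squarefree N \<and> coprime N M \<and> (\<forall>i\<in>?I. [int (n i N) = a i] (mod l i)) then of_real L else 0) =
      (\<Sum>c\<in>X. w c * twist (\<zeta> c) N)" for N
  proof (cases "squarefree N \<and> coprime N M")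
    case True
    have "(\<Sum>c\<in>X. w c * twist (\<zeta> c) N) =
        (\<Sum>c\<in>X. \<Prod>i\<in>?I. cis (2 * pi * real_of_int (int (n i N) - a i) / real (len i)) ^ c i)"
    proof (intro sum.cong refl)
      fix c
      have "cis (- (2 * pi * real (c i) * real_of_int (a i) / real (len i))) * \<zeta> c i ^ n i N =
          cis (2 * pi * real_of_int (int (n i N) - a i) / real (len i)) ^ c i" for i
        unfolding \<zeta>_def Complex.DeMoivre cis_mult
        by (intro arg_cong[of _ _ cis]) (simp add: algebra_simps add_divide_distrib diff_divide_distrib)
      thus "w c * twist (\<zeta> c) N = (\<Prod>i\<in>?I. cis (2 * pi * real_of_int (int (n i N) - a i) / real (len i)) ^ c i)"
        using True by (simp add: w_def twist_def n_def flip: prod.distrib)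
    qed
    \<comment> \<open>The sum over tuples factors into one root-of-unity sum per residue class, each
      of which tests a single congruence.\<close>
    also have "\<dots> = (\<Prod>i\<in>?I. \<Sum>k<len i. cis (2 * pi * real_of_int (int (n i N) - a i) / real (len i)) ^ k)"
      unfolding X_def by (rule prod_sum_PiE[symmetric]) auto
    also have "\<dots> = (\<Prod>i\<in>?I. if [int (n i N) = a i] (mod l i) then of_int (l i) else 0)"
    proof (intro prod.cong refl)
      fix i assume i: "i \<in> ?I"
      show "(\<Sum>k<len i. cis (2 * pi * real_of_int (int (n i N) - a i) / real (len i)) ^ k) =
          (if [int (n i N) = a i] (mod l i) then of_int (l i) else 0)"
        unfolding sum_roots_of_unity[OF len(1)[OF i]] len(2)[OF i] cong_iff_dvd_diff
        by (simp flip: len(2)[OF i])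
    qed
    also have "\<dots> = (if \<forall>i\<in>?I. [int (n i N) = a i] (mod l i) then of_real L else 0)"
      by (auto simp: L_def intro!: prod.cong)
    finally show ?thesis using True by simp
  next
    case False
    thus ?thesis by (auto simp: twist_def)
  qed
  have count: "of_nat (card (A_set M r l a (real N))) * complex_of_real L = (\<Sum>c\<in>X. w c * (\<Sum>k=1..N. twist (\<zeta> c) k))" for N
  proof -
    have "A_set M r l a (real N) = {k\<in>{1..N}. squarefree k \<and> coprime k M \<and> (\<forall>i\<in>?I. [int (n i k) = a i] (mod l i))}"
      unfolding A_set_def n_def by auto
    hence "of_nat (card (A_set M r l a (real N))) * complex_of_real L =
        (\<Sum>k\<in>{k\<in>{1..N}. squarefree k \<and> coprime k M \<and> (\<forall>i\<in>?I. [int (n i k) = a i] (mod l i))}. of_real L)"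
      by simp
    also have "\<dots> = (\<Sum>k=1..N. if squarefree k \<and> coprime k M \<and> (\<forall>i\<in>?I. [int (n i k) = a i] (mod l i)) then of_real L else 0)"
      by (rule sum.inter_filter) simp
    also have "\<dots> = (\<Sum>k=1..N. \<Sum>c\<in>X. w c * twist (\<zeta> c) k)" by (simp only: detect)
    also have "\<dots> = (\<Sum>c\<in>X. w c * (\<Sum>k=1..N. twist (\<zeta> c) k))"
      unfolding sum_distrib_left by (rule sum.swap)
    finally show ?thesis .
  qed
  have lim: "(\<lambda>N. (\<Sum>k=1..N. twist (\<zeta> c) k) / of_nat N) \<longlonglongrightarrow> (if c = c0 then of_real \<beta> else 0)" if c: "c \<in> X" for c
  proof (cases "c = c0")
    case True
    have tw: "twist (\<zeta> c) k = (if squarefree k \<and> coprime k M then 1 else 0)" for k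
      using True by (simp add: twist_def \<zeta>_def c0_def)
    have "(\<Sum>k=1..N. twist (\<zeta> c) k) = of_nat (sqf_count M N)" for N
    proof -
      have "{k. k \<le> N \<and> squarefree k \<and> coprime k M} = {k\<in>{1..N}. squarefree k \<and> coprime k M}"
        using not_squarefree_0[where 'a = nat] by (auto simp: Suc_le_eq intro!: Nat.gr0I)
      moreover have "(\<Sum>k=1..N. twist (\<zeta> c) k) = (\<Sum>k\<in>{k\<in>{1..N}. squarefree k \<and> coprime k M}. 1)"
        unfolding tw by (rule sum.inter_filter[symmetric]) simp
      ultimately show ?thesis by (simp add: sqf_count_def)
    qed
    moreover have "(\<lambda>N. complex_of_real (real (sqf_count M N) / real N)) \<longlonglongrightarrow> of_real \<beta>"
      unfolding \<beta>_def by (intro tendsto_of_real sqf_count_asymp M)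
    ultimately show ?thesis using True by simp
  next
    case False
    obtain j where j: "j \<in> ?I" "c j \<noteq> 0"
    proof -
      have "\<exists>j\<in>?I. c j \<noteq> 0"
      proof (rule ccontr)
        assume "\<not> (\<exists>j\<in>?I. c j \<noteq> 0)"
        hence "c = c0" using c by (auto simp: X_def c0_def PiE_def extensional_def fun_eq_iff)
        thus False using False by simp
      qed
      thus ?thesis using that by blast
    qed
    have "c j < len j" using c j by (auto simp: X_def PiE_def Pi_def)
    hence "\<not> int (len j) dvd int (c j)" using j(2) by (auto dest: dvd_imp_le)
    hence "\<zeta> c j \<noteq> 1" unfolding \<zeta>_def using cis_2pi_fraction_eq_1_iff[OF len(1)[OF j(1)], of "int (c j)"] by simp
    thus ?thesis using twist_mean_zero[of "\<zeta> c", OF _ j(1)] False by (simp add: \<zeta>_def)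
  qed
  have "(\<lambda>N. \<Sum>c\<in>X. w c * ((\<Sum>k=1..N. twist (\<zeta> c) k) / of_nat N)) \<longlonglongrightarrow> (\<Sum>c\<in>X. w c * (if c = c0 then of_real \<beta> else 0))"
    by (intro tendsto_intros lim)
  also have "(\<Sum>c\<in>X. w c * (if c = c0 then of_real \<beta> else 0)) = (\<Sum>c\<in>X. if c = c0 then w c0 * of_real \<beta> else 0)"
    by (intro sum.cong) auto
  also have "\<dots> = w c0 * of_real \<beta>" using X c0 by (simp add: sum.delta)
  also have "w c0 = 1" unfolding w_def c0_def by (intro prod.neutral) auto
  also have "(\<lambda>N. \<Sum>c\<in>X. w c * ((\<Sum>k=1..N. twist (\<zeta> c) k) / of_nat N)) =
      (\<lambda>N. complex_of_real (real (card (A_set M r l a (real N))) * L / real N))"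
  proof
    fix N
    have "(\<Sum>c\<in>X. w c * ((\<Sum>k=1..N. twist (\<zeta> c) k) / of_nat N)) = (\<Sum>c\<in>X. w c * (\<Sum>k=1..N. twist (\<zeta> c) k)) / of_nat N"
      unfolding times_divide_eq_right by (rule sum_divide_distrib[symmetric])
    thus "(\<Sum>c\<in>X. w c * ((\<Sum>k=1..N. twist (\<zeta> c) k) / of_nat N)) = complex_of_real (real (card (A_set M r l a (real N))) * L / real N)"
      unfolding count[symmetric] by simp
  qed
  finally have "(\<lambda>N. real (card (A_set M r l a (real N))) * L / real N) \<longlonglongrightarrow> \<beta>"
    by (simp only: mult_1 tendsto_of_real_iff)
  hence "(\<lambda>N. real (card (A_set M r l a (real N))) * L / real N / L) \<longlonglongrightarrow> \<beta> / L"
    using L by (intro tendsto_intros) auto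
  moreover have "x * L / y / L = x / y" for x y using L by simp
  ultimately have "(\<lambda>N. real (card (A_set M r l a (real N))) / real N) \<longlonglongrightarrow> \<beta> / L" by simp
  thus ?thesis by (simp only: \<beta>_def L_def)
qed

end

theorem theorem1p1:
  fixes M :: nat and r l a :: "nat \<Rightarrow> int"
  assumes "M \<ge> 3"
    and "unit_reps M r"
    and "\<And>i. i \<in> {1..totient M} \<Longrightarrow> l i \<ge> 1"
    and "\<And>i. i \<in> {1..totient M} \<Longrightarrow> 0 \<le> a i \<and> a i \<le> l i - 1"
  shows "(\<lambda>x::real. real (card (A_set M r l a x))) \<sim>[at_top]
         (\<lambda>x. 6 * x / (pi\<^sup>2 * real_of_int (\<Prod>i\<in>{1..totient M}. l i) *
                 (\<Prod>p\<in>{p::nat. prime p \<and> p dvd M}. 1 + 1 / real p)))"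
proof -
  interpret unit_representatives M r by standard (use assms(1,2) in auto)
  define c where "c = 6 / (pi\<^sup>2 * (\<Prod>p | prime p \<and> p dvd M. 1 + 1 / real p)) / real_of_int (\<Prod>i\<in>{1..totient M}. l i)"
  have "(\<Prod>i\<in>{1..totient M}. l i) > 0" using assms(3) by (intro prod_pos) force
  moreover have "(\<Prod>p | prime p \<and> p dvd M. 1 + 1 / real p) > 0" by (intro prod_pos) (auto intro: add_pos_nonneg)
  ultimately have c: "c > 0" unfolding c_def by (intro divide_pos_pos mult_pos_pos) (auto simp only: of_int_0_less_iff, auto)
  \<comment> \<open>The limit is known along integers. The set depends on x only through its integer
    part, and the quotient of the integer part by x tends to 1.\<close>
  have fl: "filterlim (\<lambda>x::real. nat \<lfloor>x\<rfloor>) at_top at_top" by real_asymp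
  have "((\<lambda>x::real. real (card (A_set M r l a (real (nat \<lfloor>x\<rfloor>)))) / real (nat \<lfloor>x\<rfloor>)) \<longlongrightarrow> c) at_top"
    using filterlim_compose[OF residue_count_limit[OF assms(3), where a = a] fl] unfolding c_def by simp
  moreover have "((\<lambda>x::real. real (nat \<lfloor>x\<rfloor>) / x) \<longlongrightarrow> 1) at_top" by real_asymp
  ultimately have "((\<lambda>x::real. real (card (A_set M r l a (real (nat \<lfloor>x\<rfloor>)))) / real (nat \<lfloor>x\<rfloor>) * (real (nat \<lfloor>x\<rfloor>) / x)) \<longlongrightarrow> c * 1) at_top"
    by (rule tendsto_mult)
  moreover have "eventually (\<lambda>x::real. real (card (A_set M r l a (real (nat \<lfloor>x\<rfloor>)))) / real (nat \<lfloor>x\<rfloor>) * (real (nat \<lfloor>x\<rfloor>) / x) =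
      real (card (A_set M r l a x)) / x) at_top"
    using eventually_ge_at_top[of 1]
  proof eventually_elim
    case (elim x)
    have "real N \<le> real (nat \<lfloor>x\<rfloor>) \<longleftrightarrow> real N \<le> x" for N
    proof -
      have "real N \<le> real (nat \<lfloor>x\<rfloor>) \<longleftrightarrow> int N \<le> \<lfloor>x\<rfloor>" using elim unfolding of_nat_le_iff by (simp only: le_nat_iff zero_le_floor)
      also have "\<dots> \<longleftrightarrow> real N \<le> x" by (simp add: le_floor_iff)
      finally show ?thesis .
    qed
    hence "A_set M r l a (real (nat \<lfloor>x\<rfloor>)) = A_set M r l a x" unfolding A_set_def by simp
    moreover have "nat \<lfloor>x\<rfloor> > 0" using elim by (simp only: zero_less_nat_eq zero_less_floor)
    hence "real (nat \<lfloor>x\<rfloor>) \<noteq> 0" by (simp only: of_nat_eq_0_iff)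
    ultimately show ?case
      unfolding times_divide_times_eq by (metis mult.commute mult_divide_mult_cancel_left)
  qed
  ultimately have "((\<lambda>x::real. real (card (A_set M r l a x)) / x) \<longlongrightarrow> c) at_top"
    using Lim_transform_eventually by force
  from asymp_equivI'_const[OF this] c
  have "(\<lambda>x::real. real (card (A_set M r l a x))) \<sim>[at_top] (\<lambda>x. c * x)" by simp
  also have "(\<lambda>x. c * x) = (\<lambda>x. 6 * x / (pi\<^sup>2 * real_of_int (\<Prod>i\<in>{1..totient M}. l i) *
                 (\<Prod>p\<in>{p::nat. prime p \<and> p dvd M}. 1 + 1 / real p)))"
    by (simp add: c_def fun_eq_iff mult_ac)
  finally show ?thesis .
qed

end
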